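(* Let $s\in\mathcal S$ be a scalar Schur-class function, let $t_1,\dots,t_k\in\mathbb T$ be distinct points, let $n_1,\dots,n_k$ be nonnegative integers, let $\{f_{ij}\}$ ($0\le j\le n_i$, $1\le i\le k$) be complex numbers, and assume that $$\liminf_{z\to t_i}\frac{\partial^{2n_i}}{\partial z^{n_i}\partial\bar z^{n_i}}\,\frac{1-|s(z)|^2}{1-|z|^2}<\infty\qquad(i=1,\dots,k),$$ where $z\to t_i$ unrestrictedly in $\mathbb D$. Then there exists $f\in\mathcal H(K_s)$ with $\|f\|_{\mathcal H(K_s)}\le1$ and $$f_j(t_i):=\lim_{z\to t_i}\frac{f^{(j)}(z)}{j!}=f_{ij}\qquad(j=0,\dots,n_i,\ i=1,\dots,k)$$ (nontangential limits) if and only if $P\ge\mathbf x\mathbf x^*$, where $\mathbf x\in\mathbb C^N$, $N=\sum_{i=1}^k(n_i+1)$, is the column vector $$\mathbf x=\begin{bmatrix}\mathbf x_1\\ \vdots\\ \mathbf x_k\end{bmatrix},\qquad\mathbf x_i=\begin{bmatrix}f_{i,0}\\ \vdots\\ f_{i,n_i}\end{bmatrix},$$ and $P=[P_{ij}]_{i,j=1}^k$ is the $N\times N$ block matrix defined in the context in terms of the boundary limits of $s$.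
   Context: $\mathbb D$ is the open unit disk and $\mathbb T$ the unit circle. $\mathcal S$ is the set of analytic functions $s:\mathbb D\to\mathbb C$ with $|s|\le1$. $\mathcal H(K_s)$ is the de Branges–Rovnyak space, the reproducing kernel Hilbert space on $\mathbb D$ with kernel $K_s(z,\zeta)=\frac{1-s(z)\overline{s(\zeta)}}{1-z\bar\zeta}$. Under the stated Carathéodory–Julia conditions it is known that the nontangential boundary limits $f_j(t_i)=\lim_{z\to t_i}f^{(j)}(z)/j!$ exist for every $f\in\mathcal H(K_s)$ and $0\le j\le n_i$, and that the nontangential limits $s_{ij}=s_{i,j}:=\lim_{z\to t_i}s^{(j)}(z)/j!$ exist for $0\le j\le2n_i+1$. The blocks of $P$ are $$P_{ij}=H_{ij}\,\mathbf\Psi_{n_j}(t_j)\begin{bmatrix}\overline s_{j,0}&\cdots&\overline s_{j,n_j}\\ &\ddots&\vdots\\ 0&&\overline s_{j,0}\end{bmatrix},$$ where the last factor is upper triangular Toeplitz; $\mathbf\Psi_n(t)=[\Psi_{j\ell}]_{j,\ell=0}^n$ is upper triangular with $\Psi_{j\ell}=(-1)^\ell\binom{\ell}{j}t^{\ell+j+1}$ for $0\le j\le\ell\le n$ (and $0$ for $j>\ell$); $H_{ii}=[s_{i,\ell+r+1}]_{\ell,r=0}^{n_i}$ is a Hankel matrix; and for $i\ne j$ the matrix $H_{ij}$ has entries $$[H_{ij}]_{r,m}=\sum_{\ell=0}^r(-1)^{r-\ell}\binom{m+r-\ell}{m}\frac{s_{i,\ell}}{(t_i-t_j)^{m+r-\ell+1}}-\sum_{\ell=0}^m(-1)^r\binom{m+r-\ell}{r}\frac{s_{j,\ell}}{(t_i-t_j)^{m+r-\ell+1}}$$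 for $r=0,\dots,n_i$, $m=0,\dots,n_j$. $P\ge\mathbf x\mathbf x^*$ means that $P-\mathbf x\mathbf x^*$ is positive semidefinite. *)

theory Defs
  imports
    "HOL-Complex_Analysis.Complex_Analysis"
    "Jordan_Normal_Form.Schur_Decomposition"
begin

definition schur_class :: "(complex \<Rightarrow> complex) set" where
  "schur_class = {s. s holomorphic_on ball 0 1 \<and> (\<forall>z\<in>ball 0 1. cmod (s z) \<le> 1)}"

text \<open>
  Reproducing kernel Hilbert spaces of complex functions on a set \<open>X\<close>. Functions on \<open>X\<close> are
  represented by their extension by 0 outside \<open>X\<close>. The inner product is linear in its first
  argument. By the Moore--Aronszajn uniqueness theorem, \<open>X\<close> and \<open>K\<close> determine \<open>H\<close> and the
  values of \<open>ip\<close> on \<open>H\<close>.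
\<close>

definition rkhs_norm :: "(('a \<Rightarrow> complex) \<Rightarrow> ('a \<Rightarrow> complex) \<Rightarrow> complex) \<Rightarrow> ('a \<Rightarrow> complex) \<Rightarrow> real"
  where "rkhs_norm ip f = sqrt (Re (ip f f))"

locale rkhs =
  fixes X :: "'a set"
    and K :: "'a \<Rightarrow> 'a \<Rightarrow> complex"
    and H :: "('a \<Rightarrow> complex) set"
    and ip :: "('a \<Rightarrow> complex) \<Rightarrow> ('a \<Rightarrow> complex) \<Rightarrow> complex"
  assumes support: "f \<in> H \<Longrightarrow> z \<notin> X \<Longrightarrow> f z = 0"
    and zero_mem: "(\<lambda>_. 0) \<in> H"
    and add_mem: "f \<in> H \<Longrightarrow> g \<in> H \<Longrightarrow> (\<lambda>z. f z + g z) \<in> H"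
    and scale_mem: "f \<in> H \<Longrightarrow> (\<lambda>z. c * f z) \<in> H"
    and ip_add: "f \<in> H \<Longrightarrow> g \<in> H \<Longrightarrow> h \<in> H \<Longrightarrow> ip (\<lambda>z. f z + g z) h = ip f h + ip g h"
    and ip_scale: "f \<in> H \<Longrightarrow> h \<in> H \<Longrightarrow> ip (\<lambda>z. c * f z) h = c * ip f h"
    and ip_cnj: "f \<in> H \<Longrightarrow> g \<in> H \<Longrightarrow> ip g f = cnj (ip f g)"
    and ip_nonneg: "f \<in> H \<Longrightarrow> 0 \<le> Re (ip f f)"
    and ip_definite: "f \<in> H \<Longrightarrow> ip f f = 0 \<Longrightarrow> f = (\<lambda>_. 0)"
    and complete: "\<lbrakk> \<And>m. F m \<in> H;
        \<And>e. e > 0 \<Longrightarrow> \<exists>M. \<forall>m\<ge>M. \<forall>n\<ge>M. rkhs_norm ip (\<lambda>z. F m z - F n z) < e \<rbrakk>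
      \<Longrightarrow> \<exists>f\<in>H. (\<lambda>m. rkhs_norm ip (\<lambda>z. F m z - f z)) \<longlonglongrightarrow> 0"
    and kernel_mem: "w \<in> X \<Longrightarrow> (\<lambda>z. if z \<in> X then K z w else 0) \<in> H"
    and reproducing: "f \<in> H \<Longrightarrow> w \<in> X \<Longrightarrow> ip f (\<lambda>z. if z \<in> X then K z w else 0) = f w"

definition dbr_kernel :: "(complex \<Rightarrow> complex) \<Rightarrow> complex \<Rightarrow> complex \<Rightarrow> complex" where
  "dbr_kernel s z w = (1 - s z * cnj (s w)) / (1 - z * cnj w)"

definition stolz :: "real \<Rightarrow> complex \<Rightarrow> complex set" where
  "stolz a t = {z \<in> ball 0 1. cmod (z - t) < a * (1 - cmod z)}"

definition nontangential :: "complex \<Rightarrow> complex filter" where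
  "nontangential t = (SUP a\<in>{1<..}. at t within stolz a t)"

lemma tendsto_nontangential_iff:
  "(g \<longlongrightarrow> L) (nontangential t) \<longleftrightarrow> (\<forall>a>1. (g \<longlongrightarrow> L) (at t within stolz a t))"
  unfolding nontangential_def filterlim_def filtermap_SUP by (auto simp: SUP_le_iff)

definition taylor_coeff :: "(complex \<Rightarrow> complex) \<Rightarrow> nat \<Rightarrow> complex \<Rightarrow> complex" where
  "taylor_coeff f j z = (deriv ^^ j) f z / fact j"

definition bdry_coeff :: "(complex \<Rightarrow> complex) \<Rightarrow> complex \<Rightarrow> nat \<Rightarrow> complex" where
  "bdry_coeff s t j = Lim (nontangential t) (taylor_coeff s j)"

text \<open>The Wirtinger derivatives \<open>\<partial>/\<partial>z\<close> and \<open>\<partial>/\<partial>z\<close>-bar.\<close>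

definition wirtinger :: "(complex \<Rightarrow> complex) \<Rightarrow> complex \<Rightarrow> complex" where
  "wirtinger g z =
     (frechet_derivative g (at z) 1 - \<i> * frechet_derivative g (at z) \<i>) / 2"

definition wirtinger_bar :: "(complex \<Rightarrow> complex) \<Rightarrow> complex \<Rightarrow> complex" where
  "wirtinger_bar g z =
     (frechet_derivative g (at z) 1 + \<i> * frechet_derivative g (at z) \<i>) / 2"

definition cj_quotient :: "(complex \<Rightarrow> complex) \<Rightarrow> complex \<Rightarrow> complex" where
  "cj_quotient s z = of_real ((1 - (cmod (s z))\<^sup>2) / (1 - (cmod z)\<^sup>2))"

text \<open>
  The mixed derivative below is real-valued, since it is the \<open>n\<close>-th iterate of a quarter of the
  Laplacian applied to a real-valued function; taking the real part only changes the type.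
\<close>

definition cj_condition :: "(complex \<Rightarrow> complex) \<Rightarrow> complex \<Rightarrow> nat \<Rightarrow> bool" where
  "cj_condition s t n \<longleftrightarrow>
     Liminf (at t within ball 0 1)
       (\<lambda>z. ereal (Re ((wirtinger ^^ n) ((wirtinger_bar ^^ n) (cj_quotient s)) z))) < \<infinity>"

definition Psi_mat :: "nat \<Rightarrow> complex \<Rightarrow> complex mat" where
  "Psi_mat n t = mat (n + 1) (n + 1)
     (\<lambda>(j, l). if j \<le> l then (-1) ^ l * of_nat (l choose j) * t ^ (l + j + 1) else 0)"

definition toeplitz_mat :: "nat \<Rightarrow> (nat \<Rightarrow> complex) \<Rightarrow> complex mat" where
  "toeplitz_mat n c = mat (n + 1) (n + 1) (\<lambda>(a, b). if a \<le> b then cnj (c (b - a)) else 0)"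

definition hankel_mat :: "nat \<Rightarrow> (nat \<Rightarrow> complex) \<Rightarrow> complex mat" where
  "hankel_mat n c = mat (n + 1) (n + 1) (\<lambda>(l, r). c (l + r + 1))"

definition H_off :: "nat \<Rightarrow> nat \<Rightarrow> complex \<Rightarrow> complex \<Rightarrow> (nat \<Rightarrow> complex) \<Rightarrow> (nat \<Rightarrow> complex)
    \<Rightarrow> complex mat" where
  "H_off n n' t t' c c' = mat (n + 1) (n' + 1) (\<lambda>(r, m).
     (\<Sum>l=0..r. (-1) ^ (r - l) * of_nat ((m + r - l) choose m) * c l / (t - t') ^ (m + r - l + 1))
   - (\<Sum>l=0..m. (-1) ^ r * of_nat ((m + r - l) choose r) * c' l / (t - t') ^ (m + r - l + 1)))"

definition H_block :: "(complex \<Rightarrow> complex) \<Rightarrow> (nat \<Rightarrow> complex) \<Rightarrow> (nat \<Rightarrow> nat) \<Rightarrow> nat \<Rightarrow> nat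
    \<Rightarrow> complex mat" where
  "H_block s t n i j =
     (if i = j then hankel_mat (n i) (bdry_coeff s (t i))
      else H_off (n i) (n j) (t i) (t j) (bdry_coeff s (t i)) (bdry_coeff s (t j)))"

definition P_block :: "(complex \<Rightarrow> complex) \<Rightarrow> (nat \<Rightarrow> complex) \<Rightarrow> (nat \<Rightarrow> nat) \<Rightarrow> nat \<Rightarrow> nat
    \<Rightarrow> complex mat" where
  "P_block s t n i j =
     H_block s t n i j * Psi_mat (n j) (t j) * toeplitz_mat (n j) (bdry_coeff s (t j))"

text \<open>
  Position \<open>p\<close> of a vector or matrix of size \<open>N\<close> corresponds to the entry \<open>p\<close> of the list
  \<open>(1,0), \<dots>, (1,n\<^sub>1), (2,0), \<dots>, (k,n\<^sub>k)\<close> of pairs (block, index within the block).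
\<close>

definition block_index :: "nat \<Rightarrow> (nat \<Rightarrow> nat) \<Rightarrow> (nat \<times> nat) list" where
  "block_index k n = concat (map (\<lambda>i. map (Pair i) [0..<n i + 1]) [1..<k + 1])"

definition block_size :: "nat \<Rightarrow> (nat \<Rightarrow> nat) \<Rightarrow> nat" where
  "block_size k n = (\<Sum>i=1..k. n i + 1)"

lemma length_block_index: "length (block_index k n) = block_size k n"
  unfolding block_index_def block_size_def by (induction k) (auto simp: length_concat)

definition P_mat :: "nat \<Rightarrow> (complex \<Rightarrow> complex) \<Rightarrow> (nat \<Rightarrow> complex) \<Rightarrow> (nat \<Rightarrow> nat)
    \<Rightarrow> complex mat" where
  "P_mat k s t n = mat (block_size k n) (block_size k n) (\<lambda>(p, q).
     case (block_index k n ! p, block_index k n ! q) of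
       ((i, r), (j, m)) \<Rightarrow> P_block s t n i j $$ (r, m))"

definition x_vec :: "nat \<Rightarrow> (nat \<Rightarrow> nat) \<Rightarrow> (nat \<Rightarrow> nat \<Rightarrow> complex) \<Rightarrow> complex vec" where
  "x_vec k n v = vec (block_size k n) (\<lambda>p. case block_index k n ! p of (i, j) \<Rightarrow> v i j)"

definition col_mat :: "complex vec \<Rightarrow> complex mat" where
  "col_mat x = mat_of_cols (dim_vec x) [x]"

text \<open>
  On complex numbers, \<open>0 \<le> c\<close> means that \<open>c\<close> is real and nonnegative, so the condition below
  makes \<open>A\<close> Hermitian.
\<close>

definition pos_semidef :: "complex mat \<Rightarrow> bool" where
  "pos_semidef A \<longleftrightarrow> square_mat A \<and>
     (\<forall>v\<in>carrier_vec (dim_row A). 0 \<le> (A *\<^sub>v v) \<bullet>c v)"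

end

theory Submission
  imports Defs "HOL-Library.Function_Algebras"
begin

text \<open>
  Write \<open>f\<^sub>j(z)\<close> for the \<open>j\<close>-th Taylor coefficient of \<open>f\<close> at \<open>z\<close>. The Caratheodory--Julia condition says that
  the functionals \<open>f \<mapsto> f\<^sub>n(z)\<close> are bounded uniformly along a sequence \<open>z \<rightarrow> t\<close>. The backward shift \<open>R\<close>
  is a contraction, and \<open>f \<mapsto> f\<^sub>n(z)\<close> sends \<open>(I - z R)\<^sup>n\<^sup>+\<^sup>1 f\<close> to \<open>(R\<^sup>n f)(0)\<close>; as
  \<open>(I - t R) (I - z R)\<^sup>-\<^sup>1\<close> is bounded on each Stolz angle at \<open>t\<close>, so are these functionals. They converge on
  the dense range of \<open>I - t R\<close>, hence everywhere, and so the boundary coefficients of order up to \<open>n\<close>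
  are given by inner products with elements of the space.
  The formula for the kernel survives the passage to the boundary. It shows that \<open>s\<close> has boundary
  coefficients up to order \<open>2 n + 1\<close> and that \<open>P\<close> is the Gram matrix of the representing elements. The
  theorem is then the solvability criterion for finitely many linear conditions in a Hilbert space.
\<close>

section \<open>Reproducing kernel Hilbert spaces\<close>

text \<open>The hypothesis becomes a statement about norms because kernel functions can be
  differentiated in norm: the mixed derivative of order \<open>n\<close> of the quotient at
  \<open>z\<close> is \<open>(n!)^2\<close> times the squared norm of the element representing the
  \<open>n\<close>-th Taylor coefficient at \<open>z\<close>. A further obstacle is that
  \<open>s\<close> need not extend holomorphically past \<open>t\<close>, so its boundary
  coefficients cannot be handled as those of a power series. Having nontangential coefficients up to
  order \<open>N\<close> is therefore shown to be equivalent to an asymptotic expansion in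
  \<open>z - t\<close> with error \<open>o((z - t)^N)\<close>, and in that form powers of
  \<open>z - t\<close> can be multiplied in and divided out. The factors of \<open>P\<close> arise
  as follows. Letting one point of the kernel identity tend to \<open>t\<close> gives, for the
  representing elements, the recursion \<open>(1 - cnj t z) b_(m+1) = z b_m - cnj s_(m+1) s\<close>.
  Its solution is a combination of the remainders of \<open>s\<close> at \<open>t\<close> divided by
  powers of \<open>z - t\<close>, and the coefficients of that combination form the product of Psi
  with the Toeplitz factor. The factor \<open>H\<close> collects the Taylor coefficients of these
  divided remainders, at \<open>t\<close> itself (Hankel) or at another node.\<close>

definition fscale :: "complex \<Rightarrow> ('a \<Rightarrow> complex) \<Rightarrow> 'a \<Rightarrow> complex" (infixr "\<cdot>\<^sub>f" 75) where
  "c \<cdot>\<^sub>f f = (\<lambda>z. c * f z)"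

lemma fscale_apply [simp]: "(c \<cdot>\<^sub>f f) z = c * f z"
  by (simp add: fscale_def)

lemma fscale_simps [simp]: "0 \<cdot>\<^sub>f f = 0" "1 \<cdot>\<^sub>f f = f" "c \<cdot>\<^sub>f 0 = 0" "c \<cdot>\<^sub>f d \<cdot>\<^sub>f f = (c * d) \<cdot>\<^sub>f f"
  by (auto simp: fun_eq_iff)

lemma fscale_add: "c \<cdot>\<^sub>f (f + g) = c \<cdot>\<^sub>f f + c \<cdot>\<^sub>f g"
  and fscale_diff: "c \<cdot>\<^sub>f (f - g) = c \<cdot>\<^sub>f f - c \<cdot>\<^sub>f g"
  by (auto simp: fun_eq_iff algebra_simps)

lemma sum_fun_apply: "(\<Sum>i\<in>A. f i) z = (\<Sum>i\<in>A. f i z :: complex)"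
  by (induction A rule: infinite_finite_induct) auto

lemma fscale_uminus_diff: "(-1) \<cdot>\<^sub>f (f - g) = g - f"
  by (auto simp: fun_eq_iff)

context rkhs
begin

abbreviation nrm :: "('a \<Rightarrow> complex) \<Rightarrow> real" where "nrm \<equiv> rkhs_norm ip"

lemma zero_in [simp]: "0 \<in> H"
  using zero_mem by (simp add: zero_fun_def)

lemma add_in [simp]: "f \<in> H \<Longrightarrow> g \<in> H \<Longrightarrow> f + g \<in> H"
  using add_mem by (simp add: plus_fun_def)

lemma fscale_in [simp]: "f \<in> H \<Longrightarrow> c \<cdot>\<^sub>f f \<in> H"
  using scale_mem by (simp add: fscale_def)

lemma diff_in [simp]: "f \<in> H \<Longrightarrow> g \<in> H \<Longrightarrow> f - g \<in> H"
proof -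
  assume "f \<in> H" "g \<in> H"
  then have "f + (-1) \<cdot>\<^sub>f g \<in> H" by simp
  also have "f + (-1) \<cdot>\<^sub>f g = f - g" by (auto simp: fun_eq_iff)
  finally show ?thesis .
qed

lemma sum_in: "(\<And>i. i \<in> A \<Longrightarrow> g i \<in> H) \<Longrightarrow> (\<Sum>i\<in>A. g i) \<in> H"
  by (induction A rule: infinite_finite_induct) auto

lemma ip_add_left: "f \<in> H \<Longrightarrow> g \<in> H \<Longrightarrow> h \<in> H \<Longrightarrow> ip (f + g) h = ip f h + ip g h"
  using ip_add by (simp add: plus_fun_def)

lemma ip_scale_left: "f \<in> H \<Longrightarrow> h \<in> H \<Longrightarrow> ip (c \<cdot>\<^sub>f f) h = c * ip f h"
  using ip_scale by (simp add: fscale_def)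

lemma ip_add_right: "f \<in> H \<Longrightarrow> g \<in> H \<Longrightarrow> h \<in> H \<Longrightarrow> ip h (f + g) = ip h f + ip h g"
  using ip_cnj[of "f + g" h] ip_cnj[of f h] ip_cnj[of g h] by (simp add: ip_add_left)

lemma ip_scale_right: "f \<in> H \<Longrightarrow> h \<in> H \<Longrightarrow> ip h (c \<cdot>\<^sub>f f) = cnj c * ip h f"
  using ip_cnj[of "c \<cdot>\<^sub>f f" h] ip_cnj[of f h] by (simp add: ip_scale_left)

lemma fdiff_eq: "f - g = f + (-1) \<cdot>\<^sub>f (g :: 'a \<Rightarrow> complex)"
  by (auto simp: fun_eq_iff)

lemma ip_diff_left: "f \<in> H \<Longrightarrow> g \<in> H \<Longrightarrow> h \<in> H \<Longrightarrow> ip (f - g) h = ip f h - ip g h"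
  unfolding fdiff_eq by (simp add: ip_add_left ip_scale_left)

lemma ip_diff_right: "f \<in> H \<Longrightarrow> g \<in> H \<Longrightarrow> h \<in> H \<Longrightarrow> ip h (f - g) = ip h f - ip h g"
  unfolding fdiff_eq by (simp add: ip_add_right ip_scale_right)

lemmas ip_simps = ip_add_left ip_add_right ip_diff_left ip_diff_right ip_scale_left ip_scale_right

lemma ip_zero_left [simp]: "h \<in> H \<Longrightarrow> ip 0 h = 0"
  using ip_scale_left[of 0 h 0] by simp

lemma ip_zero_right [simp]: "h \<in> H \<Longrightarrow> ip h 0 = 0"
  using ip_scale_right[of 0 h 0] by simp

lemma ip_sum_left: "(\<And>i. i \<in> A \<Longrightarrow> g i \<in> H) \<Longrightarrow> h \<in> H \<Longrightarrow> ip (\<Sum>i\<in>A. g i) h = (\<Sum>i\<in>A. ip (g i) h)"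
  by (induction A rule: infinite_finite_induct) (auto simp: ip_simps sum_in)

lemma ip_sum_right: "(\<And>i. i \<in> A \<Longrightarrow> g i \<in> H) \<Longrightarrow> h \<in> H \<Longrightarrow> ip h (\<Sum>i\<in>A. g i) = (\<Sum>i\<in>A. ip h (g i))"
  by (induction A rule: infinite_finite_induct) (auto simp: ip_simps sum_in)

lemma nrm_nonneg [simp]: "f \<in> H \<Longrightarrow> 0 \<le> nrm f"
  by (simp add: rkhs_norm_def ip_nonneg)

lemma ip_self: "f \<in> H \<Longrightarrow> ip f f = of_real ((nrm f)\<^sup>2)"
proof -
  assume f: "f \<in> H"
  have "Im (ip f f) = 0" using ip_cnj[OF f f] by (metis cnj.simps(2) equal_neg_zero)
  then show ?thesis using ip_nonneg[OF f] by (simp add: rkhs_norm_def complex_eq_iff)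
qed

lemma nrm_eq_0: "f \<in> H \<Longrightarrow> nrm f = 0 \<Longrightarrow> f = 0"
  using ip_self[of f] ip_definite[of f] by (simp add: zero_fun_def)

lemma nrm_zero [simp]: "nrm 0 = 0"
  by (simp add: rkhs_norm_def)

lemma nrm_square: "f \<in> H \<Longrightarrow> (nrm f)\<^sup>2 = Re (ip f f)"
  by (simp add: ip_self)

lemma nrm_fscale: "f \<in> H \<Longrightarrow> nrm (c \<cdot>\<^sub>f f) = cmod c * nrm f"
proof -
  assume f: "f \<in> H"
  have "ip (c \<cdot>\<^sub>f f) (c \<cdot>\<^sub>f f) = (c * cnj c) * ip f f" using f by (simp add: ip_simps)
  also have "\<dots> = of_real ((cmod c * nrm f)\<^sup>2)"
    unfolding ip_self[OF f] complex_norm_square[symmetric] by (simp add: power_mult_distrib)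
  finally show ?thesis using f ip_nonneg[OF f] by (simp add: rkhs_norm_def abs_mult del: of_real_power of_real_mult)
qed

lemma cauchy_schwarz: "f \<in> H \<Longrightarrow> g \<in> H \<Longrightarrow> cmod (ip f g) \<le> nrm f * nrm g"
proof (cases "nrm g = 0")
  case True
  assume f: "f \<in> H" and g: "g \<in> H"
  with True have "g = 0" by (simp add: nrm_eq_0)
  with f show ?thesis by simp
next
  case False
  assume f: "f \<in> H" and g: "g \<in> H"
  define c where "c = ip f g / of_real ((nrm g)\<^sup>2)"
  have "0 \<le> Re (ip (f - c \<cdot>\<^sub>f g) (f - c \<cdot>\<^sub>f g))" using f g by (intro ip_nonneg) simp
  also have "ip (f - c \<cdot>\<^sub>f g) (f - c \<cdot>\<^sub>f g) = ip f f - cnj c * ip f g - c * cnj (ip f g) + c * cnj c * ip g g"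
    using f g ip_cnj[of f g] by (simp add: ip_simps algebra_simps)
  also have "\<dots> = of_real ((nrm f)\<^sup>2 - (cmod (ip f g))\<^sup>2 / (nrm g)\<^sup>2)"
    using False f g complex_norm_square[of "ip f g"]
    by (simp add: ip_self c_def field_simps power2_eq_square)
  finally have "(cmod (ip f g))\<^sup>2 / (nrm g)\<^sup>2 \<le> (nrm f)\<^sup>2" by (simp del: of_real_diff)
  then have "(cmod (ip f g))\<^sup>2 \<le> (nrm f * nrm g)\<^sup>2"
    using False by (simp add: field_simps power_mult_distrib)
  then show ?thesis using f g by (meson mult_nonneg_nonneg nrm_nonneg power2_le_imp_le)
qed

lemma nrm_triangle: "f \<in> H \<Longrightarrow> g \<in> H \<Longrightarrow> nrm (f + g) \<le> nrm f + nrm g"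
proof -
  assume f: "f \<in> H" and g: "g \<in> H"
  have "(nrm (f + g))\<^sup>2 = (nrm f)\<^sup>2 + (nrm g)\<^sup>2 + 2 * Re (ip f g)"
    using f g ip_cnj[of f g] by (simp add: nrm_square ip_simps)
  also have "\<dots> \<le> (nrm f)\<^sup>2 + (nrm g)\<^sup>2 + 2 * (nrm f * nrm g)"
    using cauchy_schwarz[OF f g] complex_Re_le_cmod[of "ip f g"] by simp
  also have "\<dots> = (nrm f + nrm g)\<^sup>2" by (simp add: power2_sum)
  finally show ?thesis using f g by (meson add_nonneg_nonneg nrm_nonneg power2_le_imp_le)
qed

lemma nrm_triangle_diff: "f \<in> H \<Longrightarrow> g \<in> H \<Longrightarrow> nrm (f - g) \<le> nrm f + nrm g"
  unfolding fdiff_eq using nrm_triangle[of f "(-1) \<cdot>\<^sub>f g"] by (simp add: nrm_fscale)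

lemma nrm_diff_commute: "f \<in> H \<Longrightarrow> g \<in> H \<Longrightarrow> nrm (f - g) = nrm (g - f)"
  using nrm_fscale[of "g - f" "-1"] fscale_uminus_diff[of g f] by simp

lemma nrm_le_diff: "f \<in> H \<Longrightarrow> g \<in> H \<Longrightarrow> nrm f \<le> nrm g + nrm (f - g)"
  using nrm_triangle[of g "f - g"] by simp

lemma cauchy_sequence_converges:
  assumes "\<And>m. F m \<in> H" "\<And>e. e > 0 \<Longrightarrow> \<exists>M. \<forall>m\<ge>M. \<forall>n\<ge>M. nrm (F m - F n) < e"
  obtains f where "f \<in> H" "(\<lambda>m. nrm (F m - f)) \<longlonglongrightarrow> 0"
  using complete[of F] assms by (auto simp: fun_diff_def)

lemma tendsto_ip_right:
  assumes "v \<in> H" "\<And>m. F m \<in> H" "f \<in> H" "(\<lambda>m. nrm (F m - f)) \<longlonglongrightarrow> 0"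
  shows "(\<lambda>m. ip v (F m)) \<longlonglongrightarrow> ip v f"
proof (rule LIM_zero_cancel, rule Lim_null_comparison)
  show "\<forall>\<^sub>F m in sequentially. cmod (ip v (F m) - ip v f) \<le> nrm v * nrm (F m - f)"
    using assms(1-3) cauchy_schwarz by (simp flip: ip_diff_right)
  show "(\<lambda>m. nrm v * nrm (F m - f)) \<longlonglongrightarrow> 0"
    using tendsto_mult_right_zero[OF assms(4)] by simp
qed

lemma tendsto_nrm:
  assumes "\<And>m. F m \<in> H" "f \<in> H" "(\<lambda>m. nrm (F m - f)) \<longlonglongrightarrow> 0"
  shows "(\<lambda>m. nrm (F m)) \<longlonglongrightarrow> nrm f"
proof (rule LIM_zero_cancel, rule Lim_null_comparison[OF _ assms(3)])
  show "\<forall>\<^sub>F m in sequentially. norm (nrm (F m) - nrm f) \<le> nrm (F m - f)"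
  proof (intro always_eventually allI)
    fix m
    show "norm (nrm (F m) - nrm f) \<le> nrm (F m - f)"
      using nrm_le_diff[of "F m" f] nrm_le_diff[of f "F m"] nrm_diff_commute[of f "F m"] assms by auto
  qed
qed

text \<open>
  Both the extension and the representation of functionals: the pairs \<open>(v, y)\<close> in \<open>W\<close> prescribe
  the values \<open>y\<close> of a functional at \<open>v\<close>, and the representer is the limit of a minimising sequence of
  \<open>\<parallel>v\<parallel>\<^sup>2 - 2 Re y\<close> on \<open>W\<close>.
\<close>

lemma riesz_on_subspace:
  assumes W0: "(0, 0) \<in> W"
    and Wadd: "\<And>v y v' y'. (v, y) \<in> W \<Longrightarrow> (v', y') \<in> W \<Longrightarrow> (v + v', y + y') \<in> W"
    and Wscale: "\<And>c v y. (v, y) \<in> W \<Longrightarrow> (c \<cdot>\<^sub>f v, c * y) \<in> W"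
    and WH: "\<And>v y. (v, y) \<in> W \<Longrightarrow> v \<in> H"
    and bound: "\<And>v y. (v, y) \<in> W \<Longrightarrow> cmod y \<le> M * nrm v"
    and M: "0 \<le> M"
  obtains f where "f \<in> H" "nrm f \<le> M" "\<And>v y. (v, y) \<in> W \<Longrightarrow> ip v f = y"
    "\<And>e. 0 < e \<Longrightarrow> \<exists>v y. (v, y) \<in> W \<and> nrm (f - v) < e"
proof -
  \<comment> \<open>If \<open>f\<close> in \<open>H\<close> satisfies \<open>ip v f = y\<close> on
    \<open>W\<close>, then \<open>J (v, y)\<close> is the squared norm of \<open>v - f\<close> minus
    that of \<open>f\<close>. Minimising \<open>J\<close> thus approximates the projection of
    \<open>f\<close> onto the closure of the first components.\<close>
  define J where "J = (\<lambda>(v, y). (nrm v)\<^sup>2 - 2 * Re y)"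
  have J_lower: "- (M\<^sup>2) \<le> J p" if "p \<in> W" for p
  proof -
    obtain v y where p: "p = (v, y)" by force
    have "Re y \<le> M * nrm v" using bound[of v y] complex_Re_le_cmod[of y] that p by auto
    moreover have "0 \<le> (nrm v - M)\<^sup>2" by simp
    ultimately show ?thesis by (simp add: p J_def power2_diff algebra_simps)
  qed
  define d where "d = Inf (J ` W)"
  have bdd: "bdd_below (J ` W)" using J_lower by (intro bdd_belowI2[of W "- (M\<^sup>2)"])
  have d_le: "d \<le> J p" if "p \<in> W" for p unfolding d_def using that bdd by (auto intro: cInf_lower)
  have "\<exists>p\<in>W. J p < d + 1 / real (Suc m)" for m
  proof -
    have "\<exists>x\<in>J ` W. x < d + 1 / real (Suc m)"
      unfolding d_def using W0 bdd by (subst cInf_less_iff[symmetric]) auto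
    then show ?thesis by auto
  qed
  then obtain p where p: "\<And>m. p m \<in> W" "\<And>m. J (p m) < d + 1 / real (Suc m)" by metis
  define V Y where "V = (\<lambda>m. fst (p m))" and "Y = (\<lambda>m. snd (p m))"
  have VW: "(V m, Y m) \<in> W" for m using p(1) by (simp add: V_def Y_def)
  have VH: "V m \<in> H" for m using VW WH by blast
  have JV: "(nrm (V m))\<^sup>2 - 2 * Re (Y m) < d + 1 / real (Suc m)" for m
    using p(2)[of m] by (simp add: J_def V_def Y_def split_beta)
  \<comment> \<open>Parallelogram law: the midpoint of two near-minimisers is again in
    \<open>W\<close>, so \<open>J\<close> is at least \<open>d\<close> there, which leaves little
    room for their difference.\<close>
  have par: "(nrm (V m - V k))\<^sup>2 \<le> 2 * (1 / real (Suc m) + 1 / real (Suc k))" for m k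
  proof -
    have mid: "((1/2) \<cdot>\<^sub>f (V m + V k), (1/2) * (Y m + Y k)) \<in> W" using VW by (intro Wscale Wadd)
    have "d \<le> (nrm ((1/2) \<cdot>\<^sub>f (V m + V k)))\<^sup>2 - Re (Y m + Y k)"
      using d_le[OF mid] by (simp add: J_def add_divide_distrib)
    also have "(nrm ((1/2) \<cdot>\<^sub>f (V m + V k)))\<^sup>2 = (nrm (V m + V k))\<^sup>2 / 4"
      using VH by (simp add: nrm_fscale power_mult_distrib power2_eq_square)
    finally have A: "4 * d \<le> (nrm (V m + V k))\<^sup>2 - 4 * Re (Y m + Y k)" by simp
    have B: "(nrm (V m + V k))\<^sup>2 + (nrm (V m - V k))\<^sup>2 = 2 * (nrm (V m))\<^sup>2 + 2 * (nrm (V k))\<^sup>2"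
      using VH by (simp add: nrm_square ip_simps)
    show ?thesis using A B JV[of m] JV[of k] by (simp add: algebra_simps)
  qed
  have "\<exists>N. \<forall>m\<ge>N. \<forall>k\<ge>N. nrm (V m - V k) < e" if "e > 0" for e
  proof -
    have "0 < e\<^sup>2 / 4" using that by simp
    from reals_Archimedean[OF this] obtain N where N: "inverse (real (Suc N)) < e\<^sup>2 / 4" by blast
    have "nrm (V m - V k) < e" if "m \<ge> N" "k \<ge> N" for m k
    proof -
      have "1 / real (Suc m) \<le> 1 / real (Suc N)" "1 / real (Suc k) \<le> 1 / real (Suc N)"
        using that by (auto intro: divide_left_mono)
      with par[of m k] N have "(nrm (V m - V k))\<^sup>2 < e\<^sup>2" by (simp add: inverse_eq_divide)
      then show ?thesis using \<open>e > 0\<close> by (meson less_imp_le power_less_imp_less_base)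
    qed
    then show ?thesis by blast
  qed
  from cauchy_sequence_converges[of V, OF VH this] obtain f where f: "f \<in> H" and lim: "(\<lambda>m. nrm (V m - f)) \<longlonglongrightarrow> 0"
    by blast
  have rep: "ip v f = y" if vy: "(v, y) \<in> W" for v y
  proof -
    have v: "v \<in> H" using vy WH by blast
    define \<delta> where "\<delta> = ip v f - y"
    \<comment> \<open>Perturbing a minimiser by \<open>c\<close> times \<open>v\<close> with
      \<open>c = - \<epsilon> cnj \<delta>\<close> has first-order effect
      \<open>- 2 \<epsilon> |\<delta>|^2\<close>. This size of \<open>\<epsilon>\<close> keeps the
      quadratic term strictly smaller, so minimality forces \<open>\<delta> = 0\<close>.\<close>
    define \<epsilon> where "\<epsilon> = 1 / (1 + (nrm v)\<^sup>2)"
    have \<epsilon>: "\<epsilon> > 0" by (simp add: \<epsilon>_def add_pos_nonneg)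
    define c where "c = - of_real \<epsilon> * cnj \<delta>"
    have var: "- 1 / real (Suc m) \<le> 2 * Re (c * (ip v (V m) - y)) + (cmod c)\<^sup>2 * (nrm v)\<^sup>2" for m
    proof -
      have "(V m + c \<cdot>\<^sub>f v, Y m + c * y) \<in> W" using VW vy by (intro Wadd Wscale)
      from d_le[OF this] have "d \<le> (nrm (V m + c \<cdot>\<^sub>f v))\<^sup>2 - 2 * Re (Y m + c * y)" by (simp add: J_def)
      also have "(nrm (V m + c \<cdot>\<^sub>f v))\<^sup>2
          = (nrm (V m))\<^sup>2 + 2 * Re (c * ip v (V m)) + (cmod c * nrm v)\<^sup>2"
      proof -
        have "(nrm (V m + c \<cdot>\<^sub>f v))\<^sup>2 = Re (ip (V m) (V m) + (cnj (c * ip v (V m)) + c * ip v (V m))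
            + ip (c \<cdot>\<^sub>f v) (c \<cdot>\<^sub>f v))"
          using VH[of m] v ip_cnj[of v "V m"] by (simp add: nrm_square ip_simps algebra_simps)
        then show ?thesis using VH[of m] v by (simp add: ip_self nrm_fscale)
      qed
      finally show ?thesis using JV[of m] by (simp add: algebra_simps power_mult_distrib)
    qed
    have "0 \<le> 2 * Re (c * (ip v f - y)) + (cmod c)\<^sup>2 * (nrm v)\<^sup>2"
    proof (rule LIMSEQ_le)
      show "(\<lambda>m. - 1 / real (Suc m)) \<longlonglongrightarrow> 0"
        using tendsto_minus[OF LIMSEQ_Suc[OF lim_1_over_n]] by simp
      show "(\<lambda>m. 2 * Re (c * (ip v (V m) - y)) + (cmod c)\<^sup>2 * (nrm v)\<^sup>2)
          \<longlonglongrightarrow> 2 * Re (c * (ip v f - y)) + (cmod c)\<^sup>2 * (nrm v)\<^sup>2"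
        by (intro tendsto_intros tendsto_ip_right v VH f lim)
    qed (use var in auto)
    also have "c * (ip v f - y) = - of_real (\<epsilon> * (cmod \<delta>)\<^sup>2)"
      unfolding c_def \<delta>_def[symmetric] of_real_mult complex_norm_square by simp
    also have "(cmod c)\<^sup>2 = \<epsilon>\<^sup>2 * (cmod \<delta>)\<^sup>2" using \<epsilon> by (simp add: c_def norm_mult power_mult_distrib)
    finally have "0 \<le> \<epsilon> * (cmod \<delta>)\<^sup>2 * (\<epsilon> * (nrm v)\<^sup>2 - 2)"
      by (simp add: algebra_simps power2_eq_square)
    moreover have "\<epsilon> * (nrm v)\<^sup>2 < 2"
    proof -
      have "0 < 1 + (nrm v)\<^sup>2" by (simp add: add_pos_nonneg)
      then show ?thesis by (simp add: \<epsilon>_def pos_divide_less_eq)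
    qed
    ultimately have "\<epsilon> * (cmod \<delta>)\<^sup>2 \<le> 0"
      by (smt (verit) mult_nonneg_nonpos2 mult_pos_neg zero_le_mult_iff)
    then show ?thesis using \<epsilon> by (simp add: mult_le_0_iff \<delta>_def)
  qed
  have "nrm f \<le> M"
  proof -
    \<comment> \<open>Since \<open>V m\<close> belongs to \<open>W\<close>, the real part of
      \<open>ip f (V m)\<close> is that of \<open>Y m\<close>, to which the bound applies; the limit
      gives this inequality, and one factor \<open>nrm f\<close> cancels.\<close>
    have "Re (ip f f) \<le> M * nrm f"
    proof (rule LIMSEQ_le)
      show "(\<lambda>m. Re (ip f (V m))) \<longlonglongrightarrow> Re (ip f f)"
        by (intro tendsto_intros tendsto_ip_right VH f lim)
      show "(\<lambda>m. M * nrm (V m)) \<longlonglongrightarrow> M * nrm f"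
        by (intro tendsto_intros tendsto_nrm VH f lim)
      have "Re (ip f (V m)) \<le> M * nrm (V m)" for m
        using rep[OF VW[of m]] bound[OF VW[of m]] ip_cnj[OF VH[of m] f] complex_Re_le_cmod[of "Y m"] by simp
      then show "\<exists>N. \<forall>n\<ge>N. Re (ip f (V n)) \<le> M * nrm (V n)" by blast
    qed
    then have "nrm f * nrm f \<le> M * nrm f" by (simp add: nrm_square[OF f, symmetric] power2_eq_square)
    then show ?thesis using M nrm_nonneg[OF f] by (cases "nrm f = 0") auto
  qed
  moreover have "\<exists>v y. (v, y) \<in> W \<and> nrm (f - v) < e" if "0 < e" for e
  proof -
    from order_tendstoD(2)[OF lim that] obtain m where "nrm (V m - f) < e"
      by (meson eventually_happens trivial_limit_sequentially)
    then show ?thesis using VW nrm_diff_commute[OF VH f] by metis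
  qed
  ultimately show ?thesis using that f rep by blast
qed

lemma riesz_functional:
  assumes add: "\<And>f g. f \<in> H \<Longrightarrow> g \<in> H \<Longrightarrow> \<phi> (f + g) = \<phi> f + \<phi> g"
    and scale: "\<And>c f. f \<in> H \<Longrightarrow> \<phi> (c \<cdot>\<^sub>f f) = c * \<phi> f"
    and bound: "\<And>f. f \<in> H \<Longrightarrow> cmod (\<phi> f) \<le> M * nrm f" and M: "0 \<le> M"
  shows "\<exists>g\<in>H. \<forall>f\<in>H. ip f g = \<phi> f"
proof -
  define W where "W = {(f, \<phi> f) | f. f \<in> H}"
  have "(0, 0) \<in> W" using scale[of 0 0] by (auto simp: W_def)
  then obtain g where "g \<in> H" "\<And>v y. (v, y) \<in> W \<Longrightarrow> ip v g = y"
    by (rule riesz_on_subspace[of W M]) (use M in \<open>auto simp: W_def add scale bound\<close>)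
  then show ?thesis by (auto simp: W_def)
qed

text \<open>The functional \<open>v \<mapsto> ip v f\<close> on \<open>V\<close> has a representer
  \<open>g\<close> in the closure of \<open>V\<close>, and \<open>f - g\<close> is orthogonal to
  \<open>V\<close>; hence \<open>f = g\<close>. This is the projection theorem without forming a
  closed subspace.\<close>

lemma dense_if_orthogonal_trivial:
  assumes V: "V \<subseteq> H" "0 \<in> V" "\<And>u v. u \<in> V \<Longrightarrow> v \<in> V \<Longrightarrow> u + v \<in> V" "\<And>c v. v \<in> V \<Longrightarrow> c \<cdot>\<^sub>f v \<in> V"
    and orth: "\<And>h. h \<in> H \<Longrightarrow> (\<And>v. v \<in> V \<Longrightarrow> ip v h = 0) \<Longrightarrow> h = 0"
    and f: "f \<in> H" and e: "0 < e"
  shows "\<exists>v\<in>V. nrm (f - v) < e"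
proof -
  define W where "W = {(v, ip v f) | v. v \<in> V}"
  have VH: "v \<in> H" if "v \<in> V" for v using V that by blast
  have "(0, 0) \<in> W" using V(2) f by (auto simp: W_def)
  then obtain g where g: "g \<in> H" "\<And>v y. (v, y) \<in> W \<Longrightarrow> ip v g = y"
      "\<And>e. 0 < e \<Longrightarrow> \<exists>v y. (v, y) \<in> W \<and> nrm (g - v) < e"
    by (rule riesz_on_subspace[of W "nrm f"])
      (use V VH f in \<open>auto simp: W_def ip_simps cauchy_schwarz mult.commute[of "nrm f"]\<close>)
  have "f - g = 0" using f g(1) g(2) VH by (intro orth) (auto simp: W_def ip_simps)
  then show ?thesis using g(3)[OF e] by (auto simp: W_def)
qed

section \<open>Kernel functions and their linear combinations\<close>

definition kfun :: "'a \<Rightarrow> 'a \<Rightarrow> complex" where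
  "kfun w = (\<lambda>z. if z \<in> X then K z w else 0)"

lemma kfun_in [simp]: "w \<in> X \<Longrightarrow> kfun w \<in> H"
  unfolding kfun_def by (rule kernel_mem)

lemma ip_kfun: "f \<in> H \<Longrightarrow> w \<in> X \<Longrightarrow> ip f (kfun w) = f w"
  unfolding kfun_def by (rule reproducing)

lemma kfun_ip: "f \<in> H \<Longrightarrow> w \<in> X \<Longrightarrow> ip (kfun w) f = cnj (f w)"
  using ip_cnj[of f "kfun w"] ip_kfun by simp

text \<open>Lists of coefficient-index pairs serve as formal combinations: concatenation is
  addition, and repeated indices need no normal form.\<close>

definition lcomb :: "('i \<Rightarrow> 'a \<Rightarrow> complex) \<Rightarrow> (complex \<times> 'i) list \<Rightarrow> 'a \<Rightarrow> complex" where
  "lcomb g xs = (\<Sum>(c, i)\<leftarrow>xs. c \<cdot>\<^sub>f g i)"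

lemma lcomb_Nil [simp]: "lcomb g [] = 0"
  and lcomb_Cons [simp]: "lcomb g ((c, i) # xs) = c \<cdot>\<^sub>f g i + lcomb g xs"
  and lcomb_append: "lcomb g (xs @ ys) = lcomb g xs + lcomb g ys"
  by (simp_all add: lcomb_def)

lemma lcomb_map: "lcomb g (map (\<lambda>(d, i). (c * d, i)) xs) = c \<cdot>\<^sub>f lcomb g xs"
proof (induction xs)
  case (Cons a xs)
  then show ?case by (cases a) (simp add: fun_eq_iff algebra_simps)
qed simp

lemma lcomb_in: "(\<And>i. i \<in> I \<Longrightarrow> g i \<in> H) \<Longrightarrow> snd ` set xs \<subseteq> I \<Longrightarrow> lcomb g xs \<in> H"
  by (induction xs) auto

lemma ip_lcomb_left:
  "(\<And>i. i \<in> I \<Longrightarrow> g i \<in> H) \<Longrightarrow> snd ` set xs \<subseteq> I \<Longrightarrow> h \<in> H \<Longrightarrow>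
     ip (lcomb g xs) h = (\<Sum>(c, i)\<leftarrow>xs. c * ip (g i) h)"
  by (induction xs) (auto simp: ip_simps lcomb_in[where I = I])

text \<open>Abstract moment problem with infinitely many conditions. The bound also makes the data
  consistent: a combination of the \<open>g i\<close> that vanishes gets the value 0.\<close>

lemma riesz_lcomb:
  assumes g: "\<And>i. i \<in> I \<Longrightarrow> g i \<in> H"
    and bound: "\<And>xs. snd ` set xs \<subseteq> I \<Longrightarrow> cmod (\<Sum>(c, i)\<leftarrow>xs. c * y i) \<le> M * nrm (lcomb g xs)"
    and M: "0 \<le> M"
  shows "\<exists>f\<in>H. nrm f \<le> M \<and> (\<forall>i\<in>I. ip (g i) f = y i)"
proof -
  define W where "W = {(lcomb g xs, \<Sum>(c, i)\<leftarrow>xs. c * y i) | xs. snd ` set xs \<subseteq> I}"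
  have W: "(lcomb g xs, \<Sum>(c, i)\<leftarrow>xs. c * y i) \<in> W" if "snd ` set xs \<subseteq> I" for xs
    using that by (auto simp: W_def)
  obtain f where f: "f \<in> H" "nrm f \<le> M" "\<And>v y. (v, y) \<in> W \<Longrightarrow> ip v f = y"
  proof (rule riesz_on_subspace[of W M])
    show "(0, 0) \<in> W" using W[of "[]"] by simp
  next
    fix v a v' a' assume "(v, a) \<in> W" "(v', a') \<in> W"
    then obtain xs ys where "v = lcomb g xs" "a = (\<Sum>(c, i)\<leftarrow>xs. c * y i)" "snd ` set xs \<subseteq> I"
        "v' = lcomb g ys" "a' = (\<Sum>(c, i)\<leftarrow>ys. c * y i)" "snd ` set ys \<subseteq> I"
      by (auto simp: W_def)
    then show "(v + v', a + a') \<in> W"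
      using W[of "xs @ ys"] by (simp add: lcomb_append image_Un)
  next
    fix c v a assume "(v, a) \<in> W"
    then obtain xs where xs: "v = lcomb g xs" "a = (\<Sum>(c, i)\<leftarrow>xs. c * y i)" "snd ` set xs \<subseteq> I"
      by (auto simp: W_def)
    have "(\<Sum>(d, i)\<leftarrow>map (\<lambda>(d, i). (c * d, i)) xs. d * y i) = c * (\<Sum>(d, i)\<leftarrow>xs. d * y i)"
      by (induction xs) (auto simp: algebra_simps)
    moreover have "snd ` set (map (\<lambda>(d, i). (c * d, i)) xs) \<subseteq> I" using xs(3) by auto
    ultimately show "(c \<cdot>\<^sub>f v, c * a) \<in> W"
      using W[of "map (\<lambda>(d, i). (c * d, i)) xs"] xs by (simp add: lcomb_map)
  qed (use bound M in \<open>auto simp: W_def intro: lcomb_in[where I = I] g\<close>)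
  have "ip (g i) f = y i" if "i \<in> I" for i using f(3)[OF W[of "[(1, i)]"]] that by simp
  then show ?thesis using f by blast
qed

text \<open>An element orthogonal to every kernel function vanishes on \<open>X\<close> by the
  reproducing property, and outside \<open>X\<close> by \<open>support\<close>.\<close>

lemma kernel_lcomb_dense:
  assumes f: "f \<in> H" and e: "0 < e"
  shows "\<exists>xs. snd ` set xs \<subseteq> X \<and> nrm (f - lcomb kfun xs) < e"
proof -
  define V where "V = {lcomb kfun xs | xs. snd ` set xs \<subseteq> X}"
  have VI: "lcomb kfun xs \<in> V" if "snd ` set xs \<subseteq> X" for xs using that by (auto simp: V_def)
  have "\<exists>v\<in>V. nrm (f - v) < e"
  proof (rule dense_if_orthogonal_trivial[OF _ _ _ _ _ f e])
    show "V \<subseteq> H" by (auto simp: V_def intro: lcomb_in[where I = X])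
    show "0 \<in> V" using VI[of "[]"] by simp
    show "u + v \<in> V" if uv: "u \<in> V" "v \<in> V" for u v
    proof -
      obtain xs where "u = lcomb kfun xs" "snd ` set xs \<subseteq> X" using uv(1) by (auto simp: V_def)
      moreover obtain ys where "v = lcomb kfun ys" "snd ` set ys \<subseteq> X" using uv(2) by (auto simp: V_def)
      ultimately show ?thesis using VI[of "xs @ ys"] by (simp add: lcomb_append image_Un)
    qed
    show "c \<cdot>\<^sub>f v \<in> V" if v: "v \<in> V" for c v
    proof -
      obtain xs where "v = lcomb kfun xs" "snd ` set xs \<subseteq> X"
        using v by (auto simp: V_def)
      moreover from this have "snd ` set (map (\<lambda>(d, i). (c * d, i)) xs) \<subseteq> X" by auto
      ultimately show ?thesis using VI[of "map (\<lambda>(d, i). (c * d, i)) xs"] by (simp add: lcomb_map)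
    qed
    show "h = 0" if h: "h \<in> H" and orth: "\<And>v. v \<in> V \<Longrightarrow> ip v h = 0" for h
    proof
      fix z
      show "h z = 0 z"
      proof (cases "z \<in> X")
        case True
        then show ?thesis using orth[OF VI[of "[(1, z)]"]] kfun_ip[OF h] by simp
      qed (simp add: support h)
    qed
  qed
  then show ?thesis by (auto simp: V_def)
qed

end

section \<open>Taylor coefficients\<close>

lemma taylor_coeff_0 [simp]: "taylor_coeff f 0 = f"
  by (simp add: taylor_coeff_def[abs_def])

lemma holomorphic_on_taylor_coeff:
  "f holomorphic_on S \<Longrightarrow> open S \<Longrightarrow> taylor_coeff f j holomorphic_on S"
  unfolding taylor_coeff_def by (intro holomorphic_intros) auto

lemma taylor_coeff_cong:
  assumes "f holomorphic_on S" "open S" "z \<in> S" "\<And>w. w \<in> S \<Longrightarrow> f w = g w"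
  shows "taylor_coeff f j z = taylor_coeff g j z"
proof -
  have "g holomorphic_on S" using assms holomorphic_transform by blast
  then show ?thesis
    unfolding taylor_coeff_def using assms higher_deriv_transform_within_open by metis
qed

lemma taylor_coeff_add:
  assumes "f holomorphic_on S" "g holomorphic_on S" "open S" "z \<in> S"
  shows "taylor_coeff (\<lambda>w. f w + g w) j z = taylor_coeff f j z + taylor_coeff g j z"
  unfolding taylor_coeff_def using higher_deriv_add[OF assms] by (simp add: add_divide_distrib)

lemma taylor_coeff_diff:
  assumes "f holomorphic_on S" "g holomorphic_on S" "open S" "z \<in> S"
  shows "taylor_coeff (\<lambda>w. f w - g w) j z = taylor_coeff f j z - taylor_coeff g j z"
  unfolding taylor_coeff_def using higher_deriv_diff[OF assms] by (simp add: diff_divide_distrib)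

lemma taylor_coeff_cmult:
  assumes "f holomorphic_on S" "open S" "z \<in> S"
  shows "taylor_coeff (\<lambda>w. c * f w) j z = c * taylor_coeff f j z"
  unfolding taylor_coeff_def using higher_deriv_cmult[OF assms(1,3,2)] by simp

lemma taylor_coeff_const: "taylor_coeff (\<lambda>w. c) j z = (if j = 0 then c else 0)"
  by (simp add: taylor_coeff_def)

lemma taylor_coeff_sum:
  assumes "\<And>i. i \<in> A \<Longrightarrow> f i holomorphic_on S" "open S" "z \<in> S"
  shows "taylor_coeff (\<lambda>w. \<Sum>i\<in>A. f i w) j z = (\<Sum>i\<in>A. taylor_coeff (f i) j z)"
  using assms(1)
proof (induction A rule: infinite_finite_induct)
  case (insert x F)
  then have "taylor_coeff (\<lambda>w. f x w + (\<Sum>i\<in>F. f i w)) j z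
      = taylor_coeff (f x) j z + taylor_coeff (\<lambda>w. \<Sum>i\<in>F. f i w) j z"
    using assms(2,3) by (intro taylor_coeff_add[where S = S] holomorphic_intros) auto
  then show ?case using insert by simp
qed (simp_all add: taylor_coeff_const)

lemma taylor_coeff_mult:
  assumes "f holomorphic_on S" "g holomorphic_on S" "open S" "z \<in> S"
  shows "taylor_coeff (\<lambda>w. f w * g w) j z = (\<Sum>i\<le>j. taylor_coeff f i z * taylor_coeff g (j - i) z)"
proof -
  have "taylor_coeff (\<lambda>w. f w * g w) j z
      = (\<Sum>i=0..j. of_nat (j choose i) * (deriv ^^ i) f z * (deriv ^^ (j - i)) g z / fact j)"
    unfolding taylor_coeff_def higher_deriv_mult[OF assms] by (simp add: sum_divide_distrib)
  also have "\<dots> = (\<Sum>i=0..j. taylor_coeff f i z * taylor_coeff g (j - i) z)"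
    by (intro sum.cong) (auto simp: taylor_coeff_def binomial_fact)
  finally show ?thesis by (simp add: atMost_atLeast0)
qed

lemma has_field_derivative_taylor_coeff:
  assumes "f holomorphic_on S" "open S" "z \<in> S"
  shows "(taylor_coeff f j has_field_derivative of_nat (Suc j) * taylor_coeff f (Suc j) z) (at z)"
proof -
  have "((deriv ^^ j) f has_field_derivative (deriv ^^ Suc j) f z) (at z)"
    using assms holomorphic_derivI[OF holomorphic_higher_deriv] by simp
  moreover have "of_nat (Suc j) * taylor_coeff f (Suc j) z = (deriv ^^ Suc j) f z / fact j"
    by (simp add: taylor_coeff_def del: of_nat_Suc)
  ultimately show ?thesis
    using DERIV_cdivide[of "(deriv ^^ j) f" _ z UNIV "fact j"] by (simp add: taylor_coeff_def[abs_def])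
qed

lemma taylor_coeff_Suc:
  assumes "f holomorphic_on S" "open S" "z \<in> S"
  shows "taylor_coeff f (Suc j) z = deriv (taylor_coeff f j) z / of_nat (Suc j)"
  using DERIV_imp_deriv[OF has_field_derivative_taylor_coeff[OF assms, of j]]
  by (simp del: of_nat_Suc)

text \<open>The Leibniz sum has only two terms, since an affine factor has two nonzero coefficients.
  Clearing a linear denominator therefore couples only neighbouring orders, which produces the
  recursions for the backward shift and for the kernel functions.\<close>

lemma taylor_coeff_affine_mult:
  assumes "f holomorphic_on S" "open S" "z \<in> S"
  shows "taylor_coeff (\<lambda>w. (a + b * w) * f w) (Suc j) z
    = (a + b * z) * taylor_coeff f (Suc j) z + b * taylor_coeff f j z"
proof -
  have lin: "taylor_coeff (\<lambda>w. a + b * w) i z = (if i = 0 then a + b * z else if i = 1 then b else 0)" for i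
    using taylor_coeff_add[of "\<lambda>_. a" UNIV "\<lambda>w. b * w" z i]
    by (simp add: holomorphic_intros taylor_coeff_const) (simp add: taylor_coeff_def)
  have "taylor_coeff (\<lambda>w. (a + b * w) * f w) (Suc j) z
      = (\<Sum>i\<le>Suc j. taylor_coeff (\<lambda>w. a + b * w) i z * taylor_coeff f (Suc j - i) z)"
    using assms by (intro taylor_coeff_mult[where S = S] holomorphic_intros) auto
  also have "\<dots> = (a + b * z) * taylor_coeff f (Suc j) z + (\<Sum>i\<le>j. (if i = 0 then b else 0) * taylor_coeff f (j - i) z)"
    unfolding sum.atMost_Suc_shift lin by (intro arg_cong2[where f = "(+)"] sum.cong) auto
  also have "(\<Sum>i\<le>j. (if i = 0 then b else 0) * taylor_coeff f (j - i) z) = b * taylor_coeff f j z"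
    using sum.delta[of "{..j}" 0 "\<lambda>i. b * taylor_coeff f (j - i) z"]
    by (simp add: if_distrib[of "\<lambda>x. x * _"] cong: if_cong)
  finally show ?thesis .
qed

text \<open>Negative binomial expansion at a point other than the pole; its binomials are those in
  the off-diagonal blocks \<open>H_off\<close>.\<close>

lemma taylor_coeff_inverse_power:
  assumes "z \<noteq> t"
  shows "taylor_coeff (\<lambda>w. 1 / (w - t) ^ Suc k) j z = (-1) ^ j * of_nat ((k + j) choose j) / (z - t) ^ (Suc k + j)"
  using assms
proof (induction j arbitrary: z)
  case (Suc j)
  have hol: "(\<lambda>w. 1 / (w - t) ^ Suc k) holomorphic_on - {t}" by (intro holomorphic_intros) auto
  have "deriv (taylor_coeff (\<lambda>w. 1 / (w - t) ^ Suc k) j) z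
      = deriv (\<lambda>w. (-1) ^ j * of_nat ((k + j) choose j) / (w - t) ^ (Suc k + j)) z"
  proof (rule deriv_cong_ev)
    have "\<forall>\<^sub>F w in nhds z. w \<in> - {t}" using Suc.prems by (intro eventually_nhds_in_open) auto
    then show "\<forall>\<^sub>F w in nhds z. taylor_coeff (\<lambda>w. 1 / (w - t) ^ Suc k) j w
        = (-1) ^ j * of_nat ((k + j) choose j) / (w - t) ^ (Suc k + j)"
      by eventually_elim (rule Suc.IH, simp)
  qed simp
  also have "\<dots> = - ((-1) ^ j * of_nat ((k + j) choose j) * of_nat (Suc k + j)) / (z - t) ^ (Suc k + Suc j)"
  proof (rule DERIV_imp_deriv)
    have "((\<lambda>w. c / (w - t) ^ Suc m) has_field_derivative - (c * of_nat (Suc m)) / (z - t) ^ Suc (Suc m)) (at z)" for c m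
    proof -
      have 1: "((\<lambda>w. (w - t) ^ Suc m) has_field_derivative of_nat (Suc m) * (z - t) ^ m) (at z)"
        by (rule derivative_eq_intros refl)+ simp
      have 2: "(0 * u ^ Suc m - c * (of_nat (Suc m) * u ^ m)) / (u ^ Suc m * u ^ Suc m)
          = - (c * of_nat (Suc m)) / u ^ Suc (Suc m)" if "u \<noteq> 0" for u :: complex
        using that by (simp add: divide_simps del: of_nat_Suc)
      show ?thesis
        using DERIV_divide[OF DERIV_const[of c] 1] 2[of "z - t"] Suc.prems by (simp only: right_minus_eq power_eq_0_iff not_False_eq_True simp_thms)
    qed
    from this[of "(-1) ^ j * of_nat ((k + j) choose j)" "k + j"]
    show "((\<lambda>w. (-1) ^ j * of_nat ((k + j) choose j) / (w - t) ^ (Suc k + j)) has_field_derivative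
        - ((-1) ^ j * of_nat ((k + j) choose j) * of_nat (Suc k + j)) / (z - t) ^ (Suc k + Suc j)) (at z)"
      by simp
  qed
  finally have "taylor_coeff (\<lambda>w. 1 / (w - t) ^ Suc k) (Suc j) z
      = - ((-1) ^ j * (of_nat ((k + j) choose j) * of_nat (Suc k + j))) / (z - t) ^ (Suc k + Suc j) / of_nat (Suc j)"
    using taylor_coeff_Suc[OF hol open_Compl[OF closed_singleton], of z j] Suc.prems by (simp add: mult.assoc open_delete del: of_nat_Suc)
  also have "of_nat ((k + j) choose j) * of_nat (Suc k + j) = (of_nat (Suc j) * of_nat ((k + Suc j) choose Suc j) :: complex)"
    unfolding of_nat_mult[symmetric] using Suc_times_binomial_eq[of "k + j" j]
    by (simp only: add_Suc add_Suc_right mult.commute)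
  finally show ?case by (simp del: of_nat_Suc)
qed (simp add: field_simps)

section \<open>Nontangential expansions\<close>

lemma stolz_subset_ball: "stolz a t \<subseteq> ball 0 1"
  by (auto simp: stolz_def)

text \<open>Inside the disc the region is a sublevel set of the convex function
  \<open>cmod (z - t) + a * cmod z\<close>. Convexity allows Taylor and mean value estimates that
  stay inside a Stolz angle.\<close>

lemma convex_stolz: "0 \<le> a \<Longrightarrow> convex (stolz a t)"
proof -
  assume a: "0 \<le> a"
  have conv: "cmod (u *\<^sub>R x + v *\<^sub>R y - c) \<le> u * cmod (x - c) + v * cmod (y - c)"
    if "0 \<le> u" "0 \<le> v" "u + v = 1" for u v x y and c :: complex
  proof -
    have "u *\<^sub>R x + v *\<^sub>R y - c = u *\<^sub>R (x - c) + v *\<^sub>R (y - c)"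
      using scaleR_left_distrib[of u v c] that by (simp add: algebra_simps)
    then show ?thesis using norm_triangle_ineq[of "u *\<^sub>R (x - c)" "v *\<^sub>R (y - c)"] that by simp
  qed
  have "convex {z. cmod (z - t) + a * cmod z < a}"
  proof (rule convexI)
    fix x y and u v :: real
    assume xy: "x \<in> {z. cmod (z - t) + a * cmod z < a}" "y \<in> {z. cmod (z - t) + a * cmod z < a}"
      and uv: "0 \<le> u" "0 \<le> v" "u + v = 1"
    have "cmod (u *\<^sub>R x + v *\<^sub>R y - t) + a * cmod (u *\<^sub>R x + v *\<^sub>R y)
        \<le> (u * cmod (x - t) + v * cmod (y - t)) + a * (u * cmod x + v * cmod y)"
      using conv[OF uv, of x y t] conv[OF uv, of x y 0] a by (intro add_mono mult_left_mono) auto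
    also have "\<dots> = u * (cmod (x - t) + a * cmod x) + v * (cmod (y - t) + a * cmod y)"
      by (simp add: algebra_simps)
    also have "\<dots> < a" using xy uv by (intro convex_bound_lt) auto
    finally show "u *\<^sub>R x + v *\<^sub>R y \<in> {z. cmod (z - t) + a * cmod z < a}" by simp
  qed
  then have "convex (ball 0 1 \<inter> {z. cmod (z - t) + a * cmod z < a})"
    by (intro convex_Int) auto
  also have "ball 0 1 \<inter> {z. cmod (z - t) + a * cmod z < a} = stolz a t"
    by (auto simp: stolz_def algebra_simps)
  finally show ?thesis .
qed

lemma radius_in_stolz:
  assumes "cmod t = 1" "1 < a" "0 \<le> r" "r < 1"
  shows "of_real r * t \<in> stolz a t"
proof -
  have "of_real r * t - t = - (of_real (1 - r) * t)" by (simp add: algebra_simps)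
  then have "cmod (of_real r * t - t) = 1 - r" using assms by (simp add: norm_mult del: of_real_diff)
  moreover have "1 * (1 - r) < a * (1 - r)" using assms by (intro mult_strict_right_mono) auto
  ultimately show ?thesis using assms by (simp add: stolz_def norm_mult)
qed

lemma tendsto_radius:
  assumes "cmod t = 1" "1 < a"
  shows "filterlim (\<lambda>r. of_real r * t) (at t within stolz a t) (at_left 1)"
proof -
  have "((\<lambda>r. of_real r * t) \<longlongrightarrow> of_real 1 * t) (at_left 1)" by (intro tendsto_intros)
  moreover have "\<forall>\<^sub>F r in at_left 1. of_real r * t \<in> stolz a t \<and> of_real r * t \<noteq> t"
    using eventually_at_left_real[of 0 "1::real"]
    by (rule eventually_mono) (use assms radius_in_stolz[OF assms] in auto)
  ultimately show ?thesis by (simp add: filterlim_at eventually_conj)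
qed

lemma at_within_stolz_neq_bot: "cmod t = 1 \<Longrightarrow> 1 < a \<Longrightarrow> at t within stolz a t \<noteq> bot"
  using tendsto_radius[of t a] by (auto simp: filterlim_def filtermap_bot_iff bot_unique)

lemma at_within_stolz_le: "1 < a \<Longrightarrow> at t within stolz a t \<le> nontangential t"
  by (auto simp: nontangential_def intro: SUP_upper)

lemma nontangential_neq_bot: "cmod t = 1 \<Longrightarrow> nontangential t \<noteq> bot"
  using at_within_stolz_neq_bot[of t 2] at_within_stolz_le[of 2 t] by (auto simp: bot_unique)

lemma nontangential_le_ball: "nontangential t \<le> at t within ball 0 1"
  unfolding nontangential_def by (intro SUP_least at_le stolz_subset_ball)

lemma nontangential_le_at: "nontangential t \<le> at t"
  using nontangential_le_ball at_le[of _ UNIV t] order_trans by blast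

lemma eventually_ball_nontangential: "\<forall>\<^sub>F z in nontangential t. z \<in> ball 0 1"
  using nontangential_le_ball by (rule filter_leD) (simp add: eventually_at_filter)

lemma tendsto_nontangential_isCont: "isCont f t \<Longrightarrow> (f \<longlongrightarrow> f t) (nontangential t)"
  using nontangential_le_at tendsto_mono unfolding isCont_def by blast

lemma tendsto_ident_nontangential: "((\<lambda>z. z) \<longlongrightarrow> t) (nontangential t)"
  using tendsto_nontangential_isCont[where f = "\<lambda>z. z"] by simp

lemma tendsto_taylor_coeff_entire:
  assumes "f holomorphic_on UNIV"
  shows "(taylor_coeff f j \<longlongrightarrow> taylor_coeff f j t) (nontangential t)"
  using holomorphic_on_imp_continuous_on[OF holomorphic_on_taylor_coeff[OF assms, of j]]
  by (intro tendsto_nontangential_isCont) (simp add: continuous_on_eq_continuous_at)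

lemma tendsto_bdry_coeff:
  assumes "cmod t = 1" "(taylor_coeff f j \<longlongrightarrow> L) (nontangential t)"
  shows "bdry_coeff f t j = L"
  unfolding bdry_coeff_def using assms nontangential_neq_bot tendsto_Lim by blast

text \<open>Taylor's formula with base point \<open>w\<close> is applied inside the convex region,
  and only then does \<open>w\<close> tend to \<open>t\<close>: the polynomial part disappears, and
  the remainder is controlled by the small coefficient of order \<open>N\<close>.\<close>

lemma little_o_if_taylor_coeffs_vanish:
  assumes t: "cmod t = 1" and G: "G holomorphic_on ball 0 1"
    and lim: "\<And>j. j \<le> N \<Longrightarrow> (taylor_coeff G j \<longlongrightarrow> 0) (nontangential t)"
  shows "((\<lambda>z. G z / (z - t) ^ N) \<longlongrightarrow> 0) (nontangential t)"
proof (cases N)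
  case 0
  then show ?thesis using lim[of 0] by simp
next
  case (Suc m)
  show ?thesis unfolding tendsto_nontangential_iff
  proof (intro allI impI tendstoI)
    fix a e :: real assume a: "1 < a" and e: "0 < e"
    let ?F = "at t within stolz a t"
    have limS: "(taylor_coeff G j \<longlongrightarrow> 0) ?F" if "j \<le> N" for j
      using lim[OF that] a by (simp add: tendsto_nontangential_iff)
    \<comment> \<open>The remainder carries \<open>N! / (N - 1)! = N\<close>, so this choice leaves
      \<open>e / 2\<close> after division by the power of \<open>z - t\<close>.\<close>
    define e' where "e' = e / (2 * real N)"
    have e': "e' > 0" using e Suc by (simp add: e'_def)
    from tendstoD[OF limS[of N] e'] obtain d where d: "d > 0"
      and small: "\<And>z. z \<in> stolz a t \<Longrightarrow> z \<noteq> t \<Longrightarrow> dist z t < d \<Longrightarrow> cmod (taylor_coeff G N z) < e'"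
      by (auto simp: eventually_at)
    define S where "S = stolz a t \<inter> ball t d"
    have S: "convex S" "S \<subseteq> ball 0 1" "t \<notin> S"
      using a t convex_stolz[of a t] stolz_subset_ball[of a t] by (auto simp: S_def convex_Int stolz_def)
    have evS: "\<forall>\<^sub>F w in ?F. w \<in> S"
      using d by (auto simp: eventually_at S_def dist_commute intro!: exI[of _ d])
    have bound: "cmod (G z) \<le> real N * e' * cmod (z - t) ^ N" if z: "z \<in> S" for z
    proof -
      have T: "cmod (G z - (\<Sum>i\<le>m. taylor_coeff G i w * (z - w) ^ i)) \<le> real N * e' * cmod (z - w) ^ N"
        if w: "w \<in> S" for w
      proof -
        have "cmod ((deriv ^^ 0) G z - (\<Sum>i\<le>m. (deriv ^^ i) G w * (z - w) ^ i / fact i))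
            \<le> (fact N * e') * cmod (z - w) ^ Suc m / fact m"
        proof (rule complex_Taylor[OF S(1) _ _ w z, of m "\<lambda>i. (deriv ^^ i) G"])
          fix i x assume "x \<in> S"
          then show "((deriv ^^ i) G has_field_derivative (deriv ^^ Suc i) G x) (at x within S)"
            using S(2) holomorphic_derivI[OF holomorphic_higher_deriv[OF G]] by auto
        next
          fix x assume x: "x \<in> S"
          have "cmod (taylor_coeff G N x) \<le> e'"
            using small[of x] x S(3) by (cases "x = t") (auto simp: S_def dist_commute)
          then show "cmod ((deriv ^^ Suc m) G x) \<le> fact N * e'"
            by (simp add: taylor_coeff_def norm_divide Suc field_simps del: fact_Suc)
        qed
        also have "(fact N * e') * cmod (z - w) ^ Suc m / fact m = real N * e' * cmod (z - w) ^ N"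
          by (simp add: Suc)
        finally show ?thesis by (simp add: taylor_coeff_def field_simps)
      qed
      have L1: "((\<lambda>w. cmod (G z - (\<Sum>i\<le>m. taylor_coeff G i w * (z - w) ^ i)))
          \<longlongrightarrow> cmod (G z - (\<Sum>i\<le>m. 0 * (z - t) ^ i))) ?F"
        using Suc by (intro tendsto_intros limS) auto
      have L2: "((\<lambda>w. real N * e' * cmod (z - w) ^ N) \<longlongrightarrow> real N * e' * cmod (z - t) ^ N) ?F"
        by (intro tendsto_intros)
      have "cmod (G z - (\<Sum>i\<le>m. 0 * (z - t) ^ i)) \<le> real N * e' * cmod (z - t) ^ N"
        by (rule tendsto_le[OF at_within_stolz_neq_bot[OF t a] L2 L1 eventually_mono[OF evS T]])
      then show ?thesis by simp
    qed
    show "\<forall>\<^sub>F z in ?F. dist (G z / (z - t) ^ N) 0 < e"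
      using evS
    proof eventually_elim
      case (elim z)
      then have "z \<noteq> t" using S(3) by auto
      then have "cmod (G z / (z - t) ^ N) \<le> real N * e'"
        using bound[OF elim] by (simp add: norm_divide norm_power divide_simps)
      also have "real N * e' = e / 2" using Suc by (simp add: e'_def field_simps)
      finally show ?case using e by simp
    qed
  qed
qed

text \<open>Cauchy estimates on a disc around \<open>z\<close> with radius proportional to
  \<open>cmod (z - t)\<close>. Such discs leave the given Stolz angle but stay in a wider one, so
  the hypothesis is needed for all apertures.\<close>

lemma taylor_coeffs_vanish_if_little_o:
  assumes t: "cmod t = 1" and G: "G holomorphic_on ball 0 1"
    and lim: "((\<lambda>z. G z / (z - t) ^ N) \<longlongrightarrow> 0) (nontangential t)" and j: "j \<le> N"
  shows "(taylor_coeff G j \<longlongrightarrow> 0) (nontangential t)"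
  unfolding tendsto_nontangential_iff
proof (intro allI impI tendstoI)
  fix a e :: real assume a: "1 < a" and e: "0 < e"
  \<comment> \<open>Absorbs the factor \<open>2^N\<close> from
    \<open>cmod (u - t) \<le> 2 * x\<close> and the factor \<open>(2 a)^j\<close> from dividing by
    \<open>\<rho>^j\<close>; surplus powers of \<open>x\<close> are at most 1.\<close>
  define e' where "e' = e / (2 * (2 ^ N * (2 * a) ^ N))"
  have e': "e' > 0" using e a by (simp add: e'_def)
  have "((\<lambda>z. G z / (z - t) ^ N) \<longlongrightarrow> 0) (at t within stolz (4 * a) t)"
    using lim a by (simp add: tendsto_nontangential_iff)
  from tendstoD[OF this e'] obtain d where d: "d > 0"
    and small0: "\<And>z. z \<in> stolz (4 * a) t \<Longrightarrow> z \<noteq> t \<Longrightarrow> dist z t < d \<Longrightarrow> cmod (G z / (z - t) ^ N) < e'"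
    by (auto simp: eventually_at)
  have small: "cmod (G z) \<le> e' * cmod (z - t) ^ N" if "z \<in> stolz (4 * a) t" "dist z t < d" for z
  proof -
    have "z \<noteq> t" using that t by (auto simp: stolz_def)
    then show ?thesis
      using small0[OF that(1) _ that(2)] by (simp add: norm_divide norm_power divide_simps)
  qed
  have "dist (taylor_coeff G j z) 0 < e"
    if z: "z \<in> stolz a t" "dist z t < min (d / 2) 1" for z
  proof -
    define x where "x = cmod (z - t)"
    have x: "0 < x" "x < d / 2" "x < 1" "x < a * (1 - cmod z)"
      using z t by (auto simp: x_def dist_norm stolz_def)
    \<comment> \<open>As \<open>x < a * (1 - cmod z)\<close>, this gives
      \<open>2 * \<rho> < 1 - cmod z\<close>. Points \<open>u\<close> of the disc then have
      \<open>1 - cmod u > \<rho>\<close>, hence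
      \<open>4 * a * (1 - cmod u) > 2 * x \<ge> cmod (u - t)\<close>.\<close>
    define \<rho> where "\<rho> = x / (2 * a)"
    have \<rho>: "0 < \<rho>" "\<rho> \<le> x" using x a by (auto simp: \<rho>_def field_simps intro: order_trans[of _ "a * x"])
    have in_big: "u \<in> stolz (4 * a) t" "dist u t < d" "cmod (u - t) \<le> 2 * x" if u: "u \<in> cball z \<rho>" for u
    proof -
      have uz: "cmod (u - z) \<le> \<rho>" using u by (simp add: dist_norm norm_minus_commute)
      have "cmod (u - t) \<le> cmod (u - z) + cmod (z - t)" using norm_triangle_ineq[of "u - z" "z - t"] by simp
      then show *: "cmod (u - t) \<le> 2 * x" using uz \<rho> by (simp add: x_def)
      then show "dist u t < d" using x by (simp add: dist_norm)
      have "cmod u \<le> cmod z + \<rho>" using uz norm_triangle_ineq[of "u - z" z] by simp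
      moreover have "2 * \<rho> < 1 - cmod z" using x(4) a by (simp add: \<rho>_def field_simps)
      ultimately have "\<rho> < 1 - cmod u" by simp
      then have "4 * a * \<rho> < 4 * a * (1 - cmod u)" "cmod u < 1" using a \<rho> by auto
      moreover have "4 * a * \<rho> = 2 * x" using a by (simp add: \<rho>_def)
      ultimately show "u \<in> stolz (4 * a) t" using * by (simp add: stolz_def)
    qed
    have sub: "cball z \<rho> \<subseteq> ball 0 1" using in_big(1) stolz_subset_ball by blast
    have "cmod ((deriv ^^ j) G z) \<le> fact j * (e' * (2 * x) ^ N) / \<rho> ^ j"
    proof (rule Cauchy_inequality)
      show "G holomorphic_on ball z \<rho>" using G sub holomorphic_on_subset ball_subset_cball by blast
      show "continuous_on (cball z \<rho>) G" using G sub holomorphic_on_imp_continuous_on continuous_on_subset by blast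
      fix u assume "cmod (z - u) = \<rho>"
      then have u: "u \<in> cball z \<rho>" by (simp add: dist_norm)
      have "cmod (G u) \<le> e' * cmod (u - t) ^ N" using in_big[OF u] by (intro small)
      also have "\<dots> \<le> e' * (2 * x) ^ N" using in_big[OF u] e' by (intro mult_left_mono power_mono) auto
      finally show "cmod (G u) \<le> e' * (2 * x) ^ N" .
    qed (use \<rho> in auto)
    then have "cmod (taylor_coeff G j z) \<le> e' * (2 * x) ^ N / \<rho> ^ j"
      by (simp add: taylor_coeff_def norm_divide field_simps)
    also have "\<dots> = e' * 2 ^ N * (2 * a) ^ j * x ^ (N - j)"
    proof -
      have "x ^ N = x ^ (N - j) * x ^ j" using j by (simp flip: power_add)
      then show ?thesis using x a by (simp add: \<rho>_def power_mult_distrib power_divide field_simps)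
    qed
    also have "\<dots> \<le> e' * 2 ^ N * (2 * a) ^ N * 1"
      using e' a x j by (intro mult_mono power_increasing power_le_one) auto
    also have "\<dots> < e" using e a by (simp add: e'_def)
    finally show ?thesis by simp
  qed
  then show "\<forall>\<^sub>F z in at t within stolz a t. dist (taylor_coeff G j z) 0 < e"
    unfolding eventually_at using d by (intro exI[of _ "min (d / 2) 1"]) auto
qed

lemma taylor_coeff_power_diff: "taylor_coeff (\<lambda>w. (w - t) ^ l) j t = (if j = l then 1 else 0)"
  unfolding taylor_coeff_def higher_deriv_power
  by (auto simp: pochhammer_fact[symmetric] pochhammer_0_left not_le)

lemma taylor_coeff_poly:
  "taylor_coeff (\<lambda>z. \<Sum>l\<in>{..<N}. a l * (z - t) ^ l) j t = (if j < N then a j else 0)"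
proof -
  have "taylor_coeff (\<lambda>z. \<Sum>l\<in>{..<N}. a l * (z - t) ^ l) j t = (\<Sum>l\<in>{..<N}. a l * (if j = l then 1 else 0))"
    by (subst taylor_coeff_sum[where S = UNIV])
      (auto intro!: holomorphic_intros sum.cong simp: taylor_coeff_cmult[where S = UNIV] holomorphic_intros taylor_coeff_power_diff)
  then show ?thesis by (simp add: if_distrib[of "\<lambda>x. _ * x"] cong: if_cong)
qed

lemma tendsto_taylor_coeff_poly:
  "(taylor_coeff (\<lambda>z. \<Sum>l\<in>{..<N}. a l * (z - t) ^ l) j \<longlongrightarrow> (if j < N then a j else 0)) (nontangential t)"
  using tendsto_taylor_coeff_entire[of "\<lambda>z. \<Sum>l\<in>{..<N}. a l * (z - t) ^ l" j t]
  by (simp add: taylor_coeff_poly holomorphic_intros)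

text \<open>Subtracting the candidate polynomial reduces both sides to zero coefficients, where the
  two preceding estimates are converse to each other.\<close>

lemma nontangential_expansion_iff:
  assumes t: "cmod t = 1" and F: "F holomorphic_on ball 0 1"
  shows "(\<forall>j\<le>N. (taylor_coeff F j \<longlongrightarrow> a j) (nontangential t)) \<longleftrightarrow>
    ((\<lambda>z. (F z - (\<Sum>l<Suc N. a l * (z - t) ^ l)) / (z - t) ^ N) \<longlongrightarrow> 0) (nontangential t)"
proof -
  define P where "P = (\<lambda>z. \<Sum>l<Suc N. a l * (z - t) ^ l)"
  define G where "G = (\<lambda>z. F z - P z)"
  have P: "P holomorphic_on UNIV" unfolding P_def by (intro holomorphic_intros)
  then have P': "P holomorphic_on ball 0 1" using holomorphic_on_subset by blast
  have G: "G holomorphic_on ball 0 1" unfolding G_def by (intro holomorphic_intros F P')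
  have ev: "\<forall>\<^sub>F z in nontangential t. taylor_coeff G j z = taylor_coeff F j z - taylor_coeff P j z" for j
    using eventually_ball_nontangential[of t]
    by eventually_elim (simp add: G_def taylor_coeff_diff[OF F P'])
  have limP: "(taylor_coeff P j \<longlongrightarrow> a j) (nontangential t)" if "j \<le> N" for j
    using tendsto_taylor_coeff_poly[where N = "Suc N" and a = a and t = t and j = j] that
    by (simp add: P_def less_Suc_eq_le del: sum.lessThan_Suc)
  have "(taylor_coeff F j \<longlongrightarrow> a j) (nontangential t) \<longleftrightarrow> (taylor_coeff G j \<longlongrightarrow> 0) (nontangential t)"
    if "j \<le> N" for j
  proof
    assume "(taylor_coeff F j \<longlongrightarrow> a j) (nontangential t)"
    from tendsto_diff[OF this limP[OF that]] show "(taylor_coeff G j \<longlongrightarrow> 0) (nontangential t)"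
      by (simp add: tendsto_cong[OF ev])
  next
    assume "(taylor_coeff G j \<longlongrightarrow> 0) (nontangential t)"
    then have "((\<lambda>z. taylor_coeff F j z - taylor_coeff P j z) \<longlongrightarrow> 0) (nontangential t)"
      by (simp add: tendsto_cong[OF ev])
    from tendsto_add[OF this limP[OF that]] show "(taylor_coeff F j \<longlongrightarrow> a j) (nontangential t)" by simp
  qed
  then have "(\<forall>j\<le>N. (taylor_coeff F j \<longlongrightarrow> a j) (nontangential t)) \<longleftrightarrow>
      (\<forall>j\<le>N. (taylor_coeff G j \<longlongrightarrow> 0) (nontangential t))" by blast
  also have "\<dots> \<longleftrightarrow> ((\<lambda>z. G z / (z - t) ^ N) \<longlongrightarrow> 0) (nontangential t)"
    using little_o_if_taylor_coeffs_vanish[OF t G] taylor_coeffs_vanish_if_little_o[OF t G] by blast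
  finally show ?thesis by (simp add: G_def P_def)
qed

text \<open>Both expansions have the same normalised error, because \<open>(z - t)^k\<close>
  cancels. From left to right \<open>k\<close> orders are gained, which gives the high coefficients
  of \<open>s\<close>; from right to left one divides by \<open>(z - t)^k\<close>, which gives the
  coefficients of the difference quotients.\<close>

lemma nontangential_expansion_shift:
  assumes t: "cmod t = 1" and F: "F holomorphic_on ball 0 1" and V: "V holomorphic_on ball 0 1"
    and VF: "\<And>z. z \<in> ball 0 1 \<Longrightarrow> V z = (z - t) ^ k * F z"
    and b: "\<And>j. j \<le> N + k \<Longrightarrow> b j = (if j < k then 0 else a (j - k))"
  shows "(\<forall>j\<le>N. (taylor_coeff F j \<longlongrightarrow> a j) (nontangential t)) \<longleftrightarrow>
    (\<forall>j\<le>N + k. (taylor_coeff V j \<longlongrightarrow> b j) (nontangential t))"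
proof -
  have "(V z - (\<Sum>l<Suc (N + k). b l * (z - t) ^ l)) / (z - t) ^ (N + k)
      = (F z - (\<Sum>l<Suc N. a l * (z - t) ^ l)) / (z - t) ^ N" if z: "z \<in> ball 0 1" for z
  proof -
    have zt: "z \<noteq> t" using z t by auto
    have "(\<Sum>l<Suc (N + k). b l * (z - t) ^ l) = (\<Sum>l<k. b l * (z - t) ^ l) + (\<Sum>l=k..<Suc (N + k). b l * (z - t) ^ l)"
      using sum.atLeastLessThan_concat[of 0 k "Suc (N + k)" "\<lambda>l. b l * (z - t) ^ l"]
      by (simp only: lessThan_atLeast0)
    also have "(\<Sum>l<k. b l * (z - t) ^ l) = 0" by (rule sum.neutral) (auto simp: b)
    also have "(\<Sum>l=k..<Suc (N + k). b l * (z - t) ^ l) = (\<Sum>l=0..<Suc N. b (l + k) * (z - t) ^ (l + k))"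
      using sum.shift_bounds_nat_ivl[of "\<lambda>l. b l * (z - t) ^ l" 0 k "Suc N"] by simp
    also have "\<dots> = (z - t) ^ k * (\<Sum>l<Suc N. a l * (z - t) ^ l)"
      unfolding sum_distrib_left lessThan_atLeast0
      by (intro sum.cong) (auto simp: b power_add)
    finally show ?thesis using zt by (simp add: VF[OF z] power_add field_simps flip: right_diff_distrib)
  qed
  then have "\<forall>\<^sub>F z in nontangential t. (V z - (\<Sum>l<Suc (N + k). b l * (z - t) ^ l)) / (z - t) ^ (N + k)
      = (F z - (\<Sum>l<Suc N. a l * (z - t) ^ l)) / (z - t) ^ N"
    using eventually_ball_nontangential by (rule eventually_mono[rotated])
  from tendsto_cong[OF this] show ?thesis
    unfolding nontangential_expansion_iff[OF t F] nontangential_expansion_iff[OF t V] by simp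
qed

section \<open>The Caratheodory--Julia condition\<close>

lemma one_minus_mult_cnj_neq_0:
  assumes "cmod z < 1" "cmod w \<le> 1"
  shows "1 - z * cnj w \<noteq> 0"
proof
  assume "1 - z * cnj w = 0"
  then have "cmod (z * cnj w) = 1" by simp
  moreover have "cmod z * cmod w \<le> cmod z * 1" using assms by (intro mult_left_mono) auto
  ultimately show False using assms by (simp add: norm_mult)
qed

locale de_branges_rovnyak = rkhs "ball 0 1" "dbr_kernel s" H ip for s H ip +
  assumes schur: "s \<in> schur_class"
begin

lemma s_holomorphic: "s holomorphic_on ball 0 1"
  and s_le_1: "cmod z < 1 \<Longrightarrow> cmod (s z) \<le> 1"
  using schur by (auto simp: schur_class_def)

lemma kfun_eq: "cmod z < 1 \<Longrightarrow> kfun w z = (1 - s z * cnj (s w)) / (1 - z * cnj w)"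
  by (simp add: kfun_def dbr_kernel_def)

lemma kfun_holomorphic: "cmod w < 1 \<Longrightarrow> kfun w holomorphic_on ball 0 1"
proof -
  assume w: "cmod w < 1"
  have "(\<lambda>z. (1 - s z * cnj (s w)) / (1 - z * cnj w)) holomorphic_on ball 0 1"
    using w one_minus_mult_cnj_neq_0 by (intro holomorphic_intros s_holomorphic) auto
  then show ?thesis by (rule holomorphic_transform) (simp add: kfun_eq)
qed

lemma nrm_kfun: "cmod w < 1 \<Longrightarrow> (nrm (kfun w))\<^sup>2 = (1 - (cmod (s w))\<^sup>2) / (1 - (cmod w)\<^sup>2)"
proof -
  assume w: "cmod w < 1"
  have "complex_of_real ((nrm (kfun w))\<^sup>2) = kfun w w" using w ip_self[of "kfun w"] ip_kfun[of "kfun w" w] by simp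
  also have "\<dots> = of_real ((1 - (cmod (s w))\<^sup>2) / (1 - (cmod w)\<^sup>2))"
    using w by (simp add: kfun_eq complex_norm_square[symmetric])
  finally show ?thesis by (simp only: of_real_eq_iff)
qed

lemma nrm_kfun_le: "cmod w < 1 \<Longrightarrow> nrm (kfun w) \<le> 1 / sqrt (1 - cmod w)"
proof -
  assume w: "cmod w < 1"
  have sq: "(cmod w)\<^sup>2 \<le> cmod w" using w by (simp add: power2_eq_square mult_left_le)
  then have "(nrm (kfun w))\<^sup>2 \<le> 1 / (1 - cmod w)"
    unfolding nrm_kfun[OF w] using w by (intro frac_le) auto
  also have "\<dots> = (1 / sqrt (1 - cmod w))\<^sup>2" using w by (simp add: power_divide)
  finally show ?thesis by (rule power2_le_imp_le) (use w in simp)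
qed

lemma eval_le: "f \<in> H \<Longrightarrow> cmod z < 1 \<Longrightarrow> cmod (f z) \<le> nrm f * nrm (kfun z)"
  using cauchy_schwarz[of f "kfun z"] ip_kfun[of f z] by simp

lemma eval_bound:
  assumes "f \<in> H" "cmod z < 1"
  shows "cmod (f z) \<le> nrm f / sqrt (1 - cmod z)"
  using eval_le[OF assms] mult_left_mono[OF nrm_kfun_le[OF assms(2)] nrm_nonneg[OF assms(1)]] by simp

lemma lcomb_kfun_holomorphic: "snd ` set xs \<subseteq> ball 0 1 \<Longrightarrow> lcomb kfun xs holomorphic_on ball 0 1"
proof (induction xs)
  case (Cons a xs)
  obtain c w where a: "a = (c, w)" by force
  have "(\<lambda>z. c * kfun w z + lcomb kfun xs z) holomorphic_on ball 0 1"
    using Cons by (intro holomorphic_intros kfun_holomorphic) (auto simp: a)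
  then show ?case by (rule holomorphic_transform) (simp add: a)
qed (simp add: zero_fun_def)

text \<open>Membership in \<open>H\<close> is only abstract. Combinations of kernel functions are
  holomorphic and dense, and \<open>eval_bound\<close> turns norm convergence into locally uniform
  convergence.\<close>

lemma holomorphic_in:
  assumes f: "f \<in> H"
  shows "f holomorphic_on ball 0 1"
proof -
  have "\<exists>xs. snd ` set xs \<subseteq> ball 0 1 \<and> nrm (f - lcomb kfun xs) < 1 / real (Suc m)" for m
    using kernel_lcomb_dense[OF f, of "1 / real (Suc m)"] by simp
  then obtain xs where xs: "\<And>m. snd ` set (xs m) \<subseteq> ball 0 1"
      "\<And>m. nrm (f - lcomb kfun (xs m)) < 1 / real (Suc m)" by metis
  define F where "F = (\<lambda>m. lcomb kfun (xs m))"
  have FH: "F m \<in> H" for m unfolding F_def using xs(1) by (intro lcomb_in[where I = "ball 0 1"]) auto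
  show ?thesis
  proof (rule holomorphic_uniform_sequence[of "ball 0 1" F])
    show "F m holomorphic_on ball 0 1" for m unfolding F_def by (intro lcomb_kfun_holomorphic xs)
    fix x :: complex assume "x \<in> ball 0 1"
    define d where "d = (1 - cmod x) / 2"
    have d: "d > 0" using \<open>x \<in> ball 0 1\<close> by (simp add: d_def)
    have in_disc: "d \<le> 1 - cmod u" if "u \<in> cball x d" for u
      using that norm_triangle_ineq2[of u x] by (simp add: d_def dist_norm norm_minus_commute field_simps)
    have close: "dist (F m u) (f u) \<le> 1 / real (Suc m) / sqrt d" if u: "u \<in> cball x d" for m u
    proof -
      have u1: "cmod u < 1" using in_disc[OF u] d by simp
      have "cmod ((f - F m) u) \<le> nrm (f - F m) / sqrt (1 - cmod u)"
        using FH f u1 by (intro eval_bound[of "f - F m"]) simp_all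
      also have "\<dots> \<le> 1 / real (Suc m) / sqrt d"
        using xs(2)[of m] in_disc[OF u] d f FH[of m] by (intro frac_le) (auto simp: F_def less_imp_le)
      finally show ?thesis by (simp add: dist_norm norm_minus_commute)
    qed
    have "uniform_limit (cball x d) F f sequentially"
    proof (rule uniform_limitI)
      fix e :: real assume "e > 0"
      have "(\<lambda>m. 1 / real (Suc m) / sqrt d) \<longlonglongrightarrow> 0"
        using tendsto_divide_zero[OF LIMSEQ_Suc[OF lim_1_over_n]] by simp
      from order_tendstoD(2)[OF this \<open>e > 0\<close>]
      show "\<forall>\<^sub>F m in sequentially. \<forall>u\<in>cball x d. dist (F m u) (f u) < e"
        by eventually_elim (use close le_less_trans in blast)
    qed
    moreover have "cball x d \<subseteq> ball 0 1" using in_disc d by force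
    ultimately show "\<exists>d. 0 < d \<and> cball x d \<subseteq> ball 0 1 \<and> uniform_limit (cball x d) F f sequentially"
      using d by blast
  qed simp
qed

lemma taylor_coeff_bound:
  assumes r: "r < 1"
  shows "\<exists>C\<ge>0. \<forall>f\<in>H. \<forall>z. cmod z \<le> r \<longrightarrow> cmod (taylor_coeff f j z) \<le> C * nrm f"
proof -
  define d where "d = (1 - r) / 2"
  have d: "d > 0" using r by (simp add: d_def)
  have "cmod (taylor_coeff f j z) \<le> (1 / sqrt d / d ^ j) * nrm f" if f: "f \<in> H" and z: "cmod z \<le> r" for f z
  proof -
    have in_disc: "d \<le> 1 - cmod u" if "u \<in> cball z d" for u
      using that z norm_triangle_ineq2[of u z] by (simp add: d_def dist_norm norm_minus_commute field_simps)
    then have sub: "cball z d \<subseteq> ball 0 1" using d by force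
    have "cmod ((deriv ^^ j) f z) \<le> fact j * (nrm f / sqrt d) / d ^ j"
    proof (rule Cauchy_inequality)
      show "f holomorphic_on ball z d"
        using holomorphic_in[OF f] sub holomorphic_on_subset ball_subset_cball by blast
      show "continuous_on (cball z d) f"
        using holomorphic_in[OF f] sub holomorphic_on_imp_continuous_on continuous_on_subset by blast
      fix u assume "cmod (z - u) = d"
      then have u: "u \<in> cball z d" by (simp add: dist_norm)
      have "cmod (f u) \<le> nrm f / sqrt (1 - cmod u)" using f in_disc[OF u] d by (intro eval_bound) auto
      also have "\<dots> \<le> nrm f / sqrt d" using in_disc[OF u] d f by (intro divide_left_mono) auto
      finally show "cmod (f u) \<le> nrm f / sqrt d" .
    qed (use d in auto)
    then show ?thesis by (simp add: taylor_coeff_def norm_divide field_simps)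
  qed
  then show ?thesis using d by (intro exI[of _ "1 / sqrt d / d ^ j"]) auto
qed

section \<open>Derivative kernels and the mixed derivative of the quotient\<close>

lemma taylor_coeff_plus: "f \<in> H \<Longrightarrow> g \<in> H \<Longrightarrow> cmod z < 1 \<Longrightarrow>
    taylor_coeff (f + g) j z = taylor_coeff f j z + taylor_coeff g j z"
  using taylor_coeff_add[OF holomorphic_in holomorphic_in, of f g z j] by (simp add: plus_fun_def)

lemma taylor_coeff_minus: "f \<in> H \<Longrightarrow> g \<in> H \<Longrightarrow> cmod z < 1 \<Longrightarrow>
    taylor_coeff (f - g) j z = taylor_coeff f j z - taylor_coeff g j z"
  using taylor_coeff_diff[OF holomorphic_in holomorphic_in, of f g z j] by (simp add: fun_diff_def)

lemma taylor_coeff_fscale: "f \<in> H \<Longrightarrow> cmod z < 1 \<Longrightarrow> taylor_coeff (c \<cdot>\<^sub>f f) j z = c * taylor_coeff f j z"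
  using taylor_coeff_cmult[OF holomorphic_in, of f z c j] by (simp add: fscale_def)

text \<open>Up to the factor \<open>1 / j!\<close>, the \<open>j\<close>-th antiholomorphic
  derivative of \<open>z \<mapsto> kfun z\<close>, obtained here by duality.\<close>

definition kder :: "nat \<Rightarrow> complex \<Rightarrow> complex \<Rightarrow> complex" where
  "kder j z = (SOME g. g \<in> H \<and> (\<forall>f\<in>H. ip f g = taylor_coeff f j z))"

lemma kder_props: "cmod z < 1 \<Longrightarrow> kder j z \<in> H \<and> (\<forall>f\<in>H. ip f (kder j z) = taylor_coeff f j z)"
proof -
  assume z: "cmod z < 1"
  from taylor_coeff_bound[OF z, of j] obtain C where
    C: "C \<ge> 0" "\<And>f. f \<in> H \<Longrightarrow> cmod (taylor_coeff f j z) \<le> C * nrm f" by blast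
  then have "\<exists>g. g \<in> H \<and> (\<forall>f\<in>H. ip f g = taylor_coeff f j z)"
    using riesz_functional[of "\<lambda>f. taylor_coeff f j z" C] taylor_coeff_plus[OF _ _ z] taylor_coeff_fscale[OF _ z]
    by blast
  from someI_ex[OF this] show ?thesis unfolding kder_def .
qed

lemma kder_in [simp]: "cmod z < 1 \<Longrightarrow> kder j z \<in> H"
  and ip_kder: "cmod z < 1 \<Longrightarrow> f \<in> H \<Longrightarrow> ip f (kder j z) = taylor_coeff f j z"
  using kder_props by blast+

lemma kder_0: "cmod z < 1 \<Longrightarrow> kder 0 z = kfun z"
proof
  fix w assume z: "cmod z < 1"
  show "kder 0 z w = kfun z w"
  proof (cases "cmod w < 1")
    case True
    then show ?thesis
      using ip_cnj[of "kfun w" "kder 0 z"] ip_cnj[of "kfun w" "kfun z"] z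
      by (simp add: ip_kfun[symmetric, of _ w] ip_kder) (simp add: ip_kfun)
  next
    case False
    then show ?thesis using support[of "kder 0 z" w] support[of "kfun z" w] z by simp
  qed
qed

lemma nrm_kder_bound:
  assumes r: "r < 1"
  shows "\<exists>C\<ge>0. \<forall>z. cmod z \<le> r \<longrightarrow> nrm (kder j z) \<le> C"
proof -
  from taylor_coeff_bound[OF r, of j] obtain C where
    C: "C \<ge> 0" "\<And>f z. f \<in> H \<Longrightarrow> cmod z \<le> r \<Longrightarrow> cmod (taylor_coeff f j z) \<le> C * nrm f" by blast
  have "nrm (kder j z) \<le> C" if z: "cmod z \<le> r" for z
  proof -
    have k: "kder j z \<in> H" using z r by simp
    have "(nrm (kder j z))\<^sup>2 = Re (taylor_coeff (kder j z) j z)"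
      using z r k by (simp add: nrm_square ip_kder)
    also have "\<dots> \<le> C * nrm (kder j z)" using C(2)[OF k z] complex_Re_le_cmod order_trans by blast
    finally show ?thesis using C(1) nrm_nonneg[OF k] by (cases "nrm (kder j z) = 0") (auto simp: power2_eq_square)
  qed
  with C show ?thesis by blast
qed

text \<open>Differentiability in norm by duality: the error vector paired with itself is the
  second-order Taylor remainder of a coefficient of that same vector, so one factor of its norm
  cancels.\<close>

lemma kder_first_order:
  assumes z: "cmod z < 1"
  shows "\<exists>C\<ge>0. \<forall>h. cmod h < (1 - cmod z) / 2 \<longrightarrow>
    nrm (kder j (z + h) - kder j z - (of_nat (Suc j) * cnj h) \<cdot>\<^sub>f kder (Suc j) z) \<le> C * (cmod h)\<^sup>2"
proof -
  define r where "r = (1 - cmod z) / 2"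
  have r: "0 < r" "cmod z + r < 1" using z by (auto simp: r_def field_simps)
  from taylor_coeff_bound[OF r(2), of "Suc (Suc j)"] obtain C where
    C: "C \<ge> 0" "\<And>f u. f \<in> H \<Longrightarrow> cmod u \<le> cmod z + r \<Longrightarrow> cmod (taylor_coeff f (Suc (Suc j)) u) \<le> C * nrm f"
    by blast
  \<comment> \<open>The second derivative of the \<open>j\<close>-th coefficient function is
    \<open>(j + 1) (j + 2)\<close> times the coefficient of order \<open>j + 2\<close>.\<close>
  define C' where "C' = real (Suc j) * real (Suc (Suc j)) * C"
  have ball: "cmod u \<le> cmod z + r" if "u \<in> ball z r" for u
    using that norm_triangle_ineq2[of u z] by (simp add: dist_norm norm_minus_commute)
  have taylor: "cmod (taylor_coeff f j (z + h) - taylor_coeff f j z - of_nat (Suc j) * h * taylor_coeff f (Suc j) z)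
      \<le> C' * nrm f * (cmod h)\<^sup>2" if f: "f \<in> H" and h: "cmod h < r" for f h
  proof -
    define g where "g = (\<lambda>i u. (deriv ^^ (i + j)) f u / fact j)"
    have "cmod (g 0 (z + h) - (\<Sum>i\<le>1. g i z * (z + h - z) ^ i / fact i))
        \<le> (C' * nrm f) * cmod (z + h - z) ^ Suc 1 / fact 1"
    proof (rule complex_Taylor[of "ball z r"])
      fix i u assume "u \<in> ball z r"
      then have "u \<in> ball 0 1" using ball r(2) by force
      then have "((deriv ^^ (i + j)) f has_field_derivative (deriv ^^ Suc (i + j)) f u) (at u within ball z r)"
        using holomorphic_derivI[OF holomorphic_higher_deriv[OF holomorphic_in[OF f]]] by auto
      then show "(g i has_field_derivative g (Suc i) u) (at u within ball z r)"
        unfolding g_def using DERIV_cdivide by force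
    next
      fix u assume "u \<in> ball z r"
      then have "cmod (taylor_coeff f (Suc (Suc j)) u) \<le> C * nrm f" using ball f by (intro C)
      then have "real (Suc j) * real (Suc (Suc j)) * cmod (taylor_coeff f (Suc (Suc j)) u)
          \<le> real (Suc j) * real (Suc (Suc j)) * (C * nrm f)" by (intro mult_left_mono) auto
      moreover have "g (Suc 1) u = of_nat (Suc j) * of_nat (Suc (Suc j)) * taylor_coeff f (Suc (Suc j)) u"
        by (simp add: g_def taylor_coeff_def del: of_nat_Suc)
      ultimately show "cmod (g (Suc 1) u) \<le> C' * nrm f"
        by (simp add: C'_def norm_mult mult.assoc del: of_nat_Suc)
    qed (use h r in \<open>auto simp: dist_norm\<close>)
    moreover have "g 0 u = taylor_coeff f j u" "g 1 u = of_nat (Suc j) * taylor_coeff f (Suc j) u" for u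
      by (simp_all add: g_def taylor_coeff_def del: of_nat_Suc)
    ultimately show ?thesis by (simp add: numeral_2_eq_2 algebra_simps)
  qed
  have "nrm (kder j (z + h) - kder j z - (of_nat (Suc j) * cnj h) \<cdot>\<^sub>f kder (Suc j) z) \<le> C' * (cmod h)\<^sup>2"
    if h: "cmod h < r" for h
  proof -
    have zh: "cmod (z + h) < 1" using h r norm_triangle_ineq[of z h] by simp
    define E where "E = kder j (z + h) - kder j z - (of_nat (Suc j) * cnj h) \<cdot>\<^sub>f kder (Suc j) z"
    have E: "E \<in> H" using z zh by (simp add: E_def)
    have "ip E E = taylor_coeff E j (z + h) - taylor_coeff E j z - of_nat (Suc j) * h * taylor_coeff E (Suc j) z"
      using E z zh by (subst (2) E_def) (simp add: ip_simps ip_kder)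
    then have "(nrm E)\<^sup>2 \<le> C' * nrm E * (cmod h)\<^sup>2"
      using taylor[OF E h] complex_Re_le_cmod[of "ip E E"] by (simp add: nrm_square[OF E])
    moreover have "0 \<le> C'" using C by (simp add: C'_def)
    ultimately have "nrm E \<le> C' * (cmod h)\<^sup>2"
      using nrm_nonneg[OF E] by (cases "nrm E = 0") (auto simp: power2_eq_square)
    then show ?thesis by (simp add: E_def)
  qed
  then show ?thesis using C(1) by (intro exI[of _ C']) (auto simp: r_def C'_def)
qed

text \<open>\<open>kder\<close> depends antiholomorphically on \<open>z\<close> and
  \<open>ip\<close> is conjugate linear in its second argument. So \<open>i\<close> counts
  holomorphic and \<open>j\<close> antiholomorphic derivatives, and the indices appear in reverse
  order in \<open>ip\<close>.\<close>

definition gram :: "nat \<Rightarrow> nat \<Rightarrow> complex \<Rightarrow> complex" where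
  "gram i j z = ip (kder j z) (kder i z)"

text \<open>The first-order expansions of both arguments are multiplied out, and each of the three
  leftover terms is quadratic in \<open>h\<close>. Real differentiability is the right notion here,
  since the Wirtinger derivatives are defined through \<open>frechet_derivative\<close>.\<close>

lemma gram_has_derivative:
  assumes z: "cmod z < 1"
  shows "(gram i j has_derivative
    (\<lambda>h. of_nat (Suc i) * gram (Suc i) j z * h + of_nat (Suc j) * gram i (Suc j) z * cnj h)) (at z)"
proof -
  let ?D = "\<lambda>h. of_nat (Suc i) * gram (Suc i) j z * h + of_nat (Suc j) * gram i (Suc j) z * cnj h"
  define r where "r = (1 - cmod z) / 2"
  have r: "0 < r" "cmod z + r < 1" using z by (auto simp: r_def field_simps)
  define E where "E = (\<lambda>j h. kder j (z + h) - kder j z - (of_nat (Suc j) * cnj h) \<cdot>\<^sub>f kder (Suc j) z)"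
  obtain Ci Cj where C: "\<And>h. cmod h < r \<Longrightarrow> nrm (E i h) \<le> Ci * (cmod h)\<^sup>2"
      "\<And>h. cmod h < r \<Longrightarrow> nrm (E j h) \<le> Cj * (cmod h)\<^sup>2" "0 \<le> Ci" "0 \<le> Cj"
    using kder_first_order[OF z, of i] kder_first_order[OF z, of j] unfolding E_def r_def by blast
  obtain B where B: "\<And>u. cmod u \<le> cmod z + r \<Longrightarrow> nrm (kder i u) \<le> B" "0 \<le> B"
    using nrm_kder_bound[OF r(2), of i] by blast
  define A where "A = nrm (kder j z) + real (Suc j) * nrm (kder (Suc j) z)"
  define A' where "A' = real (Suc j) * real (Suc i) * (nrm (kder (Suc j) z) * nrm (kder (Suc i) z))"
  have kz: "kder l z \<in> H" for l using z by simp
  have A: "0 \<le> A" using kz by (simp add: A_def)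
  define M where "M = Cj * B + A * Ci + A'"
  show ?thesis
  proof (rule has_derivativeI_sandwich[OF r(1)])
    show "bounded_linear ?D"
      by (intro bounded_linear_add bounded_linear_mult_right bounded_linear_const_mult bounded_linear_cnj)
    show "((\<lambda>y. M * norm (y - z)) \<longlongrightarrow> 0) (at z)"
      by (rule tendsto_eq_intros refl)+ simp
    fix y assume y: "y \<noteq> z" "dist y z < r"
    define h where "h = y - z"
    have h: "cmod h < r" "h \<noteq> 0" "y = z + h" using y by (auto simp: h_def dist_norm)
    have zh: "cmod (z + h) < 1" "cmod (z + h) \<le> cmod z + r"
      using h r norm_triangle_ineq[of z h] by auto
    have h1: "cmod h \<le> 1" using h r norm_ge_zero[of z] by linarith
    have kzh: "kder l (z + h) \<in> H" for l using zh by simp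
    have EH: "E l h \<in> H" for l unfolding E_def using kz kzh by simp
    define a where "a = of_nat (Suc j) * cnj h"
    define b where "b = of_nat (Suc i) * cnj h"
    have kj: "kder j (z + h) = E j h + (kder j z + a \<cdot>\<^sub>f kder (Suc j) z)"
      and ki: "kder i (z + h) = E i h + (kder i z + b \<cdot>\<^sub>f kder (Suc i) z)"
      by (simp_all add: E_def a_def b_def)
    have "gram i j (z + h) = ip (E j h) (kder i (z + h)) + ip (kder j z + a \<cdot>\<^sub>f kder (Suc j) z) (kder i (z + h))"
      unfolding gram_def using kz EH kzh by (subst kj) (simp add: ip_add_left)
    also have "ip (kder j z + a \<cdot>\<^sub>f kder (Suc j) z) (kder i (z + h))
        = ip (kder j z + a \<cdot>\<^sub>f kder (Suc j) z) (E i h) + gram i j z + ?D h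
          + a * cnj b * ip (kder (Suc j) z) (kder (Suc i) z)"
      using kz EH by (subst ki) (simp add: ip_simps gram_def a_def b_def algebra_simps)
    finally have "gram i j (z + h) - gram i j z - ?D h = ip (E j h) (kder i (z + h))
        + ip (kder j z + a \<cdot>\<^sub>f kder (Suc j) z) (E i h) + a * cnj b * ip (kder (Suc j) z) (kder (Suc i) z)"
      by simp
    also have "cmod \<dots> \<le> Cj * (cmod h)\<^sup>2 * B + A * (Ci * (cmod h)\<^sup>2) + A' * (cmod h)\<^sup>2"
    proof (intro norm_triangle_mono)
      have "cmod (ip (E j h) (kder i (z + h))) \<le> nrm (E j h) * nrm (kder i (z + h))"
        using EH kzh by (intro cauchy_schwarz)
      also have "\<dots> \<le> Cj * (cmod h)\<^sup>2 * B"
        using C(2)[OF h(1)] C(4) B(1)[OF zh(2)] kzh EH by (intro mult_mono) auto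
      finally show "cmod (ip (E j h) (kder i (z + h))) \<le> Cj * (cmod h)\<^sup>2 * B" .
      have "nrm (kder j z + a \<cdot>\<^sub>f kder (Suc j) z) \<le> nrm (kder j z) + cmod a * nrm (kder (Suc j) z)"
        using nrm_triangle[of "kder j z" "a \<cdot>\<^sub>f kder (Suc j) z"] kz by (simp add: nrm_fscale)
      also have "\<dots> \<le> nrm (kder j z) + (real (Suc j) * 1) * nrm (kder (Suc j) z)"
        unfolding a_def norm_mult using h1 kz by (intro add_left_mono mult_right_mono mult_mono) (auto simp del: of_nat_Suc)
      finally have "nrm (kder j z + a \<cdot>\<^sub>f kder (Suc j) z) \<le> A" by (simp add: A_def)
      then have "nrm (kder j z + a \<cdot>\<^sub>f kder (Suc j) z) * nrm (E i h) \<le> A * (Ci * (cmod h)\<^sup>2)"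
        using C(1)[OF h(1)] A EH by (intro mult_mono) auto
      then show "cmod (ip (kder j z + a \<cdot>\<^sub>f kder (Suc j) z) (E i h)) \<le> A * (Ci * (cmod h)\<^sup>2)"
        using cauchy_schwarz[of "kder j z + a \<cdot>\<^sub>f kder (Suc j) z" "E i h"] kz EH by simp
      have "cmod (a * cnj b * ip (kder (Suc j) z) (kder (Suc i) z))
          = (real (Suc j) * real (Suc i)) * (cmod h)\<^sup>2 * cmod (ip (kder (Suc j) z) (kder (Suc i) z))"
        by (simp add: a_def b_def norm_mult power2_eq_square del: of_nat_Suc)
      also have "\<dots> \<le> (real (Suc j) * real (Suc i)) * (cmod h)\<^sup>2 * (nrm (kder (Suc j) z) * nrm (kder (Suc i) z))"
        using kz by (intro mult_left_mono cauchy_schwarz) auto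
      finally show "cmod (a * cnj b * ip (kder (Suc j) z) (kder (Suc i) z)) \<le> A' * (cmod h)\<^sup>2"
        by (simp add: A'_def algebra_simps)
    qed
    also have "\<dots> = M * cmod h * cmod h" by (simp add: M_def power2_eq_square algebra_simps)
    finally show "cmod (gram i j y - gram i j z - ?D (y - z)) / cmod (y - z) \<le> M * cmod (y - z)"
      using h by (simp add: divide_simps)
  qed
qed

lemma wirtinger_gram:
  assumes z: "cmod z < 1" and g: "\<And>w. cmod w < 1 \<Longrightarrow> g w = c * gram i j w"
  shows "wirtinger g z = c * of_nat (Suc i) * gram (Suc i) j z"
    and "wirtinger_bar g z = c * of_nat (Suc j) * gram i (Suc j) z"
proof -
  let ?D = "\<lambda>h. of_nat (Suc i) * gram (Suc i) j z * h + of_nat (Suc j) * gram i (Suc j) z * cnj h"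
  have "((\<lambda>w. c * gram i j w) has_derivative (\<lambda>h. c * ?D h)) (at z)"
    by (intro has_derivative_mult_right gram_has_derivative z)
  then have "(g has_derivative (\<lambda>h. c * ?D h)) (at z)"
    by (rule has_derivative_transform_within_open[OF _ open_ball[of 0 1]]) (use z g in auto)
  then have "frechet_derivative g (at z) = (\<lambda>h. c * ?D h)" by (rule frechet_derivative_at[symmetric])
  then show "wirtinger g z = c * of_nat (Suc i) * gram (Suc i) j z"
    and "wirtinger_bar g z = c * of_nat (Suc j) * gram i (Suc j) z"
    by (simp_all add: wirtinger_def wirtinger_bar_def algebra_simps del: of_nat_Suc)
qed

lemma cj_quotient_eq: "cmod z < 1 \<Longrightarrow> cj_quotient s z = gram 0 0 z"
  by (simp add: cj_quotient_def gram_def kder_0 ip_self nrm_kfun)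

text \<open>For \<open>m = n\<close> the right side is \<open>(n!)^2\<close> times the squared norm
  of \<open>kder n z\<close>; this is how the boundary hypothesis on \<open>s\<close> becomes a
  bound on functionals.\<close>

lemma mixed_derivative_cj_quotient:
  assumes z: "cmod z < 1"
  shows "(wirtinger ^^ m) ((wirtinger_bar ^^ n) (cj_quotient s)) z = fact m * fact n * gram m n z"
proof -
  have bar: "(wirtinger_bar ^^ n) (cj_quotient s) z = fact n * gram 0 n z" if "cmod z < 1" for z
    using that
  proof (induction n arbitrary: z)
    case (Suc n)
    then show ?case using wirtinger_gram(2)[of z _ "fact n" 0 n] by (simp add: algebra_simps)
  qed (simp add: cj_quotient_eq)
  show ?thesis using z
  proof (induction m arbitrary: z)
    case (Suc m)
    then show ?case using wirtinger_gram(1)[of z _ "fact m * fact n" m n] by (simp add: algebra_simps)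
  qed (simp add: bar)
qed


section \<open>The backward shift\<close>

text \<open>The equation defining the backward shift says nothing at the origin; continuity there
  supplies uniqueness.\<close>

lemma eq_if_eq_on_punctured_disc:
  assumes f: "f \<in> H" and g: "g \<in> H" and eq: "\<And>z. z \<noteq> 0 \<Longrightarrow> cmod z < 1 \<Longrightarrow> f z = g z"
  shows "f = g"
proof
  fix z
  have h: "(\<lambda>z. f z - g z) holomorphic_on ball 0 1" by (intro holomorphic_intros holomorphic_in f g)
  then have "isCont (\<lambda>z. f z - g z) 0"
    using holomorphic_on_imp_continuous_on[OF h] by (simp add: continuous_on_eq_continuous_at)
  then have "((\<lambda>z. f z - g z) \<longlongrightarrow> f 0 - g 0) (at 0)" by (simp add: isCont_def)
  moreover have "\<forall>\<^sub>F z in at 0. f z - g z = 0"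
    unfolding eventually_at using eq by (intro exI[of _ 1]) (auto simp: dist_norm)
  then have "((\<lambda>z. f z - g z) \<longlongrightarrow> 0) (at 0)" by (rule tendsto_eventually)
  ultimately have "f 0 - g 0 = 0" using tendsto_unique[OF trivial_limit_at] by blast
  then show "f z = g z"
    using eq[of z] support[OF f, of z] support[OF g, of z] by (cases "z = 0"; cases "cmod z < 1") auto
qed

text \<open>
  The difference quotients \<open>u w = (K\<^sub>w - K\<^sub>0) / cnj w\<close> represent evaluation of \<open>(f - f 0) / z\<close> at \<open>w\<close>.
  Their Gram kernel is the kernel of the space minus a rank one positive kernel, which makes
  the backward shift a contraction.
\<close>

lemma backward_shift_exists:
  assumes f: "f \<in> H"
  shows "\<exists>h. h \<in> H \<and> nrm h \<le> nrm f \<and> (\<forall>z. cmod z < 1 \<longrightarrow> z * h z = f z - f 0)"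
proof -
  define I where "I = ball (0::complex) 1 - {0}"
  define u where "u = (\<lambda>w. (1 / cnj w) \<cdot>\<^sub>f (kfun w - kfun 0))"
  define b where "b = (\<lambda>w. cnj ((s w - s 0) / w))"
  define y where "y = (\<lambda>w. cnj ((f w - f 0) / w))"
  have u_in: "u w \<in> H" if "w \<in> I" for w using that by (simp add: u_def I_def)
  have k_in: "kfun w \<in> H" if "w \<in> I" for w using that by (simp add: I_def)
  have gram: "ip (u w) (u z) = ip (kfun w) (kfun z) - b w * cnj (b z)" if w: "w \<in> I" and z: "z \<in> I" for w z
  proof -
    have alg: "(1 / W) * (1 / z) * ((1 - S * T) / (1 - z * W) - (1 - S * T0) - (1 - S0 * T) + (1 - S0 * T0))
        = (1 - S * T) / (1 - z * W) - (T - T0) / W * ((S - S0) / z)"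
      if "W \<noteq> 0" "z \<noteq> 0" "1 - z * W \<noteq> 0" for S S0 T T0 W z :: complex
      using that by (simp add: divide_simps) (simp add: algebra_simps)
    have "ip (u w) (u z) = (1 / cnj w) * (1 / z) * (kfun w z - kfun 0 z - kfun w 0 + kfun 0 0)"
      using w z by (simp add: u_def I_def ip_simps ip_kfun divide_simps)
    also have "\<dots> = (1 / cnj w) * (1 / z) * ((1 - s z * cnj (s w)) / (1 - z * cnj w)
        - (1 - s z * cnj (s 0)) - (1 - s 0 * cnj (s w)) + (1 - s 0 * cnj (s 0)))"
      using w z by (simp add: kfun_eq I_def)
    also have "\<dots> = (1 - s z * cnj (s w)) / (1 - z * cnj w) - b w * cnj (b z)"
      using w z one_minus_mult_cnj_neq_0[of z w] unfolding b_def I_def by (subst alg) auto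
    finally show ?thesis using w z by (simp add: ip_kfun kfun_eq I_def)
  qed
  have gram1: "ip (u w) (lcomb u ys) = ip (kfun w) (lcomb kfun ys) - b w * cnj (\<Sum>(c, i)\<leftarrow>ys. c * b i)"
    if w: "w \<in> I" and ys: "snd ` set ys \<subseteq> I" for w ys
    using ys
  proof (induction ys)
    case (Cons a ys)
    obtain c v where a: "a = (c, v)" by force
    have "lcomb u ys \<in> H" "lcomb kfun ys \<in> H"
      using Cons.prems by (auto intro: lcomb_in[where I = I] u_in k_in)
    then show ?case
      using Cons w u_in k_in by (simp add: a ip_simps gram algebra_simps del: plus_fun_apply fscale_apply)
  qed (use w u_in k_in in simp)
  have gram2: "ip (lcomb u xs) (lcomb u ys) = ip (lcomb kfun xs) (lcomb kfun ys)
      - (\<Sum>(c, i)\<leftarrow>xs. c * b i) * cnj (\<Sum>(c, i)\<leftarrow>ys. c * b i)"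
    if xs: "snd ` set xs \<subseteq> I" and ys: "snd ` set ys \<subseteq> I" for xs ys
    using xs
  proof (induction xs)
    case (Cons a xs)
    obtain c v where a: "a = (c, v)" by force
    have "lcomb u xs \<in> H" "lcomb kfun xs \<in> H" "lcomb u ys \<in> H" "lcomb kfun ys \<in> H"
      using Cons.prems ys by (auto intro: lcomb_in[where I = I] u_in k_in)
    then show ?case
      using Cons ys u_in k_in by (simp add: a ip_simps gram1 algebra_simps del: plus_fun_apply fscale_apply)
  next
    case Nil
    have "lcomb u ys \<in> H" "lcomb kfun ys \<in> H"
      using ys by (auto intro: lcomb_in[where I = I] u_in k_in)
    then show ?case by (simp flip: zero_fun_def)
  qed
  \<comment> \<open>The wanted values \<open>y w\<close> are \<open>ip (u w) f\<close>. Replacing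
    each \<open>kfun w\<close> by \<open>u w\<close> does not increase the norm of a combination, so
    the moment problem is solvable with bound \<open>nrm f\<close>, and its solution is the shifted
    function. The origin is left out of \<open>I\<close> because \<open>u w\<close> divides by
    \<open>cnj w\<close>.\<close>
  have "\<exists>h\<in>H. nrm h \<le> nrm f \<and> (\<forall>w\<in>I. ip (kfun w) h = y w)"
  proof (rule riesz_lcomb)
    fix xs :: "(complex \<times> complex) list" assume xs: "snd ` set xs \<subseteq> I"
    have u': "lcomb u xs \<in> H" and k': "lcomb kfun xs \<in> H"
      using xs by (auto intro: lcomb_in[where I = I] u_in k_in)
    have uf: "ip (u w) f = y w" if "w \<in> I" for w
      using that f by (simp add: u_def y_def I_def ip_simps kfun_ip)
    have "(\<Sum>(c, w)\<leftarrow>xs. c * y w) = (\<Sum>(c, w)\<leftarrow>xs. c * ip (u w) f)"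
      using xs uf by (intro arg_cong[where f = sum_list] map_cong) auto
    also have "\<dots> = ip (lcomb u xs) f" using ip_lcomb_left[OF u_in xs f] by simp
    finally have "cmod (\<Sum>(c, w)\<leftarrow>xs. c * y w) \<le> nrm (lcomb u xs) * nrm f"
      using cauchy_schwarz[OF u' f] by simp
    also have "nrm (lcomb u xs) \<le> nrm (lcomb kfun xs)"
    proof (rule power2_le_imp_le)
      define \<beta> where "\<beta> = (\<Sum>(c, i)\<leftarrow>xs. c * b i)"
      have "complex_of_real ((nrm (lcomb u xs))\<^sup>2) = of_real ((nrm (lcomb kfun xs))\<^sup>2 - (cmod \<beta>)\<^sup>2)"
        using gram2[OF xs xs] complex_norm_square[of \<beta>]
        by (simp add: ip_self[OF u'] ip_self[OF k'] \<beta>_def[symmetric])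
      then have "(nrm (lcomb u xs))\<^sup>2 = (nrm (lcomb kfun xs))\<^sup>2 - (cmod \<beta>)\<^sup>2" by (simp only: of_real_eq_iff)
      then show "(nrm (lcomb u xs))\<^sup>2 \<le> (nrm (lcomb kfun xs))\<^sup>2" by simp
    qed (use k' in simp)
    then have "nrm (lcomb u xs) * nrm f \<le> nrm f * nrm (lcomb kfun xs)"
      using f by (simp add: mult.commute mult_left_mono)
    finally show "cmod (\<Sum>(c, w)\<leftarrow>xs. c * y w) \<le> nrm f * nrm (lcomb kfun xs)" .
  qed (use k_in f in auto)
  then obtain h where h: "h \<in> H" "nrm h \<le> nrm f" "\<And>w. w \<in> I \<Longrightarrow> ip (kfun w) h = y w" by blast
  have "z * h z = f z - f 0" if "cmod z < 1" for z
  proof (cases "z = 0")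
    case False
    then have "cnj (h z) = y z" using h(3)[of z] kfun_ip[OF h(1), of z] that by (simp add: I_def)
    then have "h z = (f z - f 0) / z" by (simp only: y_def complex_cnj_cancel_iff)
    then show ?thesis using False by simp
  qed simp
  with h show ?thesis by blast
qed

definition bshift :: "(complex \<Rightarrow> complex) \<Rightarrow> complex \<Rightarrow> complex" where
  "bshift f = (SOME h. h \<in> H \<and> nrm h \<le> nrm f \<and> (\<forall>z. cmod z < 1 \<longrightarrow> z * h z = f z - f 0))"

lemma bshift_in [simp]: "f \<in> H \<Longrightarrow> bshift f \<in> H"
  and nrm_bshift_le: "f \<in> H \<Longrightarrow> nrm (bshift f) \<le> nrm f"
  and bshift_eq: "f \<in> H \<Longrightarrow> cmod z < 1 \<Longrightarrow> z * bshift f z = f z - f 0"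
  unfolding bshift_def using someI_ex[OF backward_shift_exists] by blast+

lemma bshift_unique:
  assumes "f \<in> H" "h \<in> H" "\<And>z. cmod z < 1 \<Longrightarrow> z * h z = f z - f 0"
  shows "bshift f = h"
proof (rule eq_if_eq_on_punctured_disc)
  fix z :: complex assume "z \<noteq> 0" "cmod z < 1"
  then show "bshift f z = h z" using bshift_eq[OF assms(1), of z] assms(3)[of z] by (metis mult_left_cancel)
qed (use assms in auto)

lemma bshift_add: "f \<in> H \<Longrightarrow> g \<in> H \<Longrightarrow> bshift (f + g) = bshift f + bshift g"
  by (rule bshift_unique) (auto simp: algebra_simps bshift_eq)

lemma bshift_fscale: "f \<in> H \<Longrightarrow> bshift (c \<cdot>\<^sub>f f) = c \<cdot>\<^sub>f bshift f"
proof (rule bshift_unique)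
  fix z :: complex assume f: "f \<in> H" and z: "cmod z < 1"
  have "z * (c \<cdot>\<^sub>f bshift f) z = c * (z * bshift f z)" by simp
  then show "z * (c \<cdot>\<^sub>f bshift f) z = (c \<cdot>\<^sub>f f) z - (c \<cdot>\<^sub>f f) 0"
    unfolding bshift_eq[OF f z] by (simp add: algebra_simps)
qed auto

lemma bshift_diff: "f \<in> H \<Longrightarrow> g \<in> H \<Longrightarrow> bshift (f - g) = bshift f - bshift g"
  by (rule bshift_unique) (auto simp: algebra_simps bshift_eq)

section \<open>The operators \<open>I - w R\<close> and their action on Taylor coefficients\<close>

definition Q :: "complex \<Rightarrow> (complex \<Rightarrow> complex) \<Rightarrow> complex \<Rightarrow> complex" where
  "Q w f = f - w \<cdot>\<^sub>f bshift f"

lemma Q_in [simp]: "f \<in> H \<Longrightarrow> Q w f \<in> H"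
  by (simp add: Q_def)

lemma Qpow_in [simp]: "f \<in> H \<Longrightarrow> (Q w ^^ m) f \<in> H"
  by (induction m) auto

lemma bshiftpow_in [simp]: "f \<in> H \<Longrightarrow> (bshift ^^ m) f \<in> H"
  by (induction m) auto

lemma nrm_bshiftpow_le: "f \<in> H \<Longrightarrow> nrm ((bshift ^^ m) f) \<le> nrm f"
proof (induction m)
  case (Suc m)
  then show ?case using nrm_bshift_le[of "(bshift ^^ m) f"] by simp
qed simp

lemma Q_add: "f \<in> H \<Longrightarrow> g \<in> H \<Longrightarrow> Q w (f + g) = Q w f + Q w g"
  by (simp add: Q_def bshift_add fscale_add)

lemma Q_diff: "f \<in> H \<Longrightarrow> g \<in> H \<Longrightarrow> Q w (f - g) = Q w f - Q w g"
  by (simp add: Q_def bshift_diff fscale_diff)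

lemma Q_fscale: "f \<in> H \<Longrightarrow> Q w (c \<cdot>\<^sub>f f) = c \<cdot>\<^sub>f Q w f"
  by (simp add: Q_def bshift_fscale fscale_diff mult.commute)

lemma bshift_Q: "f \<in> H \<Longrightarrow> bshift (Q w f) = Q w (bshift f)"
  by (simp add: Q_def bshift_diff bshift_fscale)

lemma Q_commute: "f \<in> H \<Longrightarrow> Q w (Q t f) = Q t (Q w f)"
  by (simp add: Q_def bshift_diff bshift_fscale fscale_diff mult.commute algebra_simps)

lemma bshift_Qpow: "f \<in> H \<Longrightarrow> bshift ((Q w ^^ m) f) = (Q w ^^ m) (bshift f)"
  by (induction m) (auto simp: bshift_Q)

lemma Qpow_commute: "f \<in> H \<Longrightarrow> Q w ((Q t ^^ m) f) = (Q t ^^ m) (Q w f)"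
proof (induction m)
  case (Suc m)
  then show ?case using Q_commute[of "(Q t ^^ m) f" w t] by simp
qed simp

lemma Q_change: "Q t f = Q w f + (w - t) \<cdot>\<^sub>f bshift f"
  by (auto simp: Q_def fun_eq_iff algebra_simps)

lemma nrm_Q_le: "f \<in> H \<Longrightarrow> cmod w \<le> 1 \<Longrightarrow> nrm (Q w f) \<le> 2 * nrm f"
proof -
  assume f: "f \<in> H" and w: "cmod w \<le> 1"
  have "nrm (Q w f) \<le> nrm f + cmod w * nrm (bshift f)"
    unfolding Q_def using nrm_triangle_diff[of f "w \<cdot>\<^sub>f bshift f"] f by (simp add: nrm_fscale)
  also have "cmod w * nrm (bshift f) \<le> 1 * nrm f" using w f nrm_bshift_le[OF f] by (intro mult_mono) auto
  finally show ?thesis by simp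
qed

lemma taylor_coeff_bshift:
  assumes f: "f \<in> H" and w: "cmod w < 1"
  shows "taylor_coeff f (Suc j) w = w * taylor_coeff (bshift f) (Suc j) w + taylor_coeff (bshift f) j w"
proof -
  have b: "bshift f holomorphic_on ball 0 1" using f by (simp add: holomorphic_in)
  have "taylor_coeff f (Suc j) w = taylor_coeff (\<lambda>z. f 0 + (0 + 1 * z) * bshift f z) (Suc j) w"
  proof (rule taylor_coeff_cong[OF holomorphic_in[OF f]])
    fix z :: complex assume "z \<in> ball 0 1"
    then show "f z = f 0 + (0 + 1 * z) * bshift f z" using bshift_eq[OF f, of z] by simp
  qed (use w in auto)
  also have "\<dots> = taylor_coeff (\<lambda>z. f 0) (Suc j) w + taylor_coeff (\<lambda>z. (0 + 1 * z) * bshift f z) (Suc j) w"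
    using w by (intro taylor_coeff_add[where S = "ball 0 1"] holomorphic_intros b) auto
  also have "\<dots> = w * taylor_coeff (bshift f) (Suc j) w + taylor_coeff (bshift f) j w"
    using taylor_coeff_affine_mult[OF b, of w 0 1 j] w by (simp add: taylor_coeff_const)
  finally show ?thesis .
qed

lemma Q_eval: "f \<in> H \<Longrightarrow> cmod w < 1 \<Longrightarrow> Q w f w = f 0"
  using bshift_eq[of f w] by (simp add: Q_def)

lemma taylor_coeff_Q_Suc:
  assumes "f \<in> H" "cmod w < 1"
  shows "taylor_coeff (Q w f) (Suc j) w = taylor_coeff (bshift f) j w"
  using assms taylor_coeff_bshift[OF assms, of j]
  by (simp add: Q_def taylor_coeff_minus taylor_coeff_fscale)

text \<open>At \<open>w\<close>, one factor \<open>Q w\<close> turns the coefficient of order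
  \<open>j + 1\<close> into the coefficient of order \<open>j\<close> of the backward shift. After
  \<open>n\<close> such steps the last factor leaves the value at 0, hence the exponent
  \<open>n + 1\<close>.\<close>

lemma taylor_coeff_Qpow:
  assumes "f \<in> H" "cmod w < 1"
  shows "taylor_coeff ((Q w ^^ Suc n) f) n w = (bshift ^^ n) f 0"
  using assms(1)
proof (induction n arbitrary: f)
  case 0
  then show ?case using Q_eval assms(2) by simp
next
  case (Suc n)
  have "taylor_coeff ((Q w ^^ Suc (Suc n)) f) (Suc n) w = taylor_coeff (bshift ((Q w ^^ Suc n) f)) n w"
    using taylor_coeff_Q_Suc[of "(Q w ^^ Suc n) f" w n] Suc.prems assms(2) by simp
  also have "\<dots> = (bshift ^^ n) (bshift f) 0"
    using Suc by (simp only: bshift_Qpow bshift_in)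
  finally show ?case by (simp add: funpow_swap1)
qed

lemma tendsto_Qpow:
  assumes f: "f \<in> H" and t: "cmod t = 1"
  shows "((\<lambda>w. nrm ((Q w ^^ m) f - (Q t ^^ m) f)) \<longlongrightarrow> 0) (at t within ball 0 1)"
proof (induction m)
  case (Suc m)
  define g where "g = (\<lambda>w. (Q w ^^ m) f)"
  have g: "g w \<in> H" for w using f by (simp add: g_def)
  have lim: "((\<lambda>w. 2 * nrm (g w - g t) + cmod (w - t) * nrm (g t)) \<longlongrightarrow> 2 * 0 + cmod (t - t) * nrm (g t))
      (at t within ball 0 1)"
    using Suc unfolding g_def by (intro tendsto_intros)
  have "\<forall>\<^sub>F w in at t within ball 0 1. norm (nrm (Q w (g w) - Q t (g t)))
      \<le> 2 * nrm (g w - g t) + cmod (w - t) * nrm (g t)"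
    unfolding eventually_at_filter
  proof (intro always_eventually allI impI)
    fix w :: complex assume w: "w \<in> ball 0 1"
    have "Q w (g w) - Q t (g t) = Q w (g w - g t) - (w - t) \<cdot>\<^sub>f bshift (g t)"
      using g Q_change[of t "g t" w] by (simp add: Q_diff)
    then have "nrm (Q w (g w) - Q t (g t)) \<le> nrm (Q w (g w - g t)) + cmod (w - t) * nrm (bshift (g t))"
      using nrm_triangle_diff[of "Q w (g w - g t)" "(w - t) \<cdot>\<^sub>f bshift (g t)"] g by (simp add: nrm_fscale)
    also have "\<dots> \<le> 2 * nrm (g w - g t) + cmod (w - t) * nrm (g t)"
      using w g by (intro add_mono nrm_Q_le mult_left_mono nrm_bshift_le) auto
    finally show "norm (nrm (Q w (g w) - Q t (g t))) \<le> 2 * nrm (g w - g t) + cmod (w - t) * nrm (g t)"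
      using g by simp
  qed
  moreover have "((\<lambda>w. 2 * nrm (g w - g t) + cmod (w - t) * nrm (g t)) \<longlongrightarrow> 0) (at t within ball 0 1)"
    using lim by simp
  ultimately have "((\<lambda>w. nrm (Q w (g w) - Q t (g t))) \<longlongrightarrow> 0) (at t within ball 0 1)"
    by (rule Lim_null_comparison)
  then show ?case by (simp only: g_def funpow.simps o_apply)
next
  case 0
  then show ?case by (simp only: funpow.simps id_apply diff_self nrm_zero tendsto_const)
qed

section \<open>Uniform bounds in Stolz angles and boundary functionals\<close>

lemma cj_condition_imp_frequently:
  assumes "cj_condition s t n"
  shows "\<exists>M\<ge>0. \<exists>\<^sub>F z in at t within ball 0 1. cmod z < 1 \<and> nrm (kder n z) \<le> M"
proof -
  let ?F = "at t within ball 0 1"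
  let ?g = "\<lambda>z. ereal (Re ((wirtinger ^^ n) ((wirtinger_bar ^^ n) (cj_quotient s)) z))"
  from assms have "Liminf ?F ?g < \<infinity>" by (simp add: cj_condition_def)
  then obtain m :: nat where m: "Liminf ?F ?g < ereal (real m)"
    using less_PInf_Ex_of_nat[of "Liminf ?F ?g"] by auto
  \<comment> \<open>A finite lower limit bounds the derivative only at points accumulating at
    \<open>t\<close>, so the conclusion is "frequently" rather than "eventually".\<close>
  have "\<not> (\<forall>\<^sub>F z in ?F. ereal (real m) \<le> ?g z)"
    using m Liminf_bounded[of "ereal (real m)" ?g ?F] by (auto simp: not_le)
  then have "\<exists>\<^sub>F z in ?F. \<not> (ereal (real m) \<le> ?g z)" by (simp add: frequently_def)
  moreover have "\<forall>\<^sub>F z in ?F. z \<in> ball 0 1" by (simp add: eventually_at_filter)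
  ultimately have "\<exists>\<^sub>F z in ?F. \<not> (ereal (real m) \<le> ?g z) \<and> z \<in> ball 0 1"
    by (rule frequently_eventually_frequently)
  then have "\<exists>\<^sub>F z in ?F. cmod z < 1 \<and> nrm (kder n z) \<le> 1 + real m"
  proof (rule frequently_elim1)
    fix z assume z: "\<not> (ereal (real m) \<le> ?g z) \<and> z \<in> ball 0 1"
    then have k: "kder n z \<in> H" by simp
    have "(wirtinger ^^ n) ((wirtinger_bar ^^ n) (cj_quotient s)) z = of_real (fact n * fact n * (nrm (kder n z))\<^sup>2)"
      using z by (simp add: mixed_derivative_cj_quotient gram_def ip_self)
    with z have "fact n * fact n * (nrm (kder n z))\<^sup>2 < real m" by (simp del: of_real_mult of_real_power)
    moreover have "1 * (nrm (kder n z))\<^sup>2 \<le> fact n * fact n * (nrm (kder n z))\<^sup>2"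
      using fact_ge_1[of n, where ?'a = real] by (intro mult_right_mono) (auto simp: mult_ge1_I)
    \<comment> \<open>With \<open>x = nrm (kder n z)\<close>, this gives
      \<open>2 * x \<le> 1 + x^2\<close>, a bound linear in \<open>m\<close>.\<close>
    moreover have "0 \<le> (nrm (kder n z) - 1)\<^sup>2" by simp
    then have "0 \<le> (nrm (kder n z))\<^sup>2 - 2 * nrm (kder n z) + 1" by (simp add: power2_diff)
    ultimately have "nrm (kder n z) \<le> 1 + real m"
      using nrm_nonneg[OF k] by linarith
    then show "cmod z < 1 \<and> nrm (kder n z) \<le> 1 + real m" using z by simp
  qed
  then show ?thesis by (intro exI[of _ "1 + real m"]) simp
qed

text \<open>
  On \<open>(I - w R)\<^sup>n\<^sup>+\<^sup>1 f\<close>, with \<open>R\<close> the backward shift, the functional \<open>h \<mapsto> h\<^sub>n(w)\<close> takes the value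
  \<open>(R\<^sup>n f)(0)\<close>, which does not depend on \<open>w\<close>. A bound along one sequence tending to \<open>t\<close> therefore becomes
  a bound in terms of \<open>(I - t R)\<^sup>n\<^sup>+\<^sup>1 f\<close>.
\<close>

lemma bshiftpow_bound:
  assumes t: "cmod t = 1" and cj: "cj_condition s t n"
  shows "\<exists>M\<ge>0. \<forall>f\<in>H. cmod ((bshift ^^ n) f 0) \<le> M * nrm ((Q t ^^ Suc n) f)"
proof -
  let ?F = "at t within ball 0 1"
  obtain M where M: "0 \<le> M" and freq: "\<exists>\<^sub>F z in ?F. cmod z < 1 \<and> nrm (kder n z) \<le> M"
    using cj_condition_imp_frequently[OF cj] by blast
  have "cmod ((bshift ^^ n) f 0) \<le> M * nrm ((Q t ^^ Suc n) f)" if f: "f \<in> H" for f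
  proof (rule ccontr)
    let ?q = "\<lambda>w. (Q w ^^ Suc n) f"
    assume "\<not> ?thesis"
    then have less: "M * nrm (?q t) < cmod ((bshift ^^ n) f 0)" by simp
    \<comment> \<open>The assumed strict inequality at \<open>t\<close> persists for
      \<open>w\<close> near \<open>t\<close> by continuity of
      \<open>w \<mapsto> (Q w ^^ Suc n) f\<close>. Some such \<open>w\<close> has
      \<open>nrm (kder n w) \<le> M\<close>, which contradicts Cauchy-Schwarz.\<close>
    have "((\<lambda>w. M * (nrm (?q t) + nrm (?q w - ?q t))) \<longlongrightarrow> M * (nrm (?q t) + 0)) ?F"
      by (intro tendsto_intros tendsto_Qpow f t)
    then have "\<forall>\<^sub>F w in ?F. M * (nrm (?q t) + nrm (?q w - ?q t)) < cmod ((bshift ^^ n) f 0)"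
      using less by (intro order_tendstoD(2)) auto
    with freq have "\<exists>\<^sub>F w in ?F. (cmod w < 1 \<and> nrm (kder n w) \<le> M) \<and>
        M * (nrm (?q t) + nrm (?q w - ?q t)) < cmod ((bshift ^^ n) f 0)"
      by (rule frequently_eventually_frequently)
    then obtain w where w: "cmod w < 1" "nrm (kder n w) \<le> M"
        "M * (nrm (?q t) + nrm (?q w - ?q t)) < cmod ((bshift ^^ n) f 0)"
      using frequently_ex by blast
    have qH: "?q w \<in> H" for w using f by (rule Qpow_in)
    have "(bshift ^^ n) f 0 = ip (?q w) (kder n w)"
      using taylor_coeff_Qpow[OF f w(1)] ip_kder[OF w(1) qH] by simp
    then have "cmod ((bshift ^^ n) f 0) \<le> nrm (?q w) * nrm (kder n w)"
      using cauchy_schwarz[OF qH, of "kder n w"] w(1) by simp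
    also have "\<dots> \<le> (nrm (?q t) + nrm (?q w - ?q t)) * M"
      using w(1,2) M qH nrm_le_diff[OF qH qH, of w t] by (intro mult_mono) auto
    finally show False using w(3) by (simp add: mult.commute)
  qed
  with M show ?thesis by blast
qed

text \<open>Neumann series: the solution is the sum of \<open>w^k R^k f\<close>, which converges
  since \<open>R\<close> is a contraction and \<open>cmod w < 1\<close>.\<close>

lemma Q_surj:
  assumes w: "cmod w < 1" and f: "f \<in> H"
  shows "\<exists>h\<in>H. Q w h = f"
proof -
  define a where "a = (\<lambda>k. w ^ k \<cdot>\<^sub>f (bshift ^^ k) f)"
  define F where "F = (\<lambda>m. \<Sum>k<m. a k)"
  have aH: "a k \<in> H" for k using f by (simp add: a_def)
  have FH: "F m \<in> H" for m unfolding F_def by (intro sum_in aH)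
  have na: "nrm (a k) \<le> cmod w ^ k * nrm f" for k
    using f nrm_bshiftpow_le[OF f] by (simp add: a_def nrm_fscale norm_power mult_left_mono)
  \<comment> \<open>A real geometric majorant; its Cauchy property is inherited by the partial sums
    in \<open>H\<close>.\<close>
  define S where "S = (\<lambda>m. \<Sum>k<m. cmod w ^ k * nrm f)"
  have diff: "nrm (F (m + l) - F m) \<le> S (m + l) - S m" for m l
  proof (induction l)
    case (Suc l)
    have eq: "F (m + Suc l) - F m = (F (m + l) - F m) + a (m + l)" by (simp add: F_def)
    have "nrm (F (m + Suc l) - F m) \<le> nrm (F (m + l) - F m) + nrm (a (m + l))"
      unfolding eq using FH aH by (intro nrm_triangle) auto
    moreover have "S (m + Suc l) = S (m + l) + cmod w ^ (m + l) * nrm f" by (simp add: S_def)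
    ultimately show ?case using Suc na[of "m + l"] by linarith
  qed (simp flip: zero_fun_def)
  have "summable (\<lambda>k. cmod w ^ k * nrm f)" using w by (intro summable_mult2 summable_geometric) simp
  then have "convergent S" by (simp add: S_def summable_iff_convergent)
  then have cauchy: "Cauchy S" by (rule convergent_Cauchy)
  have "\<exists>M. \<forall>m\<ge>M. \<forall>n\<ge>M. nrm (F m - F n) < e" if "e > 0" for e
  proof -
    obtain M where M: "\<And>m n. m \<ge> M \<Longrightarrow> n \<ge> M \<Longrightarrow> dist (S m) (S n) < e"
      using metric_CauchyD[OF cauchy \<open>e > 0\<close>] by blast
    have "nrm (F m - F n) < e" if "m \<ge> M" "n \<ge> M" "n \<le> m" for m n
      using diff[of n "m - n"] M[of m n] that by (simp add: dist_real_def)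
    then have "nrm (F m - F n) < e" if "m \<ge> M" "n \<ge> M" for m n
      using that nrm_diff_commute[OF FH FH, of m n] by (metis linear)
    then show ?thesis by blast
  qed
  from cauchy_sequence_converges[of F, OF FH this] obtain h where h: "h \<in> H" and lim: "(\<lambda>m. nrm (F m - h)) \<longlonglongrightarrow> 0"
    by blast
  have QF: "Q w (F m) = f - w ^ m \<cdot>\<^sub>f (bshift ^^ m) f" for m
  proof (induction m)
    case 0
    then show ?case using Q_fscale[of 0 w 0] by (simp add: F_def flip: zero_fun_def)
  next
    case (Suc m)
    have "Q w (F (Suc m)) = Q w (F m) + Q w (a m)" using FH aH by (simp add: F_def Q_add)
    also have "Q w (a m) = w ^ m \<cdot>\<^sub>f (bshift ^^ m) f - w ^ Suc m \<cdot>\<^sub>f (bshift ^^ Suc m) f"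
      using f by (simp add: Q_def a_def bshift_fscale)
    finally show ?case unfolding Suc by (simp only: add_diff_eq diff_add_cancel)
  qed
  have "nrm (Q w h - f) \<le> 2 * nrm (F m - h) + cmod w ^ m * nrm f" for m
  proof -
    have 1: "Q w (F m - h) = f - w ^ m \<cdot>\<^sub>f (bshift ^^ m) f - Q w h"
      using FH h by (simp only: Q_diff QF)
    have "Q w h - f = (- 1) \<cdot>\<^sub>f (Q w (F m - h) + w ^ m \<cdot>\<^sub>f (bshift ^^ m) f)"
      unfolding 1 by (rule ext) simp
    then have "nrm (Q w h - f) = nrm (Q w (F m - h) + w ^ m \<cdot>\<^sub>f (bshift ^^ m) f)"
      using FH h f by (simp add: nrm_fscale)
    also have "\<dots> \<le> nrm (Q w (F m - h)) + nrm (w ^ m \<cdot>\<^sub>f (bshift ^^ m) f)"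
      using FH h f by (intro nrm_triangle) auto
    also have "\<dots> \<le> 2 * nrm (F m - h) + cmod w ^ m * nrm f"
      using FH h f w nrm_bshiftpow_le[OF f, of m]
      by (intro add_mono nrm_Q_le) (auto simp: nrm_fscale norm_power mult_left_mono)
    finally show ?thesis .
  qed
  moreover have "(\<lambda>m. 2 * nrm (F m - h) + cmod w ^ m * nrm f) \<longlonglongrightarrow> 2 * 0 + 0 * nrm f"
    using w by (intro tendsto_intros lim LIMSEQ_realpow_zero) auto
  ultimately have "nrm (Q w h - f) \<le> 2 * 0 + 0 * nrm f" by (intro LIMSEQ_le_const) auto
  then have "nrm (Q w h - f) = 0" using h f by (simp add: order_antisym)
  then have "Q w h - f = 0" using h f by (intro nrm_eq_0) auto
  then show ?thesis using h by auto
qed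

lemma Qpow_surj:
  assumes w: "cmod w < 1" and f: "f \<in> H"
  shows "\<exists>h\<in>H. (Q w ^^ m) h = f"
  using f
proof (induction m arbitrary: f)
  case (Suc m)
  obtain g where "g \<in> H" "Q w g = f" using Q_surj[OF w Suc.prems] by blast
  moreover obtain h where "h \<in> H" "(Q w ^^ m) h = g" using Suc.IH[OF \<open>g \<in> H\<close>] by blast
  ultimately show ?case by auto
qed auto

text \<open>This is the boundedness of \<open>(I - t R) (I - w R)^(-1)\<close>. Contractivity gives
  \<open>(1 - cmod w) * nrm f \<le> nrm (Q w f)\<close>, and the error \<open>(w - t) R f\<close>
  has norm at most \<open>a * (1 - cmod w) * nrm f\<close>; the two factors
  \<open>1 - cmod w\<close> compensate exactly in a Stolz angle.\<close>

lemma nrm_Q_compare: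
  assumes a: "1 < a" and w: "w \<in> stolz a t" and f: "f \<in> H"
  shows "nrm (Q t f) \<le> (1 + a) * nrm (Q w f)"
proof -
  have w1: "cmod w < 1" "cmod (w - t) \<le> a * (1 - cmod w)" using w by (auto simp: stolz_def)
  have "f = Q w f + w \<cdot>\<^sub>f bshift f" by (simp add: Q_def)
  then have "nrm f \<le> nrm (Q w f) + cmod w * nrm (bshift f)"
    using nrm_triangle[of "Q w f" "w \<cdot>\<^sub>f bshift f"] f by (simp add: nrm_fscale)
  also have "cmod w * nrm (bshift f) \<le> cmod w * nrm f" using nrm_bshift_le[OF f] by (intro mult_left_mono) auto
  finally have *: "(1 - cmod w) * nrm f \<le> nrm (Q w f)" by (simp add: algebra_simps)
  have "nrm (Q t f) \<le> nrm (Q w f) + cmod (w - t) * nrm (bshift f)"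
    unfolding Q_change[of t f w] using nrm_triangle[of "Q w f" "(w - t) \<cdot>\<^sub>f bshift f"] f by (simp add: nrm_fscale)
  also have "cmod (w - t) * nrm (bshift f) \<le> (a * (1 - cmod w)) * nrm f"
    using w1 f nrm_bshift_le[OF f] a by (intro mult_mono) auto
  also have "\<dots> = a * ((1 - cmod w) * nrm f)" by simp
  also have "\<dots> \<le> a * nrm (Q w f)" using * a by (intro mult_left_mono) auto
  finally show ?thesis by (simp add: algebra_simps)
qed

lemma nrm_Qpow_compare:
  assumes a: "1 < a" and w: "w \<in> stolz a t" and f: "f \<in> H"
  shows "nrm ((Q t ^^ m) f) \<le> (1 + a) ^ m * nrm ((Q w ^^ m) f)"
  using f
proof (induction m arbitrary: f)
  case (Suc m)
  have "nrm ((Q t ^^ Suc m) f) \<le> (1 + a) * nrm (Q w ((Q t ^^ m) f))"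
    using nrm_Q_compare[OF a w, of "(Q t ^^ m) f"] Suc.prems by simp
  also have "Q w ((Q t ^^ m) f) = (Q t ^^ m) (Q w f)" using Suc.prems by (rule Qpow_commute)
  also have "nrm ((Q t ^^ m) (Q w f)) \<le> (1 + a) ^ m * nrm ((Q w ^^ m) (Q w f))"
    using Suc.prems by (intro Suc.IH) simp
  finally show ?case using a by (simp add: funpow_swap1 mult.assoc)
qed simp

text \<open>Write \<open>f\<close> as \<open>(Q w ^^ Suc n) h\<close>. The coefficient at
  \<open>w\<close> is then a quantity depending on \<open>h\<close> alone, bounded through
  \<open>Q t\<close>, and the comparison of \<open>Q t\<close> with \<open>Q w\<close> leads back to
  \<open>nrm f\<close>.\<close>

lemma stolz_bound:
  assumes t: "cmod t = 1" and cj: "cj_condition s t n" and a: "1 < a"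
  shows "\<exists>C\<ge>0. \<forall>w\<in>stolz a t. \<forall>f\<in>H. cmod (taylor_coeff f n w) \<le> C * nrm f"
proof -
  obtain M where M: "0 \<le> M" "\<And>f. f \<in> H \<Longrightarrow> cmod ((bshift ^^ n) f 0) \<le> M * nrm ((Q t ^^ Suc n) f)"
    using bshiftpow_bound[OF t cj] by blast
  have "cmod (taylor_coeff f n w) \<le> (M * (1 + a) ^ Suc n) * nrm f" if w: "w \<in> stolz a t" and f: "f \<in> H" for w f
  proof -
    have w1: "cmod w < 1" using w by (simp add: stolz_def)
    obtain h where h: "h \<in> H" "(Q w ^^ Suc n) h = f" using Qpow_surj[OF w1 f] by blast
    have "taylor_coeff f n w = (bshift ^^ n) h 0" using taylor_coeff_Qpow[OF h(1) w1, of n] by (simp only: h(2))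
    also have "cmod \<dots> \<le> M * nrm ((Q t ^^ Suc n) h)" by (rule M(2)[OF h(1)])
    also have "\<dots> \<le> M * ((1 + a) ^ Suc n * nrm ((Q w ^^ Suc n) h))"
      using M(1) by (intro mult_left_mono nrm_Qpow_compare a w h)
    finally show ?thesis using h(2) by (simp add: mult.assoc)
  qed
  moreover have "0 \<le> M * (1 + a) ^ Suc n" using M(1) a by simp
  ultimately show ?thesis by blast
qed

text \<open>The derivative of the coefficient of order \<open>j\<close> is \<open>j + 1\<close>
  times the next one. It is bounded on a convex region containing 0, where the coefficient is under
  control.\<close>

lemma stolz_bound_pred:
  assumes t: "cmod t = 1" and a: "1 < a"
    and bound: "\<exists>C\<ge>0. \<forall>w\<in>stolz a t. \<forall>f\<in>H. cmod (taylor_coeff f (Suc j) w) \<le> C * nrm f"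
  shows "\<exists>C\<ge>0. \<forall>w\<in>stolz a t. \<forall>f\<in>H. cmod (taylor_coeff f j w) \<le> C * nrm f"
proof -
  obtain C where C: "0 \<le> C" "\<And>w f. w \<in> stolz a t \<Longrightarrow> f \<in> H \<Longrightarrow> cmod (taylor_coeff f (Suc j) w) \<le> C * nrm f"
    using bound by blast
  obtain C0 where C0: "0 \<le> C0" "\<And>f. f \<in> H \<Longrightarrow> cmod (taylor_coeff f j 0) \<le> C0 * nrm f"
    using taylor_coeff_bound[of 0 j] by auto
  have zero: "0 \<in> stolz a t" using a t by (simp add: stolz_def)
  have "cmod (taylor_coeff f j w) \<le> (C0 + real (Suc j) * C) * nrm f" if w: "w \<in> stolz a t" and f: "f \<in> H" for w f
  proof -
    have w1: "cmod w \<le> 1" using w by (simp add: stolz_def)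
    have "cmod (taylor_coeff f j w - taylor_coeff f j 0) \<le> (real (Suc j) * (C * nrm f)) * cmod (w - 0)"
    proof (rule field_differentiable_bound[of "stolz a t"])
      show "convex (stolz a t)" using a by (intro convex_stolz) simp
      fix z assume z: "z \<in> stolz a t"
      then have "z \<in> ball 0 1" using stolz_subset_ball by blast
      then show "(taylor_coeff f j has_field_derivative of_nat (Suc j) * taylor_coeff f (Suc j) z) (at z within stolz a t)"
        by (rule has_field_derivative_at_within[OF has_field_derivative_taylor_coeff[OF holomorphic_in[OF f] open_ball]])
      show "cmod (of_nat (Suc j) * taylor_coeff f (Suc j) z) \<le> real (Suc j) * (C * nrm f)"
        unfolding norm_mult norm_of_nat using C(2)[OF z f] by (intro mult_left_mono) auto
    qed (use w zero in auto)
    also have "\<dots> \<le> (real (Suc j) * (C * nrm f)) * 1" using w1 C(1) f by (intro mult_left_mono) auto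
    finally have "cmod (taylor_coeff f j w) \<le> cmod (taylor_coeff f j 0) + real (Suc j) * (C * nrm f)"
      using norm_triangle_ineq2[of "taylor_coeff f j w" "taylor_coeff f j 0"] by linarith
    then show ?thesis using C0(2)[OF f] by (simp add: algebra_simps)
  qed
  moreover have "0 \<le> C0 + real (Suc j) * C" using C C0 by simp
  ultimately show ?thesis by blast
qed

lemma stolz_bound_le:
  assumes t: "cmod t = 1" and cj: "cj_condition s t n" and a: "1 < a" and j: "j \<le> n"
  shows "\<exists>C\<ge>0. \<forall>w\<in>stolz a t. \<forall>f\<in>H. cmod (taylor_coeff f j w) \<le> C * nrm f"
  using j by (induction rule: inc_induct) (use stolz_bound[OF t cj a] stolz_bound_pred[OF t a] in auto)

text \<open>If \<open>h\<close> is orthogonal to the range, then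
  \<open>ip (t R h) h = ip h h\<close>, and contractivity forces \<open>R h = cnj t h\<close>. So
  \<open>h\<close> equals \<open>h 0 / (1 - z cnj t)\<close>, whose radial growth at
  \<open>t\<close> exceeds what the evaluation bound allows unless \<open>h 0 = 0\<close>.\<close>

lemma Q_range_dense:
  assumes t: "cmod t = 1" and f: "f \<in> H" and e: "0 < e"
  shows "\<exists>u\<in>H. nrm (f - Q t u) < e"
proof -
  have "\<exists>v\<in>Q t ` H. nrm (f - v) < e"
  proof (rule dense_if_orthogonal_trivial[OF _ _ _ _ _ f e])
    show "Q t ` H \<subseteq> H" by auto
    show "0 \<in> Q t ` H" using Q_fscale[of 0 t 0] by (intro image_eqI[of _ _ 0]) auto
    show "u + v \<in> Q t ` H" if "u \<in> Q t ` H" "v \<in> Q t ` H" for u v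
      using that by (auto simp flip: Q_add)
    show "c \<cdot>\<^sub>f v \<in> Q t ` H" if "v \<in> Q t ` H" for c v
      using that by (auto simp flip: Q_fscale)
    show "h = 0" if h: "h \<in> H" and orth: "\<And>v. v \<in> Q t ` H \<Longrightarrow> ip v h = 0" for h
    proof -
      have "ip (Q t h) h = 0" using h by (intro orth) auto
      then have eq: "t * ip (bshift h) h = ip h h" using h by (simp add: Q_def ip_simps)
      define d where "d = bshift h - cnj t \<cdot>\<^sub>f h"
      have d: "d \<in> H" using h by (simp add: d_def)
      have "ip h (bshift h) = cnj (ip (bshift h) h)" using h by (intro ip_cnj) auto
      then have "ip d d = ip (bshift h) (bshift h) - t * ip (bshift h) h - cnj (t * ip (bshift h) h)
          + (t * cnj t) * ip h h"
        using h by (simp add: d_def ip_simps algebra_simps)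
      also have "\<dots> = of_real ((nrm (bshift h))\<^sup>2 - (nrm h)\<^sup>2)"
        unfolding eq complex_norm_square[symmetric] t using h by (simp add: ip_self)
      finally have "(nrm d)\<^sup>2 = (nrm (bshift h))\<^sup>2 - (nrm h)\<^sup>2" by (simp add: nrm_square[OF d])
      moreover have "(nrm (bshift h))\<^sup>2 \<le> (nrm h)\<^sup>2" using h nrm_bshift_le[OF h] by (intro power_mono) auto
      ultimately have "(nrm d)\<^sup>2 \<le> 0" by simp
      then have "d = 0" using nrm_eq_0[OF d] by simp
      then have bh: "bshift h z = cnj t * h z" for z by (simp add: d_def fun_eq_iff)
      have hz: "(1 - z * cnj t) * h z = h 0" if "cmod z < 1" for z
        using bshift_eq[OF h that] by (simp add: bh algebra_simps)
      \<comment> \<open>On the radius to \<open>t\<close> one has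
        \<open>h 0 = (1 - r) * h (r t)\<close>, while \<open>h (r t)\<close> is at most of order
        \<open>(1 - r)^(-1/2)\<close>.\<close>
      have "cmod (h 0) \<le> nrm h * sqrt (1 - r)" if r: "0 \<le> r" "r < 1" for r
      proof -
        let ?z = "of_real r * t"
        have z: "cmod ?z = r" using r t by (simp add: norm_mult)
        have "t * cnj t = 1" using t complex_norm_square[of t] by simp
        then have eq1: "1 - ?z * cnj t = of_real (1 - r)" by (simp add: mult.assoc)
        have "h 0 = of_real (1 - r) * h ?z" using hz[of ?z] z r unfolding eq1 by simp
        then have "cmod (h 0) = (1 - r) * cmod (h ?z)" using r by (simp add: norm_mult del: of_real_diff)
        also have "\<dots> \<le> (1 - r) * (nrm h / sqrt (1 - cmod ?z))"
          using r z by (intro mult_left_mono eval_bound h) auto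
        also have "\<dots> = nrm h * sqrt (1 - r)" unfolding z using r by (simp add: field_simps)
        finally show ?thesis .
      qed
      then have ev: "\<forall>\<^sub>F r in at_left 1. cmod (h 0) \<le> nrm h * sqrt (1 - r)"
        using eventually_at_left_real[of 0 "1::real"] by (auto elim: eventually_mono)
      have "((\<lambda>r. nrm h * sqrt (1 - r)) \<longlongrightarrow> nrm h * sqrt (1 - 1)) (at_left 1)" by (intro tendsto_intros)
      from tendsto_lowerbound[OF this ev] have "h 0 = 0" by simp
      then have "h z = 0" if "cmod z < 1" for z using hz[OF that] one_minus_mult_cnj_neq_0[of z t] that t by simp
      then show "h = 0" using support[OF h] by (force simp: fun_eq_iff)
    qed
  qed
  then show ?thesis by blast
qed

lemma tendsto_zero_if_stolz_bound:
  assumes bound: "\<And>a. 1 < a \<Longrightarrow> \<exists>C\<ge>0. \<forall>w\<in>stolz a t. \<forall>f\<in>H. cmod (taylor_coeff f j w) \<le> C * nrm f"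
    and f: "f \<in> H"
  shows "((\<lambda>w. (w - t) * taylor_coeff f j w) \<longlongrightarrow> 0) (nontangential t)"
  unfolding tendsto_nontangential_iff
proof (intro allI impI)
  fix a :: real assume "1 < a"
  from bound[OF this] obtain C where
    C: "0 \<le> C" "\<And>w. w \<in> stolz a t \<Longrightarrow> cmod (taylor_coeff f j w) \<le> C * nrm f" using f by blast
  show "((\<lambda>w. (w - t) * taylor_coeff f j w) \<longlongrightarrow> 0) (at t within stolz a t)"
  proof (rule Lim_null_comparison)
    show "\<forall>\<^sub>F w in at t within stolz a t. cmod ((w - t) * taylor_coeff f j w) \<le> cmod (w - t) * (C * nrm f)"
      unfolding eventually_at_filter norm_mult using C(2) by (intro always_eventually) (auto intro: mult_left_mono)
    show "((\<lambda>w. cmod (w - t) * (C * nrm f)) \<longlongrightarrow> 0) (at t within stolz a t)"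
      by (rule tendsto_eq_intros refl)+ simp
  qed
qed

text \<open>Uniformly bounded functionals that converge on a dense subspace converge everywhere. The
  representer is found first, from all pairs of a vector and its limit, and then shown to give the
  limit for every \<open>f\<close>.\<close>

lemma boundary_functional_if_range:
  assumes t: "cmod t = 1"
    and bound: "\<And>a. 1 < a \<Longrightarrow> \<exists>C\<ge>0. \<forall>w\<in>stolz a t. \<forall>f\<in>H. cmod (taylor_coeff f j w) \<le> C * nrm f"
    and conv: "\<And>u. u \<in> H \<Longrightarrow> \<exists>L. (taylor_coeff (Q t u) j \<longlongrightarrow> L) (nontangential t)"
  shows "\<exists>g\<in>H. \<forall>f\<in>H. (taylor_coeff f j \<longlongrightarrow> ip f g) (nontangential t)"
proof -
  define W where "W = {(v, L). v \<in> H \<and> (taylor_coeff v j \<longlongrightarrow> L) (nontangential t)}"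
  note ball = eventually_ball_nontangential[of t]
  \<comment> \<open>The aperture 2 is an arbitrary choice: a nontangential limit can be estimated in
    any one angle.\<close>
  obtain C where C: "0 \<le> C" "\<And>w f. w \<in> stolz 2 t \<Longrightarrow> f \<in> H \<Longrightarrow> cmod (taylor_coeff f j w) \<le> C * nrm f"
    using bound[of 2] by auto
  obtain g where g: "g \<in> H" "\<And>v L. (v, L) \<in> W \<Longrightarrow> ip v g = L"
  proof (rule riesz_on_subspace[of W C])
    have "taylor_coeff (0 :: complex \<Rightarrow> complex) j = (\<lambda>_. 0)"
      using taylor_coeff_const[of 0 j] by (auto simp: zero_fun_def)
    then show "(0, 0) \<in> W" by (simp add: W_def)
  next
    fix v y v' y' assume "(v, y) \<in> W" "(v', y') \<in> W"
    then have v: "v \<in> H" "v' \<in> H" and lim: "((\<lambda>z. taylor_coeff v j z + taylor_coeff v' j z) \<longlongrightarrow> y + y') (nontangential t)"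
      by (auto simp: W_def intro: tendsto_add)
    have "\<forall>\<^sub>F z in nontangential t. taylor_coeff v j z + taylor_coeff v' j z = taylor_coeff (v + v') j z"
      using ball by eventually_elim (simp add: taylor_coeff_plus v)
    with lim have "(taylor_coeff (v + v') j \<longlongrightarrow> y + y') (nontangential t)" by (rule Lim_transform_eventually)
    with v show "(v + v', y + y') \<in> W" by (simp add: W_def)
  next
    fix c v y assume "(v, y) \<in> W"
    then have v: "v \<in> H" and lim: "((\<lambda>z. c * taylor_coeff v j z) \<longlongrightarrow> c * y) (nontangential t)"
      by (auto simp: W_def intro: tendsto_mult_left)
    have "\<forall>\<^sub>F z in nontangential t. c * taylor_coeff v j z = taylor_coeff (c \<cdot>\<^sub>f v) j z"
      using ball by eventually_elim (simp add: taylor_coeff_fscale v)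
    with lim have "(taylor_coeff (c \<cdot>\<^sub>f v) j \<longlongrightarrow> c * y) (nontangential t)" by (rule Lim_transform_eventually)
    with v show "(c \<cdot>\<^sub>f v, c * y) \<in> W" by (simp add: W_def)
  next
    fix v y assume "(v, y) \<in> W"
    then have v: "v \<in> H" and lim: "(taylor_coeff v j \<longlongrightarrow> y) (at t within stolz 2 t)"
      by (auto simp: W_def tendsto_nontangential_iff)
    show "cmod y \<le> C * nrm v"
    proof (rule tendsto_upperbound[OF tendsto_norm[OF lim]])
      show "\<forall>\<^sub>F w in at t within stolz 2 t. cmod (taylor_coeff v j w) \<le> C * nrm v"
        unfolding eventually_at_filter using C(2) v by (intro always_eventually) auto
    qed (use at_within_stolz_neq_bot[OF t] in simp)
  qed (use C(1) in \<open>auto simp: W_def\<close>)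
  have "(taylor_coeff f j \<longlongrightarrow> ip f g) (nontangential t)" if f: "f \<in> H" for f
    unfolding tendsto_nontangential_iff
  proof (intro allI impI tendstoI)
    fix a e :: real assume a: "1 < a" and e: "0 < e"
    obtain B where B: "0 \<le> B" "\<And>w f. w \<in> stolz a t \<Longrightarrow> f \<in> H \<Longrightarrow> cmod (taylor_coeff f j w) \<le> B * nrm f"
      using bound[OF a] by auto
    \<comment> \<open>Replacing \<open>f\<close> by \<open>v\<close> costs at most
      \<open>(B + nrm g) * nrm (f - v)\<close>, which stays within \<open>e / 2\<close>; the other
      half is for the convergence at \<open>v\<close>. The summand 1 keeps the denominator
      positive.\<close>
    define d where "d = e / (2 * (B + nrm g + 1))"
    have pos: "0 < B + nrm g + 1" using B(1) g(1) by (simp add: add_nonneg_pos)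
    then have d: "0 < d" using e by (simp add: d_def)
    obtain u where u: "u \<in> H" "nrm (f - Q t u) < d" using Q_range_dense[OF t f d] by blast
    define v where "v = Q t u"
    have v: "v \<in> H" using u by (simp add: v_def)
    obtain L where L: "(taylor_coeff v j \<longlongrightarrow> L) (nontangential t)" using conv[OF u(1)] by (auto simp: v_def)
    then have "ip v g = L" using g(2) v by (simp add: W_def)
    with L have "(taylor_coeff v j \<longlongrightarrow> ip v g) (at t within stolz a t)"
      using a by (simp add: tendsto_nontangential_iff)
    then have "\<forall>\<^sub>F w in at t within stolz a t. dist (taylor_coeff v j w) (ip v g) < e / 2"
      using e by (intro tendstoD) auto
    moreover have "\<forall>\<^sub>F w in at t within stolz a t. w \<in> stolz a t" by (simp add: eventually_at_filter)
    ultimately show "\<forall>\<^sub>F w in at t within stolz a t. dist (taylor_coeff f j w) (ip f g) < e"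
    proof eventually_elim
      case (elim w)
      then have w1: "cmod w < 1" by (simp add: stolz_def)
      have eq: "taylor_coeff f j w - ip f g
          = taylor_coeff (f - v) j w + (taylor_coeff v j w - ip v g) - ip (f - v) g"
        using f v g w1 by (simp add: taylor_coeff_minus ip_simps)
      have 1: "cmod (taylor_coeff (f - v) j w) \<le> B * nrm (f - v)"
        by (rule B(2)[OF elim(2) diff_in[OF f v]])
      have 2: "cmod (ip (f - v) g) \<le> nrm (f - v) * nrm g"
        by (rule cauchy_schwarz[OF diff_in[OF f v] g(1)])
      have "cmod (taylor_coeff f j w - ip f g)
          \<le> cmod (taylor_coeff (f - v) j w) + cmod (taylor_coeff v j w - ip v g) + cmod (ip (f - v) g)"
        unfolding eq by (rule order_trans[OF norm_triangle_ineq4 add_right_mono[OF norm_triangle_ineq]])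
      also have "\<dots> \<le> B * nrm (f - v) + cmod (taylor_coeff v j w - ip v g) + nrm (f - v) * nrm g"
        by (intro add_mono order_refl 1 2)
      also have "\<dots> < (B + nrm g) * nrm (f - v) + e / 2"
        using elim by (simp add: dist_norm algebra_simps)
      also have "(B + nrm g) * nrm (f - v) \<le> (B + nrm g + 1) * d"
        using u(2) B(1) g(1) f v by (intro mult_mono) (auto simp: v_def)
      also have "(B + nrm g + 1) * d = e / 2" using pos by (simp add: d_def field_simps)
      finally show ?case by (simp add: dist_norm)
    qed
  qed
  with g(1) show ?thesis by blast
qed

text \<open>On the range of \<open>Q t\<close> the coefficient of order \<open>j + 1\<close> of
  \<open>Q t u\<close> at \<open>w\<close> is the coefficient of order \<open>j\<close> of
  \<open>R u\<close> plus \<open>(w - t)\<close> times one bounded in the Stolz angle. Convergence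
  thus follows by induction, starting from the constant \<open>u 0\<close>.\<close>

theorem boundary_functional:
  assumes t: "cmod t = 1" and cj: "cj_condition s t n" and j: "j \<le> n"
  shows "\<exists>g\<in>H. \<forall>f\<in>H. (taylor_coeff f j \<longlongrightarrow> ip f g) (nontangential t)"
  using j
proof (induction j)
  case 0
  have bound: "\<exists>C\<ge>0. \<forall>w\<in>stolz a t. \<forall>f\<in>H. cmod (taylor_coeff f 0 w) \<le> C * nrm f" if "1 < a" for a
    using stolz_bound_le[OF t cj that, of 0] by blast
  show ?case
  proof (rule boundary_functional_if_range[OF t bound])
    fix u assume u: "u \<in> H"
    have "((\<lambda>w. u 0 + (w - t) * taylor_coeff (bshift u) 0 w) \<longlongrightarrow> u 0 + 0) (nontangential t)"
      using u by (intro tendsto_intros tendsto_zero_if_stolz_bound bound) auto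
    moreover have "\<forall>\<^sub>F w in nontangential t. u 0 + (w - t) * taylor_coeff (bshift u) 0 w = taylor_coeff (Q t u) 0 w"
      using eventually_ball_nontangential[of t]
    proof eventually_elim
      case (elim w)
      then show ?case using Q_eval[OF u, of w] Q_change[of t u w] by simp
    qed
    ultimately show "\<exists>L. (taylor_coeff (Q t u) 0 \<longlongrightarrow> L) (nontangential t)"
      using Lim_transform_eventually by blast
  qed
next
  case (Suc j)
  have bound: "\<exists>C\<ge>0. \<forall>w\<in>stolz a t. \<forall>f\<in>H. cmod (taylor_coeff f (Suc j) w) \<le> C * nrm f" if "1 < a" for a
    using stolz_bound_le[OF t cj that Suc.prems] .
  obtain g where g: "\<And>f. f \<in> H \<Longrightarrow> (taylor_coeff f j \<longlongrightarrow> ip f g) (nontangential t)"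
    using Suc by auto
  show ?case
  proof (rule boundary_functional_if_range[OF t bound])
    fix u assume u: "u \<in> H"
    have "((\<lambda>w. taylor_coeff (bshift u) j w + (w - t) * taylor_coeff (bshift u) (Suc j) w)
        \<longlongrightarrow> ip (bshift u) g + 0) (nontangential t)"
      using u by (intro tendsto_add tendsto_zero_if_stolz_bound bound g) auto
    moreover have "\<forall>\<^sub>F w in nontangential t.
        taylor_coeff (bshift u) j w + (w - t) * taylor_coeff (bshift u) (Suc j) w = taylor_coeff (Q t u) (Suc j) w"
      using eventually_ball_nontangential[of t]
    proof eventually_elim
      case (elim w)
      then show ?case
        using taylor_coeff_Q_Suc[OF u, of w j] u unfolding Q_change[of t u w]
        by (simp add: taylor_coeff_plus taylor_coeff_fscale)
    qed
    ultimately show "\<exists>L. (taylor_coeff (Q t u) (Suc j) \<longlongrightarrow> L) (nontangential t)"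
      using Lim_transform_eventually by blast
  qed
qed

end

section \<open>Boundary coefficients and the Gram matrix\<close>

lemma cnj_mult_self: "cmod t = 1 \<Longrightarrow> cnj t * t = 1"
  using complex_norm_square[of t] by (simp add: mult.commute)

lemma one_minus_cnj_mult: "cmod t = 1 \<Longrightarrow> 1 - cnj t * z = - cnj t * (z - t)"
  using cnj_mult_self[of t] by (simp add: algebra_simps)

context de_branges_rovnyak
begin

lemma kfun_mult: "cmod u < 1 \<Longrightarrow> cmod \<zeta> < 1 \<Longrightarrow> (1 - u * cnj \<zeta>) * kfun \<zeta> u = 1 - s u * cnj (s \<zeta>)"
  using one_minus_mult_cnj_neq_0[of u \<zeta>] by (simp add: kfun_eq)

text \<open>The coefficient of order \<open>j + 1\<close> of the identity \<open>kfun_mult\<close>.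
  Solved for \<open>s\<close> it carries boundary limits from kernel functions over to
  \<open>s\<close>; in the limit \<open>u \<rightarrow> t\<close> it becomes the recursion
  \<open>bder_Suc\<close>.\<close>

lemma taylor_coeff_kfun_Suc:
  assumes u: "cmod u < 1" and \<zeta>: "cmod \<zeta> < 1"
  shows "(1 - u * cnj \<zeta>) * taylor_coeff (kfun \<zeta>) (Suc j) u - cnj \<zeta> * taylor_coeff (kfun \<zeta>) j u
    = - cnj (s \<zeta>) * taylor_coeff s (Suc j) u"
proof -
  have k: "kfun \<zeta> holomorphic_on ball 0 1" using \<zeta> by (intro kfun_holomorphic)
  have "taylor_coeff (\<lambda>u. (1 + (- cnj \<zeta>) * u) * kfun \<zeta> u) (Suc j) u
      = taylor_coeff (\<lambda>u. 1 - cnj (s \<zeta>) * s u) (Suc j) u"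
  proof (rule taylor_coeff_cong[where S = "ball 0 1"])
    fix w :: complex assume "w \<in> ball 0 1"
    then show "(1 + (- cnj \<zeta>) * w) * kfun \<zeta> w = 1 - cnj (s \<zeta>) * s w"
      using kfun_mult[of w \<zeta>] \<zeta> by (simp add: mult.commute)
  qed (use u k in \<open>auto intro!: holomorphic_intros\<close>)
  also have "\<dots> = taylor_coeff (\<lambda>u. 1) (Suc j) u - taylor_coeff (\<lambda>u. cnj (s \<zeta>) * s u) (Suc j) u"
    using u by (intro taylor_coeff_diff[where S = "ball 0 1"] holomorphic_intros s_holomorphic) auto
  also have "\<dots> = - cnj (s \<zeta>) * taylor_coeff s (Suc j) u"
    using taylor_coeff_cmult[OF s_holomorphic, of u "cnj (s \<zeta>)"] u by (simp add: taylor_coeff_const)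
  finally show ?thesis
    using taylor_coeff_affine_mult[OF k, of u 1 "- cnj \<zeta>" j] u by (simp add: mult.commute)
qed

text \<open>The bound of order 0, applied to \<open>kfun z\<close> at \<open>z\<close>, bounds its
  norm in a Stolz angle, and \<open>1 - |s z|^2\<close> is \<open>1 - |z|^2\<close> times the square
  of that norm. The result makes \<open>s\<close> and its boundary value nonzero, so that both can
  be divided by.\<close>

lemma tendsto_norm_s:
  assumes t: "cmod t = 1" and cj: "cj_condition s t n"
  shows "((\<lambda>z. (cmod (s z))\<^sup>2) \<longlongrightarrow> 1) (nontangential t)"
  unfolding tendsto_nontangential_iff
proof (intro allI impI)
  fix a :: real assume a: "1 < a"
  let ?F = "at t within stolz a t"
  obtain C where C: "0 \<le> C" "\<And>w f. w \<in> stolz a t \<Longrightarrow> f \<in> H \<Longrightarrow> cmod (f w) \<le> C * nrm f"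
    using stolz_bound_le[OF t cj a, of 0] by auto
  have "((\<lambda>z. 1 - (cmod (s z))\<^sup>2) \<longlongrightarrow> 0) ?F"
  proof (rule Lim_null_comparison)
    show "\<forall>\<^sub>F z in ?F. norm (1 - (cmod (s z))\<^sup>2) \<le> (1 - (cmod z)\<^sup>2) * C\<^sup>2"
      unfolding eventually_at_filter
    proof (intro always_eventually allI impI)
      fix z assume z: "z \<in> stolz a t"
      then have z1: "cmod z < 1" by (simp add: stolz_def)
      then have k: "kfun z \<in> H" by simp
      have "(nrm (kfun z))\<^sup>2 \<le> C * nrm (kfun z)"
        using C(2)[OF z k] ip_kfun[OF k, of z] z1 complex_Re_le_cmod[of "kfun z z"] by (simp add: nrm_square[OF k])
      then have "nrm (kfun z) \<le> C"
        using C(1) nrm_nonneg[OF k] by (cases "nrm (kfun z) = 0") (auto simp: power2_eq_square)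
      then have *: "(nrm (kfun z))\<^sup>2 \<le> C\<^sup>2" using nrm_nonneg[OF k] by (intro power_mono)
      have pos: "0 < 1 - (cmod z)\<^sup>2" using z1 by (simp add: power_less_one_iff abs_square_less_1)
      have "1 - (cmod (s z))\<^sup>2 = (1 - (cmod z)\<^sup>2) * (nrm (kfun z))\<^sup>2"
        using pos by (simp add: nrm_kfun[OF z1])
      moreover have "0 \<le> 1 - (cmod (s z))\<^sup>2" using s_le_1[OF z1] by (simp add: power_le_one)
      ultimately show "norm (1 - (cmod (s z))\<^sup>2) \<le> (1 - (cmod z)\<^sup>2) * C\<^sup>2"
        using mult_left_mono[OF *, of "1 - (cmod z)\<^sup>2"] pos by simp
    qed
    have "((\<lambda>z. (1 - (cmod z)\<^sup>2) * C\<^sup>2) \<longlongrightarrow> (1 - (cmod t)\<^sup>2) * C\<^sup>2) ?F" by (intro tendsto_intros)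
    then show "((\<lambda>z. (1 - (cmod z)\<^sup>2) * C\<^sup>2) \<longlongrightarrow> 0) ?F" using t by simp
  qed
  from tendsto_diff[OF tendsto_const[of 1] this] show "((\<lambda>z. (cmod (s z))\<^sup>2) \<longlongrightarrow> 1) ?F" by simp
qed

lemma s_nonzero:
  assumes t: "cmod t = 1" and cj: "cj_condition s t n"
  shows "\<exists>\<zeta>. cmod \<zeta> < 1 \<and> s \<zeta> \<noteq> 0"
proof -
  have "\<forall>\<^sub>F z in nontangential t. 0 < (cmod (s z))\<^sup>2"
    by (rule order_tendstoD[OF tendsto_norm_s[OF t cj]]) simp
  with eventually_ball_nontangential[of t]
  have "\<forall>\<^sub>F z in nontangential t. cmod z < 1 \<and> s z \<noteq> 0" by eventually_elim auto
  then show ?thesis using eventually_happens nontangential_neq_bot[OF t] by blast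
qed

lemma taylor_coeff_s_converges_le:
  assumes t: "cmod t = 1" and cj: "cj_condition s t n" and j: "j \<le> n"
  shows "\<exists>L. (taylor_coeff s j \<longlongrightarrow> L) (nontangential t)"
proof -
  obtain \<zeta> where \<zeta>: "cmod \<zeta> < 1" "s \<zeta> \<noteq> 0" using s_nonzero[OF t cj] by blast
  have conv: "\<exists>L. (taylor_coeff (kfun \<zeta>) i \<longlongrightarrow> L) (nontangential t)" if "i \<le> n" for i
    using boundary_functional[OF t cj that] \<zeta> by (meson kfun_in mem_ball_0)
  show ?thesis
  proof (cases j)
    case 0
    obtain L where L: "(kfun \<zeta> \<longlongrightarrow> L) (nontangential t)" using conv[of 0] by auto
    have "((\<lambda>u. (1 - (1 - u * cnj \<zeta>) * kfun \<zeta> u) / cnj (s \<zeta>)) \<longlongrightarrow> (1 - (1 - t * cnj \<zeta>) * L) / cnj (s \<zeta>)) (nontangential t)"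
      using \<zeta> by (intro tendsto_intros L tendsto_ident_nontangential) auto
    moreover have "\<forall>\<^sub>F u in nontangential t. (1 - (1 - u * cnj \<zeta>) * kfun \<zeta> u) / cnj (s \<zeta>) = taylor_coeff s j u"
      using eventually_ball_nontangential[of t]
      by eventually_elim (use \<zeta> in \<open>simp add: 0 kfun_mult\<close>)
    ultimately show ?thesis using Lim_transform_eventually by blast
  next
    case (Suc i)
    obtain L L' where L: "(taylor_coeff (kfun \<zeta>) (Suc i) \<longlongrightarrow> L) (nontangential t)"
      "(taylor_coeff (kfun \<zeta>) i \<longlongrightarrow> L') (nontangential t)" using conv[of "Suc i"] conv[of i] j Suc by auto
    have "((\<lambda>u. ((1 - u * cnj \<zeta>) * taylor_coeff (kfun \<zeta>) (Suc i) u - cnj \<zeta> * taylor_coeff (kfun \<zeta>) i u) / (- cnj (s \<zeta>)))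
        \<longlongrightarrow> ((1 - t * cnj \<zeta>) * L - cnj \<zeta> * L') / (- cnj (s \<zeta>))) (nontangential t)"
      using \<zeta> by (intro tendsto_intros L tendsto_ident_nontangential) auto
    moreover have "\<forall>\<^sub>F u in nontangential t.
        ((1 - u * cnj \<zeta>) * taylor_coeff (kfun \<zeta>) (Suc i) u - cnj \<zeta> * taylor_coeff (kfun \<zeta>) i u) / (- cnj (s \<zeta>))
        = taylor_coeff s j u"
      using eventually_ball_nontangential[of t]
      by eventually_elim (use \<zeta> in \<open>simp add: Suc taylor_coeff_kfun_Suc\<close>)
    ultimately show ?thesis using Lim_transform_eventually by blast
  qed
qed

lemma tendsto_bdry_coeff_le:
  assumes "cmod t = 1" "cj_condition s t n" "j \<le> n"
  shows "(taylor_coeff s j \<longlongrightarrow> bdry_coeff s t j) (nontangential t)"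
  using taylor_coeff_s_converges_le[OF assms] tendsto_bdry_coeff[OF assms(1)] by metis

section \<open>Representers of the boundary coefficients\<close>

definition bder :: "complex \<Rightarrow> nat \<Rightarrow> complex \<Rightarrow> complex" where
  "bder t j = (SOME g. g \<in> H \<and> (\<forall>f\<in>H. (taylor_coeff f j \<longlongrightarrow> ip f g) (nontangential t)))"

lemma bder_in: "cmod t = 1 \<Longrightarrow> cj_condition s t n \<Longrightarrow> j \<le> n \<Longrightarrow> bder t j \<in> H"
  and tendsto_bder: "cmod t = 1 \<Longrightarrow> cj_condition s t n \<Longrightarrow> j \<le> n \<Longrightarrow> f \<in> H \<Longrightarrow>
    (taylor_coeff f j \<longlongrightarrow> ip f (bder t j)) (nontangential t)"
  unfolding bder_def using someI_ex[OF boundary_functional[unfolded Bex_def]] by blast+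

lemma tendsto_taylor_coeff_kfun:
  assumes "cmod t = 1" "cj_condition s t n" "j \<le> n" "cmod \<zeta> < 1"
  shows "(taylor_coeff (kfun \<zeta>) j \<longlongrightarrow> cnj (bder t j \<zeta>)) (nontangential t)"
  using tendsto_bder[OF assms(1-3), of "kfun \<zeta>"] kfun_ip[OF bder_in[OF assms(1-3)], of \<zeta>] assms(4) by simp

lemma bder_0:
  assumes t: "cmod t = 1" and cj: "cj_condition s t n" and z: "cmod z < 1"
  shows "(1 - cnj t * z) * bder t 0 z = 1 - cnj (bdry_coeff s t 0) * s z"
proof -
  have "((\<lambda>u. (1 - u * cnj z) * kfun z u) \<longlongrightarrow> (1 - t * cnj z) * cnj (bder t 0 z)) (nontangential t)"
    using tendsto_taylor_coeff_kfun[OF t cj _ z, of 0] by (intro tendsto_intros tendsto_ident_nontangential) auto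
  moreover have "\<forall>\<^sub>F u in nontangential t. (1 - u * cnj z) * kfun z u = 1 - s u * cnj (s z)"
    using eventually_ball_nontangential[of t] by eventually_elim (use z in \<open>simp add: kfun_mult\<close>)
  ultimately have "((\<lambda>u. 1 - s u * cnj (s z)) \<longlongrightarrow> (1 - t * cnj z) * cnj (bder t 0 z)) (nontangential t)"
    by (rule Lim_transform_eventually)
  moreover have "((\<lambda>u. 1 - s u * cnj (s z)) \<longlongrightarrow> 1 - bdry_coeff s t 0 * cnj (s z)) (nontangential t)"
    using tendsto_bdry_coeff_le[OF t cj, of 0] by (intro tendsto_intros) auto
  ultimately have "(1 - t * cnj z) * cnj (bder t 0 z) = 1 - bdry_coeff s t 0 * cnj (s z)"
    using tendsto_unique[OF nontangential_neq_bot[OF t]] by blast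
  from arg_cong[OF this, of cnj] show ?thesis by simp
qed

lemma bder_Suc:
  assumes t: "cmod t = 1" and cj: "cj_condition s t n" and j: "Suc j \<le> n" and z: "cmod z < 1"
  shows "(1 - cnj t * z) * bder t (Suc j) z - z * bder t j z = - cnj (bdry_coeff s t (Suc j)) * s z"
proof -
  have "((\<lambda>u. (1 - u * cnj z) * taylor_coeff (kfun z) (Suc j) u - cnj z * taylor_coeff (kfun z) j u)
      \<longlongrightarrow> (1 - t * cnj z) * cnj (bder t (Suc j) z) - cnj z * cnj (bder t j z)) (nontangential t)"
    using j z by (intro tendsto_intros tendsto_ident_nontangential tendsto_taylor_coeff_kfun[OF t cj]) auto
  moreover have "\<forall>\<^sub>F u in nontangential t.
      (1 - u * cnj z) * taylor_coeff (kfun z) (Suc j) u - cnj z * taylor_coeff (kfun z) j u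
      = - cnj (s z) * taylor_coeff s (Suc j) u"
    using eventually_ball_nontangential[of t]
    by eventually_elim (use z in \<open>simp add: taylor_coeff_kfun_Suc\<close>)
  ultimately have "((\<lambda>u. - cnj (s z) * taylor_coeff s (Suc j) u)
      \<longlongrightarrow> (1 - t * cnj z) * cnj (bder t (Suc j) z) - cnj z * cnj (bder t j z)) (nontangential t)"
    by (rule Lim_transform_eventually)
  moreover have "((\<lambda>u. - cnj (s z) * taylor_coeff s (Suc j) u) \<longlongrightarrow> - cnj (s z) * bdry_coeff s t (Suc j)) (nontangential t)"
    using j by (intro tendsto_intros tendsto_bdry_coeff_le[OF t cj])
  ultimately have "(1 - t * cnj z) * cnj (bder t (Suc j) z) - cnj z * cnj (bder t j z)
      = - cnj (s z) * bdry_coeff s t (Suc j)"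
    using tendsto_unique[OF nontangential_neq_bot[OF t]] by blast
  from arg_cong[OF this, of cnj] show ?thesis by (simp add: mult.commute)
qed

lemma bdry_coeff_0_neq_0:
  assumes t: "cmod t = 1" and cj: "cj_condition s t n"
  shows "bdry_coeff s t 0 \<noteq> 0"
proof
  assume "bdry_coeff s t 0 = 0"
  then have "(s \<longlongrightarrow> 0) (nontangential t)" using tendsto_bdry_coeff_le[OF t cj, of 0] by simp
  then have "((\<lambda>z. (cmod (s z))\<^sup>2) \<longlongrightarrow> (cmod 0)\<^sup>2) (nontangential t)" by (intro tendsto_intros)
  with tendsto_norm_s[OF t cj] have "1 = (cmod 0)\<^sup>2" using tendsto_unique[OF nontangential_neq_bot[OF t]] by blast
  then show False by simp
qed

text \<open>Unrolls the recursion after clearing denominators. At \<open>t\<close> all terms of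
  \<open>p\<close> with a factor \<open>1 - cnj t z\<close> vanish, leaving \<open>t^m\<close> times
  the conjugate boundary value of \<open>s\<close>; this nonzero value later permits division by
  \<open>p\<close>.\<close>

lemma bder_mult_power:
  assumes t: "cmod t = 1" and cj: "cj_condition s t n" and m: "m \<le> n"
  shows "\<exists>p. p holomorphic_on UNIV \<and> p t \<noteq> 0 \<and>
    (\<forall>z. cmod z < 1 \<longrightarrow> (1 - cnj t * z) ^ Suc m * bder t m z = z ^ m - s z * p z)"
  using m
proof (induction m)
  case 0
  show ?case
    using bder_0[OF t cj] bdry_coeff_0_neq_0[OF t cj]
    by (intro exI[of _ "\<lambda>_. cnj (bdry_coeff s t 0)"]) (auto simp: mult.commute)
next
  case (Suc m)
  then obtain p where p: "p holomorphic_on UNIV" "p t \<noteq> 0"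
    "\<And>z. cmod z < 1 \<Longrightarrow> (1 - cnj t * z) ^ Suc m * bder t m z = z ^ m - s z * p z" by auto
  define q where "q = (\<lambda>z. z * p z + (1 - cnj t * z) ^ Suc m * cnj (bdry_coeff s t (Suc m)))"
  have "q holomorphic_on UNIV" unfolding q_def by (intro holomorphic_intros p)
  moreover have "q t \<noteq> 0" using p(2) t cnj_mult_self[OF t] by (auto simp: q_def)
  moreover have "(1 - cnj t * z) ^ Suc (Suc m) * bder t (Suc m) z = z ^ Suc m - s z * q z" if z: "cmod z < 1" for z
  proof -
    have "(1 - cnj t * z) ^ Suc (Suc m) * bder t (Suc m) z
        = (1 - cnj t * z) ^ Suc m * ((1 - cnj t * z) * bder t (Suc m) z)" by simp
    also have "(1 - cnj t * z) * bder t (Suc m) z = z * bder t m z - cnj (bdry_coeff s t (Suc m)) * s z"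
      using bder_Suc[OF t cj Suc.prems z] by (simp add: algebra_simps)
    also have "(1 - cnj t * z) ^ Suc m * (z * bder t m z - cnj (bdry_coeff s t (Suc m)) * s z)
        = z * ((1 - cnj t * z) ^ Suc m * bder t m z) - (1 - cnj t * z) ^ Suc m * cnj (bdry_coeff s t (Suc m)) * s z"
      by (simp only: right_diff_distrib mult.assoc mult.left_commute)
    finally show ?thesis unfolding p(3)[OF z] by (simp add: q_def algebra_simps)
  qed
  ultimately show ?case by blast
qed

text \<open>
  Since \<open>(1 - cnj t z)\<^sup>n\<^sup>+\<^sup>1 g = z\<^sup>n - s p\<close>, where \<open>g\<close> represents the \<open>n\<close>-th boundary coefficient and
  therefore has boundary coefficients up to order \<open>n\<close> itself, \<open>s\<close> has them up to order \<open>2 n + 1\<close>.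
\<close>

theorem tendsto_bdry_coeff_s:
  assumes t: "cmod t = 1" and cj: "cj_condition s t n" and j: "j \<le> 2 * n + 1"
  shows "(taylor_coeff s j \<longlongrightarrow> bdry_coeff s t j) (nontangential t)"
proof -
  obtain p where p: "p holomorphic_on UNIV" "p t \<noteq> 0"
    "\<And>z. cmod z < 1 \<Longrightarrow> (1 - cnj t * z) ^ Suc n * bder t n z = z ^ n - s z * p z"
    using bder_mult_power[OF t cj, of n] by auto
  have p': "p holomorphic_on ball 0 1" using p(1) holomorphic_on_subset by blast
  \<comment> \<open>The constant comes from
    \<open>1 - cnj t * z = - cnj t * (z - t)\<close>.\<close>
  define F where "F = (- cnj t) ^ Suc n \<cdot>\<^sub>f bder t n"
  have FH: "F \<in> H" using bder_in[OF t cj, of n] by (simp add: F_def)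
  define V where "V = (\<lambda>z. z ^ n - s z * p z)"
  have V: "V holomorphic_on ball 0 1" unfolding V_def by (intro holomorphic_intros s_holomorphic p')
  have VF: "V z = (z - t) ^ Suc n * F z" if "z \<in> ball 0 1" for z
  proof -
    have "(1 - cnj t * z) ^ Suc n = (- cnj t) ^ Suc n * (z - t) ^ Suc n"
      unfolding one_minus_cnj_mult[OF t] by (rule power_mult_distrib)
    then show ?thesis using p(3)[of z] that by (simp add: V_def F_def mult.assoc mult.left_commute del: power_Suc)
  qed
  have "\<forall>i\<le>n. (taylor_coeff F i \<longlongrightarrow> ip F (bder t i)) (nontangential t)"
    using tendsto_bder[OF t cj _ FH] by blast
  \<comment> \<open>The factor \<open>(z - t)^(n + 1)\<close> raises the range of known coefficients
    from \<open>n\<close> to \<open>n + (n + 1) = 2 * n + 1\<close>.\<close>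
  then have limV: "\<forall>i\<le>n + Suc n. (taylor_coeff V i \<longlongrightarrow> (if i < Suc n then 0 else ip F (bder t (i - Suc n)))) (nontangential t)"
    by (subst (asm) nontangential_expansion_shift[OF t holomorphic_in[OF FH] V VF]) auto
  have Ws: "taylor_coeff (\<lambda>z. s z * p z) i z = taylor_coeff (\<lambda>z. z ^ n) i z - taylor_coeff V i z"
    if z: "z \<in> ball 0 1" for i z
    using taylor_coeff_diff[of "\<lambda>z. z ^ n" "ball 0 1" "\<lambda>z. s z * p z" z i] z s_holomorphic p'
    by (simp add: V_def holomorphic_intros)
  have limW: "\<exists>L. (taylor_coeff (\<lambda>z. s z * p z) i \<longlongrightarrow> L) (nontangential t)" if "i \<le> 2 * n + 1" for i
  proof -
    have "((\<lambda>z. taylor_coeff (\<lambda>z. z ^ n) i z - taylor_coeff V i z) \<longlongrightarrow>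
        taylor_coeff (\<lambda>z. z ^ n) i t - (if i < Suc n then 0 else ip F (bder t (i - Suc n)))) (nontangential t)"
      using limV that by (intro tendsto_intros tendsto_taylor_coeff_entire holomorphic_intros) auto
    moreover have "\<forall>\<^sub>F z in nontangential t. taylor_coeff (\<lambda>z. z ^ n) i z - taylor_coeff V i z
        = taylor_coeff (\<lambda>z. s z * p z) i z"
      using eventually_ball_nontangential[of t] by eventually_elim (rule Ws[symmetric])
    ultimately show ?thesis using Lim_transform_eventually by blast
  qed
  \<comment> \<open>The Leibniz formula for \<open>s * p\<close> is solved for its top term: the
    lower coefficients of \<open>s\<close> converge by induction, and \<open>p\<close> is nonzero
    near \<open>t\<close>.\<close>
  have "\<exists>L. (taylor_coeff s j \<longlongrightarrow> L) (nontangential t)"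
    using j
  proof (induction j rule: less_induct)
    case (less j)
    have "\<forall>i\<in>{..<j}. \<exists>L. (taylor_coeff s i \<longlongrightarrow> L) (nontangential t)" using less by auto
    then obtain L where L: "\<And>i. i < j \<Longrightarrow> (taylor_coeff s i \<longlongrightarrow> L i) (nontangential t)"
      by (metis lessThan_iff)
    obtain W where W: "(taylor_coeff (\<lambda>z. s z * p z) j \<longlongrightarrow> W) (nontangential t)" using limW less.prems by blast
    have "((\<lambda>z. (taylor_coeff (\<lambda>z. s z * p z) j z - (\<Sum>i<j. taylor_coeff s i z * taylor_coeff p (j - i) z)) / p z)
        \<longlongrightarrow> (W - (\<Sum>i<j. L i * taylor_coeff p (j - i) t)) / p t) (nontangential t)"
      using p(2) tendsto_taylor_coeff_entire[OF p(1), of 0 t]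
      by (intro tendsto_intros W L tendsto_taylor_coeff_entire p(1)) auto
    moreover have "\<forall>\<^sub>F z in nontangential t. p z \<noteq> 0"
      using tendsto_taylor_coeff_entire[OF p(1), of 0 t] p(2) by (intro tendsto_imp_eventually_ne) auto
    with eventually_ball_nontangential[of t] have "\<forall>\<^sub>F z in nontangential t.
        (taylor_coeff (\<lambda>z. s z * p z) j z - (\<Sum>i<j. taylor_coeff s i z * taylor_coeff p (j - i) z)) / p z
        = taylor_coeff s j z"
    proof eventually_elim
      case (elim z)
      have "taylor_coeff (\<lambda>z. s z * p z) j z
          = (\<Sum>i<j. taylor_coeff s i z * taylor_coeff p (j - i) z) + taylor_coeff s j z * p z"
        using taylor_coeff_mult[OF s_holomorphic p', of z j] elim(1) by (simp flip: lessThan_Suc_atMost)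
      then show ?case using elim(2) by simp
    qed
    ultimately show ?case using Lim_transform_eventually by blast
  qed
  then show ?thesis using tendsto_bdry_coeff[OF t] by metis
qed

section \<open>Difference quotients of \<open>s\<close> at a boundary point\<close>

definition dquot :: "complex \<Rightarrow> nat \<Rightarrow> complex \<Rightarrow> complex" where
  "dquot t j z = (s z - (\<Sum>l<j. bdry_coeff s t l * (z - t) ^ l)) / (z - t) ^ j"

lemma dquot_holomorphic: "cmod t = 1 \<Longrightarrow> dquot t j holomorphic_on ball 0 1"
  unfolding dquot_def by (intro holomorphic_intros s_holomorphic) auto

lemma dquot_Suc: "z \<noteq> t \<Longrightarrow> (z - t) * dquot t (Suc j) z = dquot t j z - bdry_coeff s t j"
  by (simp add: dquot_def divide_simps)

text \<open>\<open>s\<close> minus its boundary Taylor polynomial has zero coefficients below order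
  \<open>j\<close>, so dividing by \<open>(z - t)^j\<close> shifts the rest down. With
  \<open>Suc j\<close> in place of \<open>j\<close> the limits are the entries of the Hankel
  block.\<close>

lemma tendsto_dquot:
  assumes t: "cmod t = 1" and cj: "cj_condition s t n" and j: "r + j \<le> 2 * n + 1"
  shows "(taylor_coeff (dquot t j) r \<longlongrightarrow> bdry_coeff s t (r + j)) (nontangential t)"
proof -
  define S where "S = (\<lambda>z. \<Sum>l<j. bdry_coeff s t l * (z - t) ^ l)"
  have S: "S holomorphic_on ball 0 1" unfolding S_def by (intro holomorphic_intros)
  define V where "V = (\<lambda>z. s z - S z)"
  have V: "V holomorphic_on ball 0 1" unfolding V_def by (intro holomorphic_intros s_holomorphic S)
  have VF: "V z = (z - t) ^ j * dquot t j z" if "z \<in> ball 0 1" for z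
    using that t by (auto simp: V_def S_def dquot_def)
  have "(taylor_coeff V i \<longlongrightarrow> (if i < j then 0 else bdry_coeff s t ((i - j) + j))) (nontangential t)"
    if "i \<le> r + j" for i
  proof -
    have "((\<lambda>z. taylor_coeff s i z - taylor_coeff S i z) \<longlongrightarrow>
        bdry_coeff s t i - (if i < j then bdry_coeff s t i else 0)) (nontangential t)"
      unfolding S_def using that j
      by (intro tendsto_intros tendsto_bdry_coeff_s[OF t cj] tendsto_taylor_coeff_poly) auto
    moreover have "\<forall>\<^sub>F z in nontangential t. taylor_coeff s i z - taylor_coeff S i z = taylor_coeff V i z"
      using eventually_ball_nontangential[of t]
      by eventually_elim (simp add: V_def taylor_coeff_diff[OF s_holomorphic S])
    ultimately have "(taylor_coeff V i \<longlongrightarrow> bdry_coeff s t i - (if i < j then bdry_coeff s t i else 0)) (nontangential t)"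
      by (rule Lim_transform_eventually)
    then show ?thesis by (cases "i < j") auto
  qed
  then have "\<forall>i\<le>r. (taylor_coeff (dquot t j) i \<longlongrightarrow> bdry_coeff s t (i + j)) (nontangential t)"
    by (subst nontangential_expansion_shift[OF t dquot_holomorphic[OF t] V VF,
        where a = "\<lambda>i. bdry_coeff s t (i + j)" and b = "\<lambda>i. if i < j then 0 else bdry_coeff s t ((i - j) + j)"]) auto
  then show ?thesis by blast
qed

text \<open>Entry \<open>(j, m)\<close> of the product of \<open>Psi_mat\<close> and
  \<open>toeplitz_mat\<close>; terms with \<open>l < j\<close> vanish through the binomial.\<close>

definition psi_coeff :: "complex \<Rightarrow> nat \<Rightarrow> nat \<Rightarrow> complex" where
  "psi_coeff t m j = (\<Sum>l\<le>m. (-1) ^ l * of_nat (l choose j) * t ^ (l + j + 1) * cnj (bdry_coeff s t (m - l)))"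

lemma psi_coeff_0: "psi_coeff t 0 j = (if j = 0 then t * cnj (bdry_coeff s t 0) else 0)"
  by (simp add: psi_coeff_def)

lemma psi_coeff_eq_0: "m < j \<Longrightarrow> psi_coeff t m j = 0"
  unfolding psi_coeff_def by (rule sum.neutral) auto

text \<open>Pascal's rule after shifting the summation index. The factor \<open>- cnj t\<close>
  removes one power of \<open>t\<close> and one sign, and is the one produced by
  \<open>1 - cnj t * z = - cnj t * (z - t)\<close>.\<close>

lemma psi_coeff_Suc:
  assumes t: "cmod t = 1"
  shows "- cnj t * psi_coeff t (Suc m) j = psi_coeff t m j
    + (if j = 0 then - cnj (bdry_coeff s t (Suc m)) else t * psi_coeff t m (j - 1))"
proof -
  define c where "c = (\<lambda>l. cnj (bdry_coeff s t (m - l)))"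
  have ct: "cnj t * (t * x) = x" for x using cnj_mult_self[OF t] by (simp flip: mult.assoc)
  have "psi_coeff t (Suc m) j = of_nat (0 choose j) * t ^ (j + 1) * cnj (bdry_coeff s t (Suc m))
      + (\<Sum>l\<le>m. (-1) ^ Suc l * of_nat (Suc l choose j) * t ^ (Suc l + j + 1) * c l)"
    unfolding psi_coeff_def c_def by (subst sum.atMost_Suc_shift) simp
  then have "- cnj t * psi_coeff t (Suc m) j
      = - cnj t * (of_nat (0 choose j) * t ^ (j + 1) * cnj (bdry_coeff s t (Suc m)))
      + (\<Sum>l\<le>m. - cnj t * ((-1) ^ Suc l * of_nat (Suc l choose j) * t ^ (Suc l + j + 1) * c l))"
    by (simp only: distrib_left sum_distrib_left)
  also have "- cnj t * (of_nat (0 choose j) * t ^ (j + 1) * cnj (bdry_coeff s t (Suc m)))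
      = (if j = 0 then - cnj (bdry_coeff s t (Suc m)) else 0)"
    by (simp add: ct mult.assoc)
  also have "(\<Sum>l\<le>m. - cnj t * ((-1) ^ Suc l * of_nat (Suc l choose j) * t ^ (Suc l + j + 1) * c l))
      = (\<Sum>l\<le>m. (-1) ^ l * of_nat (l choose j) * t ^ (l + j + 1) * c l
          + (if j = 0 then 0 else t * ((-1) ^ l * of_nat (l choose (j - 1)) * t ^ (l + (j - 1) + 1) * c l)))"
  proof (intro sum.cong refl)
    fix l
    have "- cnj t * ((-1) ^ Suc l * of_nat (Suc l choose j) * t ^ (Suc l + j + 1) * c l)
        = (cnj t * (t * (t ^ (l + j + 1) * ((-1) ^ l * of_nat (Suc l choose j) * c l))))"
      by (simp add: algebra_simps)
    also have "\<dots> = (-1) ^ l * of_nat (Suc l choose j) * t ^ (l + j + 1) * c l"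
      unfolding ct by (simp only: mult.commute mult.left_commute mult.assoc)
    finally show "- cnj t * ((-1) ^ Suc l * of_nat (Suc l choose j) * t ^ (Suc l + j + 1) * c l)
        = (-1) ^ l * of_nat (l choose j) * t ^ (l + j + 1) * c l
          + (if j = 0 then 0 else t * ((-1) ^ l * of_nat (l choose (j - 1)) * t ^ (l + (j - 1) + 1) * c l))"
      by (cases j) (simp_all add: algebra_simps)
  qed
  also have "\<dots> = psi_coeff t m j + (if j = 0 then 0 else t * psi_coeff t m (j - 1))"
    by (simp add: sum.distrib psi_coeff_def c_def sum_distrib_left mult.assoc)
  finally show ?thesis by simp
qed

lemma boundary_pole_vanishes:
  assumes t: "cmod t = 1"
    and eq: "\<And>z. cmod z < 1 \<Longrightarrow> (1 - cnj t * z) * d z = c"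
    and lim: "(d \<longlongrightarrow> L) (nontangential t)" and z: "cmod z < 1"
  shows "d z = 0"
proof -
  have "((\<lambda>z. (1 - cnj t * z) * d z) \<longlongrightarrow> (1 - cnj t * t) * L) (nontangential t)"
    by (intro tendsto_intros lim tendsto_ident_nontangential)
  moreover have "\<forall>\<^sub>F z in nontangential t. (1 - cnj t * z) * d z = c"
    using eventually_ball_nontangential[of t] by eventually_elim (simp add: eq)
  ultimately have "((\<lambda>_. c) \<longlongrightarrow> (1 - cnj t * t) * L) (nontangential t)" by (rule Lim_transform_eventually)
  then have "c = 0" using nontangential_neq_bot[OF t] cnj_mult_self[OF t] by (simp add: tendsto_const_iff)
  then show ?thesis using eq[OF z] one_minus_mult_cnj_neq_0[OF z, of t] t by (simp add: mult.commute)
qed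

text \<open>
  Both sides satisfy the same recursion in \<open>m\<close> up to additive constants, and have nontangential
  limits at \<open>t\<close>; a difference of the form \<open>c / (1 - cnj t z)\<close> with a finite limit at \<open>t\<close> vanishes.
\<close>

theorem bder_eq_sum_dquot:
  assumes t: "cmod t = 1" and cj: "cj_condition s t n" and m: "m \<le> n" and z: "cmod z < 1"
  shows "bder t m z = (\<Sum>j\<le>n. psi_coeff t m j * dquot t (Suc j) z)"
proof -
  define G where "G = (\<lambda>m z. \<Sum>j\<le>n. psi_coeff t m j * dquot t (Suc j) z)"
  define \<sigma> where "\<sigma> = bdry_coeff s t"
  have zt: "z \<noteq> t" if "cmod z < 1" for z using that t by auto
  have lim: "((\<lambda>z. bder t m z - G m z) \<longlongrightarrow> ip (bder t m) (bder t 0) - (\<Sum>j\<le>n. psi_coeff t m j * \<sigma> (0 + Suc j))) (nontangential t)"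
    if "m \<le> n" for m
  proof -
    have 1: "(bder t m \<longlongrightarrow> ip (bder t m) (bder t 0)) (nontangential t)"
      using tendsto_bder[OF t cj, of 0 "bder t m"] bder_in[OF t cj that] by simp
    have 2: "(dquot t (Suc j) \<longlongrightarrow> \<sigma> (0 + Suc j)) (nontangential t)" if "j \<le> n" for j
      using tendsto_dquot[OF t cj, of 0 "Suc j"] that by (simp add: \<sigma>_def)
    show ?thesis unfolding G_def by (intro tendsto_intros 1 2) auto
  qed
  have mult_G: "(1 - cnj t * z) * G m z = (\<Sum>j\<le>n. (- cnj t * psi_coeff t m j) * (dquot t j z - \<sigma> j))"
    if "cmod z < 1" for m z
    unfolding G_def sum_distrib_left one_minus_cnj_mult[OF t] \<sigma>_def
    by (intro sum.cong refl) (simp flip: dquot_Suc[OF zt[OF that]])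
  have z_G: "z * G m z = (\<Sum>j\<le>n. psi_coeff t m j * (dquot t j z - \<sigma> j)) + t * G m z" if "cmod z < 1" for m z
  proof -
    have "z * G m z - t * G m z = (z - t) * G m z" by (simp add: algebra_simps)
    also have "\<dots> = (\<Sum>j\<le>n. psi_coeff t m j * (dquot t j z - \<sigma> j))"
      unfolding G_def sum_distrib_left \<sigma>_def dquot_Suc[OF zt[OF that], symmetric]
      by (intro sum.cong refl) simp
    finally show ?thesis by (simp add: algebra_simps)
  qed
  have "\<forall>z. cmod z < 1 \<longrightarrow> bder t m z = G m z" using m
  proof (induction m)
    case 0
    have "(1 - cnj t * z) * (bder t 0 z - G 0 z) = 1 - cnj (\<sigma> 0) * \<sigma> 0" if z: "cmod z < 1" for z
    proof -
      have "(1 - cnj t * z) * G 0 z = (\<Sum>j\<le>n. if j = 0 then - cnj (\<sigma> 0) * (s z - \<sigma> 0) else 0)"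
        unfolding mult_G[OF z]
      proof (intro sum.cong refl)
        fix j
        have "cnj t * (t * x) = x" for x using cnj_mult_self[OF t] by (simp flip: mult.assoc)
        then show "- cnj t * psi_coeff t 0 j * (dquot t j z - \<sigma> j) = (if j = 0 then - cnj (\<sigma> 0) * (s z - \<sigma> 0) else 0)"
          by (simp add: psi_coeff_0 dquot_def \<sigma>_def)
      qed
      then show ?thesis using bder_0[OF t cj z] by (simp add: right_diff_distrib \<sigma>_def)
    qed
    from boundary_pole_vanishes[OF t this lim] show ?case by auto
  next
    case (Suc m)
    \<comment> \<open>Collects the constants \<open>\<sigma> j\<close> split off by
      \<open>dquot_Suc\<close>; \<open>boundary_pole_vanishes\<close> disposes of them
      together.\<close>
    define c where "c = (\<Sum>j\<le>n. if j = 0 then cnj (\<sigma> (Suc m)) * \<sigma> 0 else - t * psi_coeff t m (j - 1) * \<sigma> j)"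
    have "(1 - cnj t * z) * (bder t (Suc m) z - G (Suc m) z) = - c" if z: "cmod z < 1" for z
    proof -
      have "(1 - cnj t * z) * G (Suc m) z = (\<Sum>j\<le>n. psi_coeff t m j * (dquot t j z - \<sigma> j)
          + (if j = 0 then - cnj (\<sigma> (Suc m)) else t * psi_coeff t m (j - 1)) * (dquot t j z - \<sigma> j))"
        unfolding mult_G[OF z] psi_coeff_Suc[OF t] distrib_right \<sigma>_def ..
      also have "\<dots> = z * G m z - t * G m z
          + (\<Sum>j\<le>n. (if j = 0 then - cnj (\<sigma> (Suc m)) else t * psi_coeff t m (j - 1)) * (dquot t j z - \<sigma> j))"
        by (simp add: sum.distrib z_G[OF z])
      also have "(\<Sum>j\<le>n. (if j = 0 then - cnj (\<sigma> (Suc m)) else t * psi_coeff t m (j - 1)) * (dquot t j z - \<sigma> j))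
          = (\<Sum>j\<le>n. (if j = 0 then - cnj (\<sigma> (Suc m)) * s z else t * psi_coeff t m (j - 1) * dquot t j z)) + c"
        unfolding c_def sum.distrib[symmetric]
        by (intro sum.cong refl) (auto simp: dquot_def algebra_simps)
      also have "(\<Sum>j\<le>n. (if j = 0 then - cnj (\<sigma> (Suc m)) * s z else t * psi_coeff t m (j - 1) * dquot t j z))
          = - cnj (\<sigma> (Suc m)) * s z + t * G m z"
      proof -
        obtain n' where n': "n = Suc n'" using Suc.prems by (cases n) auto
        \<comment> \<open>Because \<open>m < n\<close>, the top term of \<open>G m\<close> is
          absent, so the shift from \<open>j - 1\<close> to \<open>j\<close> loses nothing at the
          upper end of the sum.\<close>
        have "psi_coeff t m n = 0" using Suc.prems by (intro psi_coeff_eq_0) auto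
        then have "G m z = (\<Sum>j\<le>n'. psi_coeff t m j * dquot t (Suc j) z)" by (simp add: G_def n')
        then show ?thesis unfolding n' sum.atMost_Suc_shift by (simp add: sum_distrib_left mult.assoc)
      qed
      finally have "(1 - cnj t * z) * G (Suc m) z = z * G m z - cnj (\<sigma> (Suc m)) * s z + c" by simp
      moreover have "(1 - cnj t * z) * bder t (Suc m) z = z * bder t m z - cnj (\<sigma> (Suc m)) * s z"
        using bder_Suc[OF t cj Suc.prems z] by (simp add: \<sigma>_def algebra_simps)
      ultimately show ?thesis using Suc z by (simp add: right_diff_distrib)
    qed
    from boundary_pole_vanishes[OF t this lim[OF Suc.prems]] show ?case by auto
  qed
  then show ?thesis using z by (simp add: G_def)
qed

text \<open>Pairing with \<open>bder \<tau> r\<close> takes the \<open>r\<close>-th boundary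
  coefficient at \<open>\<tau>\<close>, which the expansion in difference quotients allows to be
  computed term by term.\<close>

lemma ip_bder_bder:
  assumes t: "cmod t = 1" and cj: "cj_condition s t n" and m: "m \<le> n"
    and \<tau>: "cmod \<tau> = 1" and cj': "cj_condition s \<tau> n'" and r: "r \<le> n'"
    and lim: "\<And>j. j \<le> n \<Longrightarrow> (taylor_coeff (dquot t (Suc j)) r \<longlongrightarrow> h j) (nontangential \<tau>)"
  shows "ip (bder t m) (bder \<tau> r) = (\<Sum>j\<le>n. h j * psi_coeff t m j)"
proof -
  have b: "bder t m \<in> H" using bder_in[OF t cj m] .
  have hol: "dquot t j holomorphic_on ball 0 1" for j using dquot_holomorphic[OF t] .
  have "((\<lambda>z. \<Sum>j\<le>n. psi_coeff t m j * taylor_coeff (dquot t (Suc j)) r z) \<longlongrightarrow> (\<Sum>j\<le>n. psi_coeff t m j * h j)) (nontangential \<tau>)"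
    by (intro tendsto_intros lim) auto
  moreover have "\<forall>\<^sub>F z in nontangential \<tau>. (\<Sum>j\<le>n. psi_coeff t m j * taylor_coeff (dquot t (Suc j)) r z) = taylor_coeff (bder t m) r z"
    using eventually_ball_nontangential[of \<tau>]
  proof eventually_elim
    case (elim z)
    have "taylor_coeff (bder t m) r z = taylor_coeff (\<lambda>z. \<Sum>j\<le>n. psi_coeff t m j * dquot t (Suc j) z) r z"
      by (rule taylor_coeff_cong[OF holomorphic_in[OF b]]) (use elim bder_eq_sum_dquot[OF t cj m] in auto)
    also have "\<dots> = (\<Sum>j\<le>n. psi_coeff t m j * taylor_coeff (dquot t (Suc j)) r z)"
      using elim hol
      by (subst taylor_coeff_sum[where S = "ball 0 1"])
        (auto intro!: holomorphic_intros sum.cong taylor_coeff_cmult[where S = "ball 0 1"])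
    finally show ?case by simp
  qed
  ultimately have "(taylor_coeff (bder t m) r \<longlongrightarrow> (\<Sum>j\<le>n. psi_coeff t m j * h j)) (nontangential \<tau>)"
    by (rule Lim_transform_eventually)
  with tendsto_bder[OF \<tau> cj' r b] show ?thesis
    using tendsto_unique[OF nontangential_neq_bot[OF \<tau>]] by (simp add: mult.commute)
qed

text \<open>Away from \<open>t\<close> the quotient is \<open>s\<close> times
  \<open>(z - t)^(-m-1)\<close> minus finitely many explicit pole terms. The Leibniz rule for the
  product and \<open>taylor_coeff_inverse_power\<close> for the poles yield the two sums of
  \<open>H_off\<close>.\<close>

lemma tendsto_dquot_other_point:
  assumes t: "cmod t = 1" and \<tau>: "cmod \<tau> = 1" and cj: "cj_condition s \<tau> n'" and r: "r \<le> n'"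
    and ne: "\<tau> \<noteq> t"
  shows "(taylor_coeff (dquot t (Suc m)) r \<longlongrightarrow>
    (\<Sum>l=0..r. (-1) ^ (r - l) * of_nat ((m + r - l) choose m) * bdry_coeff s \<tau> l / (\<tau> - t) ^ (m + r - l + 1))
   - (\<Sum>l=0..m. (-1) ^ r * of_nat ((m + r - l) choose r) * bdry_coeff s t l / (\<tau> - t) ^ (m + r - l + 1)))
    (nontangential \<tau>)"
proof -
  let ?I = "\<lambda>k z. 1 / (z - t) ^ Suc k"
  have I: "?I k holomorphic_on ball 0 1" for k using t by (intro holomorphic_intros) auto
  have lim: "((\<lambda>z. (\<Sum>l\<le>r. taylor_coeff s l z * ((-1) ^ (r - l) * of_nat ((m + (r - l)) choose (r - l)) / (z - t) ^ (Suc m + (r - l))))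
      - (\<Sum>l\<le>m. bdry_coeff s t l * ((-1) ^ r * of_nat (((m - l) + r) choose r) / (z - t) ^ (Suc (m - l) + r))))
    \<longlongrightarrow> (\<Sum>l\<le>r. bdry_coeff s \<tau> l * ((-1) ^ (r - l) * of_nat ((m + (r - l)) choose (r - l)) / (\<tau> - t) ^ (Suc m + (r - l))))
      - (\<Sum>l\<le>m. bdry_coeff s t l * ((-1) ^ r * of_nat (((m - l) + r) choose r) / (\<tau> - t) ^ (Suc (m - l) + r)))) (nontangential \<tau>)"
    using ne r by (intro tendsto_intros tendsto_bdry_coeff_le[OF \<tau> cj] tendsto_ident_nontangential) auto
  have ev: "\<forall>\<^sub>F z in nontangential \<tau>.
      (\<Sum>l\<le>r. taylor_coeff s l z * ((-1) ^ (r - l) * of_nat ((m + (r - l)) choose (r - l)) / (z - t) ^ (Suc m + (r - l))))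
      - (\<Sum>l\<le>m. bdry_coeff s t l * ((-1) ^ r * of_nat (((m - l) + r) choose r) / (z - t) ^ (Suc (m - l) + r)))
      = taylor_coeff (dquot t (Suc m)) r z"
    using eventually_ball_nontangential[of \<tau>]
  proof eventually_elim
    case (elim z)
    have zt: "z \<noteq> t" using elim t by auto
    have "taylor_coeff (dquot t (Suc m)) r z
        = taylor_coeff (\<lambda>z. s z * ?I m z - (\<Sum>l\<le>m. bdry_coeff s t l * ?I (m - l) z)) r z"
    proof (rule taylor_coeff_cong[OF dquot_holomorphic[OF t]])
      fix w :: complex assume "w \<in> ball 0 1"
      then have w: "w - t \<noteq> 0" using t by auto
      have "(w - t) ^ l / (w - t) ^ Suc m = ?I (m - l) w" if "l \<le> m" for l
      proof -
        have "(w - t) ^ Suc m = (w - t) ^ l * (w - t) ^ Suc (m - l)"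
          using that by (simp flip: power_add add: Suc_diff_le)
        then show ?thesis using w by simp
      qed
      then have "(\<Sum>l\<le>m. bdry_coeff s t l * (w - t) ^ l / (w - t) ^ Suc m) = (\<Sum>l\<le>m. bdry_coeff s t l * ?I (m - l) w)"
        by (intro sum.cong refl) (metis atMost_iff times_divide_eq_right)
      then show "dquot t (Suc m) w = s w * ?I m w - (\<Sum>l\<le>m. bdry_coeff s t l * ?I (m - l) w)"
        by (simp add: dquot_def lessThan_Suc_atMost diff_divide_distrib sum_divide_distrib del: power_Suc sum.lessThan_Suc)
    qed (use elim in auto)
    also have "\<dots> = taylor_coeff (\<lambda>z. s z * ?I m z) r z - taylor_coeff (\<lambda>z. \<Sum>l\<le>m. bdry_coeff s t l * ?I (m - l) z) r z"
      using elim by (intro taylor_coeff_diff[where S = "ball 0 1"] holomorphic_on_mult holomorphic_on_sum holomorphic_on_const s_holomorphic I) auto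
    also have "taylor_coeff (\<lambda>z. s z * ?I m z) r z = (\<Sum>l\<le>r. taylor_coeff s l z * taylor_coeff (?I m) (r - l) z)"
      using elim by (intro taylor_coeff_mult[where S = "ball 0 1"] s_holomorphic I) auto
    also have "taylor_coeff (\<lambda>z. \<Sum>l\<le>m. bdry_coeff s t l * ?I (m - l) z) r z
        = (\<Sum>l\<le>m. taylor_coeff (\<lambda>z. bdry_coeff s t l * ?I (m - l) z) r z)"
      using elim by (intro taylor_coeff_sum[where S = "ball 0 1"] holomorphic_on_mult holomorphic_on_const I) auto
    also have "\<dots> = (\<Sum>l\<le>m. bdry_coeff s t l * taylor_coeff (?I (m - l)) r z)"
      using elim by (intro sum.cong refl taylor_coeff_cmult[where S = "ball 0 1"] I) auto
    finally show ?case unfolding taylor_coeff_inverse_power[OF zt] by simp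
  qed
  have 1: "(\<Sum>l\<le>r. bdry_coeff s \<tau> l * ((-1) ^ (r - l) * of_nat ((m + (r - l)) choose (r - l)) / (\<tau> - t) ^ (Suc m + (r - l))))
      = (\<Sum>l=0..r. (-1) ^ (r - l) * of_nat ((m + r - l) choose m) * bdry_coeff s \<tau> l / (\<tau> - t) ^ (m + r - l + 1))"
    unfolding atMost_atLeast0
  proof (intro sum.cong refl)
    fix l assume "l \<in> {0..r}"
    then have "m + r - l = m + (r - l)" by simp
    moreover have "(m + (r - l)) choose (r - l) = (m + (r - l)) choose m"
      using binomial_symmetric[of m "m + (r - l)"] by simp
    ultimately show "bdry_coeff s \<tau> l * ((-1) ^ (r - l) * of_nat ((m + (r - l)) choose (r - l)) / (\<tau> - t) ^ (Suc m + (r - l)))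
        = (-1) ^ (r - l) * of_nat ((m + r - l) choose m) * bdry_coeff s \<tau> l / (\<tau> - t) ^ (m + r - l + 1)"
      by simp
  qed
  have 2: "(\<Sum>l\<le>m. bdry_coeff s t l * ((-1) ^ r * of_nat (((m - l) + r) choose r) / (\<tau> - t) ^ (Suc (m - l) + r)))
      = (\<Sum>l=0..m. (-1) ^ r * of_nat ((m + r - l) choose r) * bdry_coeff s t l / (\<tau> - t) ^ (m + r - l + 1))"
    unfolding atMost_atLeast0 by (intro sum.cong refl) simp
  from Lim_transform_eventually[OF lim ev] show ?thesis unfolding 1 2 .
qed

end

section \<open>The interpolation problem\<close>

lemma set_block_index: "set (block_index k n) = {(i, r). i \<in> {1..k} \<and> r \<le> n i}"
  by (auto simp: block_index_def image_iff less_Suc_eq_le simp del: upt_Suc)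

lemma Psi_mult_toeplitz_entry:
  assumes "a \<le> N" "m \<le> N"
  shows "(Psi_mat N t * toeplitz_mat N c) $$ (a, m)
    = (\<Sum>l\<le>m. (-1) ^ l * of_nat (l choose a) * t ^ (l + a + 1) * cnj (c (m - l)))"
proof -
  have "(Psi_mat N t * toeplitz_mat N c) $$ (a, m)
      = (\<Sum>b\<in>{0..<N + 1}. (if a \<le> b then (-1) ^ b * of_nat (b choose a) * t ^ (b + a + 1) else 0)
          * (if b \<le> m then cnj (c (m - b)) else 0))"
    using assms by (simp add: Psi_mat_def toeplitz_mat_def scalar_prod_def)
  also have "\<dots> = (\<Sum>l\<le>m. (-1) ^ l * of_nat (l choose a) * t ^ (l + a + 1) * cnj (c (m - l)))"
    using assms by (intro sum.mono_neutral_cong_right) (auto simp: not_le)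
  finally show ?thesis .
qed

lemma quadratic_form_eq_sum:
  assumes "A \<in> carrier_mat N N" "u \<in> carrier_vec N"
  shows "(A *\<^sub>v u) \<bullet>c u = (\<Sum>p<N. \<Sum>q<N. A $$ (p, q) * u $ q * cnj (u $ p))"
  using assms by (auto simp: scalar_prod_def lessThan_atLeast0 sum_distrib_right intro!: sum.cong)

lemma col_mat_mult_adjoint_entry:
  assumes "p < dim_vec x" "q < dim_vec x"
  shows "(col_mat x * mat_adjoint (col_mat x)) $$ (p, q) = x $ p * cnj (x $ q)"
  using assms
  by (simp add: col_mat_def mat_adjoint_def scalar_prod_def mat_of_rows_def mat_of_cols_def cols_def)

context de_branges_rovnyak
begin

text \<open>The two cases of \<open>H_block\<close> are the limits of the coefficients of
  \<open>dquot (t j)\<close> at its own node and at a different one, so both reduce to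
  \<open>ip_bder_bder\<close>. The column index belongs to the first argument of \<open>ip\<close>,
  where it is linear.\<close>

lemma P_block_entry:
  assumes t: "cmod (t i) = 1" "cmod (t j) = 1" "i \<noteq> j \<Longrightarrow> t i \<noteq> t j"
    and cj: "cj_condition s (t i) (n i)" "cj_condition s (t j) (n j)"
    and r: "r \<le> n i" and m: "m \<le> n j"
  shows "P_block s t n i j $$ (r, m) = ip (bder (t j) m) (bder (t i) r)"
proof -
  let ?B = "Psi_mat (n j) (t j) * toeplitz_mat (n j) (bdry_coeff s (t j))"
  have carrier: "H_block s t n i j \<in> carrier_mat (n i + 1) (n j + 1)"
    "Psi_mat (n j) (t j) \<in> carrier_mat (n j + 1) (n j + 1)"
    "toeplitz_mat (n j) (bdry_coeff s (t j)) \<in> carrier_mat (n j + 1) (n j + 1)"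
    by (auto simp: H_block_def hankel_mat_def H_off_def Psi_mat_def toeplitz_mat_def)
  then have "P_block s t n i j = H_block s t n i j * ?B"
    unfolding P_block_def by (rule assoc_mult_mat)
  then have "P_block s t n i j $$ (r, m) = (\<Sum>a\<in>{0..<n j + 1}. H_block s t n i j $$ (r, a) * ?B $$ (a, m))"
    using carrier r m by (simp add: scalar_prod_def)
  also have "\<dots> = (\<Sum>a\<le>n j. H_block s t n i j $$ (r, a) * psi_coeff (t j) m a)"
    using m by (intro sum.cong) (auto simp: Psi_mult_toeplitz_entry psi_coeff_def)
  also have "\<dots> = ip (bder (t j) m) (bder (t i) r)"
  proof (rule ip_bder_bder[symmetric, OF t(2) cj(2) m t(1) cj(1) r])
    fix a assume a: "a \<le> n j"
    show "(taylor_coeff (dquot (t j) (Suc a)) r \<longlongrightarrow> H_block s t n i j $$ (r, a)) (nontangential (t i))"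
    proof (cases "i = j")
      case True
      then show ?thesis
        using tendsto_dquot[OF t(2) cj(2), of r "Suc a"] r a by (simp add: H_block_def hankel_mat_def)
    next
      case False
      then show ?thesis
        using tendsto_dquot_other_point[OF t(2) t(1) cj(1) r t(3), of a] r a
        by (simp add: H_block_def H_off_def)
    qed
  qed
  finally show ?thesis .
qed

end

theorem mainTheorem6:
  fixes s :: "complex \<Rightarrow> complex"
    and k :: nat
    and t :: "nat \<Rightarrow> complex"
    and n :: "nat \<Rightarrow> nat"
    and v :: "nat \<Rightarrow> nat \<Rightarrow> complex"
    and H :: "(complex \<Rightarrow> complex) set"
    and ip :: "(complex \<Rightarrow> complex) \<Rightarrow> (complex \<Rightarrow> complex) \<Rightarrow> complex"
  assumes "s \<in> schur_class"
    and "\<And>i. i \<in> {1..k} \<Longrightarrow> t i \<in> sphere 0 1"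
    and "inj_on t {1..k}"
    and "\<And>i. i \<in> {1..k} \<Longrightarrow> cj_condition s (t i) (n i)"
    and "rkhs (ball 0 1) (dbr_kernel s) H ip"
  shows "(\<exists>f\<in>H. rkhs_norm ip f \<le> 1 \<and>
            (\<forall>i\<in>{1..k}. \<forall>j\<in>{0..n i}.
               (taylor_coeff f j \<longlongrightarrow> v i j) (nontangential (t i))))
         \<longleftrightarrow> pos_semidef (P_mat k s t n
               - col_mat (x_vec k n v) * mat_adjoint (col_mat (x_vec k n v)))"
proof -
  interpret de_branges_rovnyak s H ip
    using assms(1,5) by (simp add: de_branges_rovnyak_def de_branges_rovnyak_axioms_def)
  have t: "cmod (t i) = 1" if "i \<in> {1..k}" for i using assms(2)[OF that] by simp
  note cj = assms(4)
  define N where "N = block_size k n"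
  \<comment> \<open>\<open>I\<close> and \<open>J\<close> decode a flat position into block and
    order, so that the problem becomes \<open>N\<close> linear conditions on
    \<open>f\<close>.\<close>
  define I where "I = (\<lambda>p. fst (block_index k n ! p))"
  define J where "J = (\<lambda>p. snd (block_index k n ! p))"
  define g where "g = (\<lambda>p. bder (t (I p)) (J p))"
  define x where "x = (\<lambda>p. v (I p) (J p))"
  have IJ: "I p \<in> {1..k}" "J p \<le> n (I p)" if "p < N" for p
    using nth_mem[of p "block_index k n"] that
    unfolding set_block_index length_block_index I_def J_def N_def by auto
  have IJ_surj: "\<exists>p<N. I p = i \<and> J p = j" if "i \<in> {1..k}" "j \<le> n i" for i j
  proof -
    have "(i, j) \<in> set (block_index k n)" using that by (simp add: set_block_index)
    then obtain p where "p < length (block_index k n)" "block_index k n ! p = (i, j)"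
      by (auto simp: in_set_conv_nth)
    then show ?thesis by (auto simp: I_def J_def N_def length_block_index)
  qed
  have gH: "g p \<in> H" if "p < N" for p
    unfolding g_def by (rule bder_in[OF t[OF IJ(1)[OF that]] cj[OF IJ(1)[OF that]] IJ(2)[OF that]])
  have lim: "(taylor_coeff f (J p) \<longlongrightarrow> ip f (g p)) (nontangential (t (I p)))" if "p < N" "f \<in> H" for f p
    unfolding g_def
    by (rule tendsto_bder[OF t[OF IJ(1)[OF that(1)]] cj[OF IJ(1)[OF that(1)]] IJ(2)[OF that(1)] that(2)])
  have interpolates: "(\<forall>i\<in>{1..k}. \<forall>j\<in>{0..n i}. (taylor_coeff f j \<longlongrightarrow> v i j) (nontangential (t i)))
      \<longleftrightarrow> (\<forall>p<N. ip f (g p) = x p)" if f: "f \<in> H" for f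
  proof (intro iffI ballI allI impI)
    fix p assume p: "p < N"
      and "\<forall>i\<in>{1..k}. \<forall>j\<in>{0..n i}. (taylor_coeff f j \<longlongrightarrow> v i j) (nontangential (t i))"
    then have "(taylor_coeff f (J p) \<longlongrightarrow> x p) (nontangential (t (I p)))"
      using IJ[OF p] by (simp add: x_def)
    then show "ip f (g p) = x p"
      using lim[OF p f] tendsto_unique nontangential_neq_bot t IJ(1)[OF p] by blast
  next
    fix i j assume "\<forall>p<N. ip f (g p) = x p" "i \<in> {1..k}" "j \<in> {0..n i}"
    moreover from this obtain p where "p < N" "I p = i" "J p = j" using IJ_surj[of i j] by auto
    ultimately show "(taylor_coeff f j \<longlongrightarrow> v i j) (nontangential (t i))"
      using lim[of p f] f by (auto simp: x_def)
  qed
  define A where "A = P_mat k s t n - col_mat (x_vec k n v) * mat_adjoint (col_mat (x_vec k n v))"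
  have x_vec: "dim_vec (x_vec k n v) = N" "\<And>p. p < N \<Longrightarrow> x_vec k n v $ p = x p"
    by (auto simp: x_vec_def N_def x_def I_def J_def split_beta)
  have dim_adj: "dim_row (col_mat y) = dim_vec y" "dim_col (mat_adjoint (col_mat y)) = dim_vec y" for y :: "complex vec"
    by (auto simp: col_mat_def mat_adjoint_def)
  have A: "A \<in> carrier_mat N N"
    by (rule carrier_matI) (simp_all add: A_def dim_adj x_vec)
  have A_entry: "A $$ (p, q) = ip (g q) (g p) - x p * cnj (x q)" if p: "p < N" and q: "q < N" for p q
  proof -
    have "P_mat k s t n $$ (p, q) = P_block s t n (I p) (I q) $$ (J p, J q)"
      using p q by (simp add: P_mat_def N_def I_def J_def split_beta)
    also have "\<dots> = ip (g q) (g p)"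
      unfolding g_def
      using P_block_entry[of t "I p" "I q" n "J p" "J q"] t cj IJ[OF p] IJ[OF q] inj_onD[OF assms(3)] by blast
    finally show ?thesis
      using p q col_mat_mult_adjoint_entry[of p "x_vec k n v" q] by (simp add: A_def dim_adj x_vec)
  qed
  define U where "U = (\<lambda>c. \<Sum>p<N. c p \<cdot>\<^sub>f g p)"
  \<comment> \<open>The conjugate appears because a solution \<open>f\<close> has
    \<open>ip (g p) f = cnj (x p)\<close>; thus \<open>Y c\<close> is the value forced on
    \<open>ip (U c) f\<close>.\<close>
  define Y where "Y = (\<lambda>c. \<Sum>p<N. c p * cnj (x p))"
  have UH: "U c \<in> H" for c unfolding U_def using gH by (intro sum_in) simp
  have form: "(\<Sum>p<N. \<Sum>q<N. A $$ (p, q) * c q * cnj (c p)) = of_real ((nrm (U c))\<^sup>2 - (cmod (Y c))\<^sup>2)" for c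
  proof -
    have "(\<Sum>p<N. \<Sum>q<N. A $$ (p, q) * c q * cnj (c p))
        = (\<Sum>p<N. \<Sum>q<N. ip (c q \<cdot>\<^sub>f g q) (c p \<cdot>\<^sub>f g p) - (cnj (c p) * x p) * (c q * cnj (x q)))"
      using gH by (intro sum.cong refl) (simp add: A_entry ip_simps algebra_simps)
    also have "\<dots> = (\<Sum>p<N. \<Sum>q<N. ip (c q \<cdot>\<^sub>f g q) (c p \<cdot>\<^sub>f g p)) - cnj (Y c) * Y c"
      by (simp add: sum_subtractf Y_def sum_product)
    also have "(\<Sum>p<N. \<Sum>q<N. ip (c q \<cdot>\<^sub>f g q) (c p \<cdot>\<^sub>f g p)) = ip (U c) (U c)"
    proof -
      have "ip (U c) (U c) = ip (U c) (\<Sum>p<N. c p \<cdot>\<^sub>f g p)"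
        by (simp only: U_def)
      also have "\<dots> = (\<Sum>p<N. ip (U c) (c p \<cdot>\<^sub>f g p))"
        using gH UH by (intro ip_sum_right) auto
      also have "\<dots> = (\<Sum>p<N. \<Sum>q<N. ip (c q \<cdot>\<^sub>f g q) (c p \<cdot>\<^sub>f g p))"
        unfolding U_def using gH by (intro sum.cong refl ip_sum_left) auto
      finally show ?thesis by simp
    qed
    finally show ?thesis
      using ip_self[OF UH, of c] complex_norm_square[of "Y c"] by (simp add: mult.commute)
  qed
  have psd: "pos_semidef A \<longleftrightarrow> (\<forall>c. cmod (Y c) \<le> nrm (U c))"
  proof -
    have quad: "0 \<le> (A *\<^sub>v u) \<bullet>c u \<longleftrightarrow> cmod (Y (\<lambda>p. u $ p)) \<le> nrm (U (\<lambda>p. u $ p))"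
      if "u \<in> carrier_vec N" for u
    proof -
      have "0 \<le> (A *\<^sub>v u) \<bullet>c u \<longleftrightarrow> (cmod (Y (\<lambda>p. u $ p)))\<^sup>2 \<le> (nrm (U (\<lambda>p. u $ p)))\<^sup>2"
        unfolding quadratic_form_eq_sum[OF A that] form by (simp add: less_eq_complex_def del: of_real_diff)
      also have "\<dots> \<longleftrightarrow> cmod (Y (\<lambda>p. u $ p)) \<le> nrm (U (\<lambda>p. u $ p))"
        using nrm_nonneg[OF UH] by (simp add: abs_le_square_iff[symmetric])
      finally show ?thesis .
    qed
    \<comment> \<open>Coefficients are functions on all naturals, but only the entries below
      \<open>N\<close> enter, so passing to vectors loses nothing.\<close>
    have "cmod (Y c) \<le> nrm (U c) \<longleftrightarrow> cmod (Y (\<lambda>p. vec N c $ p)) \<le> nrm (U (\<lambda>p. vec N c $ p))" for c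
    proof -
      have "U (\<lambda>p. vec N c $ p) = U c" "Y (\<lambda>p. vec N c $ p) = Y c"
        by (simp_all add: U_def Y_def)
      then show ?thesis by simp
    qed
    moreover have "pos_semidef A \<longleftrightarrow> (\<forall>u\<in>carrier_vec N. cmod (Y (\<lambda>p. u $ p)) \<le> nrm (U (\<lambda>p. u $ p)))"
      using A quad by (auto simp: pos_semidef_def)
    ultimately show ?thesis by (metis vec_carrier)
  qed
  have "(\<exists>f\<in>H. nrm f \<le> 1 \<and> (\<forall>p<N. ip f (g p) = x p)) \<longleftrightarrow> (\<forall>c. cmod (Y c) \<le> nrm (U c))"
  proof (intro iffI allI)
    fix c assume "\<exists>f\<in>H. nrm f \<le> 1 \<and> (\<forall>p<N. ip f (g p) = x p)"
    then obtain f where f: "f \<in> H" "nrm f \<le> 1" "\<And>p. p < N \<Longrightarrow> ip f (g p) = x p" by blast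
    have "ip (U c) f = (\<Sum>p<N. ip (c p \<cdot>\<^sub>f g p) f)"
      unfolding U_def using gH f(1) by (intro ip_sum_left) auto
    also have "\<dots> = Y c"
      unfolding Y_def using gH f by (intro sum.cong refl) (simp add: ip_scale_right ip_cnj[of f])
    finally have "cmod (Y c) \<le> nrm (U c) * nrm f" using cauchy_schwarz[OF UH f(1), of c] by simp
    also have "\<dots> \<le> nrm (U c) * 1" using f(2) UH by (intro mult_left_mono) auto
    finally show "cmod (Y c) \<le> nrm (U c)" by simp
  next
    assume le: "\<forall>c. cmod (Y c) \<le> nrm (U c)"
    \<comment> \<open>The \<open>g p\<close> may be linearly dependent, so \<open>Y\<close> need not
      visibly factor through \<open>U\<close>; the relation together with the bound takes care of
      this.\<close>
    define W where "W = {(U c, Y c) | c. True}"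
    have W: "(U c, Y c) \<in> W" for c by (auto simp: W_def)
    obtain f where f: "f \<in> H" "nrm f \<le> 1" "\<And>u y. (u, y) \<in> W \<Longrightarrow> ip u f = y"
    proof (rule riesz_on_subspace[of W 1])
      show "(0, 0) \<in> W" using W[of "\<lambda>_. 0"] by (simp add: U_def Y_def)
    next
      fix u y u' y' assume "(u, y) \<in> W" "(u', y') \<in> W"
      then obtain c c' where "u = U c" "y = Y c" "u' = U c'" "y' = Y c'" by (auto simp: W_def)
      moreover have "U (\<lambda>p. c p + c' p) = U c + U c'"
        unfolding U_def sum.distrib[symmetric] by (intro sum.cong refl) (auto simp: fun_eq_iff algebra_simps)
      moreover have "Y (\<lambda>p. c p + c' p) = Y c + Y c'"
        by (simp add: Y_def sum.distrib distrib_right)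
      ultimately show "(u + u', y + y') \<in> W" using W[of "\<lambda>p. c p + c' p"] by simp
    next
      fix d u y assume "(u, y) \<in> W"
      then obtain c where "u = U c" "y = Y c" by (auto simp: W_def)
      moreover have "U (\<lambda>p. d * c p) = d \<cdot>\<^sub>f U c"
        by (auto simp: U_def fun_eq_iff sum_fun_apply sum_distrib_left mult.assoc)
      moreover have "Y (\<lambda>p. d * c p) = d * Y c"
        by (simp add: Y_def sum_distrib_left mult.assoc)
      ultimately show "(d \<cdot>\<^sub>f u, d * y) \<in> W" using W[of "\<lambda>p. d * c p"] by simp
    qed (use le UH in \<open>auto simp: W_def\<close>)
    have "ip f (g p) = x p" if p: "p < N" for p
    proof -
      \<comment> \<open>The unit coefficient vector at \<open>p\<close> recovers the single
        condition from the pairing with combinations.\<close>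
      define c where "c = (\<lambda>q. if q = p then 1 else 0 :: complex)"
      have "U c z = g p z" for z using p by (simp add: U_def c_def sum_fun_apply if_distrib[of "\<lambda>a. a * _"] cong: if_cong)
      then have "U c = g p" by auto
      moreover have "Y c = cnj (x p)" using p by (simp add: Y_def c_def if_distrib[of "\<lambda>a. a * _"] cong: if_cong)
      ultimately have "ip (g p) f = cnj (x p)" using f(3)[OF W[of c]] by simp
      then show ?thesis using ip_cnj[OF gH[OF p] f(1)] by simp
    qed
    with f show "\<exists>f\<in>H. nrm f \<le> 1 \<and> (\<forall>p<N. ip f (g p) = x p)" by blast
  qed
  then show ?thesis
    unfolding A_def[symmetric] psd using interpolates by (metis (no_types, lifting))
qed

end
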